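(* Let $q\geq 11$ be an odd prime power with $q\equiv2\pmod3$. Then $\mathrm{Aut}(\mathcal X_3)=G$.
   Context: Let $m=(q+1)/3$ and let $\mathcal X_3$ be the nonsingular projective model (defined over $\mathbb F_{q^2}$) of the plane curve $y^{q+1}+x^{2m}+x^m=0$; $\mathrm{Aut}(\mathcal X_3)$ is its full automorphism group over $\overline{\mathbb F}_{q^2}$. $G$ is the group of automorphisms of $\mathcal X_3$ generated by the maps $\theta_{\gamma,\delta}:(x,y)\mapsto(\gamma x,\delta y)$ with $\gamma^m=\delta^{q+1}=1$, together with $\theta_2:(x,y)\mapsto(1/x,\,y/x)$ and $\theta_3:(x,y)\mapsto(y^3/x^2,\,y/x)$; it has order $2(q+1)^2$. *)

theory Defs
  imports "HOL-Computational_Algebra.Polynomial" "HOL-Computational_Algebra.Primes"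
begin

text \<open>We model the function field of the curve over the algebraically closed
  constant field K as a field type 'f containing a subfield K. The curve is the
  nonsingular model of the plane curve y^(q+1) + x^(2m) + x^m = 0, so its function
  field is F = K(x,y) with x transcendental over K and the relation satisfied.
  Automorphisms of the curve correspond (anti-isomorphically) to K-automorphisms
  of F; a point map (x,y) |-> (f(x,y), g(x,y)) corresponds to the automorphism
  sending x to f and y to g.\<close>

definition subfield :: "'f::field set \<Rightarrow> bool" where
  "subfield S \<longleftrightarrow> 0 \<in> S \<and> 1 \<in> S \<and>
     (\<forall>a\<in>S. \<forall>b\<in>S. a + b \<in> S \<and> a * b \<in> S) \<and>
     (\<forall>a\<in>S. - a \<in> S \<and> inverse a \<in> S)"

definition poly_over :: "'f::field set \<Rightarrow> 'f poly \<Rightarrow> bool" where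
  "poly_over K P \<longleftrightarrow> (\<forall>i. coeff P i \<in> K)"

definition alg_closed_subfield :: "'f::field set \<Rightarrow> bool" where
  "alg_closed_subfield K \<longleftrightarrow> subfield K \<and>
     (\<forall>P. poly_over K P \<and> degree P > 0 \<longrightarrow> (\<exists>a\<in>K. poly P a = 0))"

definition transcendental_over :: "'f::field set \<Rightarrow> 'f \<Rightarrow> bool" where
  "transcendental_over K x \<longleftrightarrow> (\<forall>P. poly_over K P \<and> poly P x = 0 \<longrightarrow> P = 0)"

definition generates_field :: "'f::field set \<Rightarrow> bool" where
  "generates_field A \<longleftrightarrow> (\<forall>S. subfield S \<and> A \<subseteq> S \<longrightarrow> S = UNIV)"

definition rel_auts :: "'f::field set \<Rightarrow> ('f \<Rightarrow> 'f) set" where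
  "rel_auts K = {\<sigma>. bij \<sigma> \<and> (\<forall>a b. \<sigma> (a + b) = \<sigma> a + \<sigma> b \<and> \<sigma> (a * b) = \<sigma> a * \<sigma> b)
                     \<and> \<sigma> 1 = 1 \<and> (\<forall>a\<in>K. \<sigma> a = a)}"

inductive_set gen_perm_group :: "('a \<Rightarrow> 'a) set \<Rightarrow> ('a \<Rightarrow> 'a) set" for S where
  gen_id: "id \<in> gen_perm_group S"
| gen_base: "s \<in> S \<Longrightarrow> s \<in> gen_perm_group S"
| gen_comp: "a \<in> gen_perm_group S \<Longrightarrow> b \<in> gen_perm_group S \<Longrightarrow> a \<circ> b \<in> gen_perm_group S"
| gen_inv: "a \<in> gen_perm_group S \<Longrightarrow> inv a \<in> gen_perm_group S"

end

theory Submission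
  imports Defs
begin

text \<open>Put $m = (q+1)/3$ and $z = y^3/x$, so that $x^m + z^m + 1 = 0$ and $xz = y^3$: the curve lies on
  the cubic surface $T_0 T_1 T_3 = T_2^3$ through the coordinates $(1 : x : y : z)$. Let $V$ be the span of
  $1, x, y, z$. It is the whole space $L(D)$, where $D$ is the pole divisor of $x$. For a place $Q$ the
  function $h_Q = 1 + x(Q)^q x + z(Q)^q z - 3 y(Q)^q y$ (rescaled if $x$ has a pole at $Q$) lies in $V$,
  and since $1 + x^{q+1} + z^{q+1} - 3 y^{q+1} = 0$ it vanishes at $Q$ to order at least $q$. At the points
  $P = (\varepsilon, 0)$ with $\varepsilon^m = -1$ the functions $y/(x - \varepsilon)$ and
  $z/(x - \varepsilon)$ have poles only at $P$, of order at most $q$. Hence for an automorphism $\sigma$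
  with $Q = \sigma(P)$ the products of their images with $h_Q$ lie in $L(D) = V$, so that a multiple
  $\varphi\,\sigma(\langle x - \varepsilon, y, z\rangle)$ is contained in $V$. Using two such points $P$, and that no
  quadric contains the curve, $\varphi\,\sigma(V) \subseteq V$. Thus $\sigma$ is a linear map that preserves the
  cubic surface and its three singular points. It is therefore monomial, and monomial automorphisms
  are products of the given generators.\<close>

section \<open>Rings and valuation rings in a field\<close>

text \<open>The obstacle is that nothing says in advance that an automorphism maps the special
  points \<open>(\<epsilon>, 0)\<close> to special points, so a function with many zeros is needed
  at an arbitrary place Q. It comes from a^3 + b^3 + 1 - 3ab, which is divisible by a + b + 1: with
  a = x^m and b = z^m the equation of the curve makes it vanish, and q + 1 = 3m turns it into a form
  that is linear both in the coordinates and in their q-th powers. As q-th powers are additive,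
  freezing them at their values at Q changes the form only by q-th powers of functions vanishing at
  Q. This guarantees q zeros, while 1/(x - \<epsilon>) has a pole of order q + 1. Hence a single
  point P controls only three of the four dimensions of V. Since q is odd, m is even, so -\<epsilon>
  is a second root and supplies the missing direction. Places are valuation rings containing K, and
  conditions on poles are quantified over all of them. Automorphisms act on such rings by preimage,
  so the argument is carried out without divisors, degrees or genus.\<close>

definition subring :: "'f::field set \<Rightarrow> bool" where
  "subring R \<longleftrightarrow> 1 \<in> R \<and> (\<forall>a\<in>R. \<forall>b\<in>R. a + b \<in> R \<and> a * b \<in> R) \<and> (\<forall>a\<in>R. - a \<in> R)"

lemma subringD:
  assumes "subring R"
  shows "1 \<in> R" "0 \<in> R" "\<And>a b. a \<in> R \<Longrightarrow> b \<in> R \<Longrightarrow> a + b \<in> R"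
    "\<And>a b. a \<in> R \<Longrightarrow> b \<in> R \<Longrightarrow> a * b \<in> R" "\<And>a. a \<in> R \<Longrightarrow> - a \<in> R"
    "\<And>a b. a \<in> R \<Longrightarrow> b \<in> R \<Longrightarrow> a - b \<in> R" "\<And>a n. a \<in> R \<Longrightarrow> a ^ n \<in> R"
    "\<And>h I. (\<And>i. i \<in> I \<Longrightarrow> h i \<in> R) \<Longrightarrow> sum h I \<in> R"
proof -
  show *: "1 \<in> R" "\<And>a b. a \<in> R \<Longrightarrow> b \<in> R \<Longrightarrow> a + b \<in> R"
    "\<And>a b. a \<in> R \<Longrightarrow> b \<in> R \<Longrightarrow> a * b \<in> R" "\<And>a. a \<in> R \<Longrightarrow> - a \<in> R"
    using assms by (auto simp: subring_def)
  show d: "a - b \<in> R" if "a \<in> R" "b \<in> R" for a b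
    using *(2)[OF that(1) *(4)[OF that(2)]] by simp
  show z: "0 \<in> R" using d[OF *(1) *(1)] by simp
  show "a ^ n \<in> R" if "a \<in> R" for a n by (induction n) (use * that in auto)
  show "sum h I \<in> R" if "\<And>i. i \<in> I \<Longrightarrow> h i \<in> R" for h I
    using that by (induction I rule: infinite_finite_induct) (use * z in auto)
qed

lemma subfield_subring: "subfield S \<Longrightarrow> subring S"
  by (auto simp: subfield_def subring_def)

lemma subfieldD:
  assumes "subfield S"
  shows "1 \<in> S" "0 \<in> S" "\<And>a b. a \<in> S \<Longrightarrow> b \<in> S \<Longrightarrow> a + b \<in> S"
    "\<And>a b. a \<in> S \<Longrightarrow> b \<in> S \<Longrightarrow> a * b \<in> S" "\<And>a. a \<in> S \<Longrightarrow> - a \<in> S"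
    "\<And>a b. a \<in> S \<Longrightarrow> b \<in> S \<Longrightarrow> a - b \<in> S" "\<And>a n. a \<in> S \<Longrightarrow> a ^ n \<in> S"
    "\<And>h I. (\<And>i. i \<in> I \<Longrightarrow> h i \<in> S) \<Longrightarrow> sum h I \<in> S"
    "\<And>a. a \<in> S \<Longrightarrow> inverse a \<in> S" "\<And>a b. a \<in> S \<Longrightarrow> b \<in> S \<Longrightarrow> a / b \<in> S"
    "\<And>n. of_nat n \<in> S" "\<And>n. numeral n \<in> S"
proof -
  note R = subringD[OF subfield_subring[OF assms]]
  show "1 \<in> S" "0 \<in> S" "\<And>a b. a \<in> S \<Longrightarrow> b \<in> S \<Longrightarrow> a + b \<in> S"
    "\<And>a b. a \<in> S \<Longrightarrow> b \<in> S \<Longrightarrow> a * b \<in> S" "\<And>a. a \<in> S \<Longrightarrow> - a \<in> S"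
    "\<And>a b. a \<in> S \<Longrightarrow> b \<in> S \<Longrightarrow> a - b \<in> S" "\<And>a n. a \<in> S \<Longrightarrow> a ^ n \<in> S"
    "\<And>h I. (\<And>i. i \<in> I \<Longrightarrow> h i \<in> S) \<Longrightarrow> sum h I \<in> S" by (fact R)+
  show i: "inverse a \<in> S" if "a \<in> S" for a using assms that by (auto simp: subfield_def)
  show "a / b \<in> S" if "a \<in> S" "b \<in> S" for a b
    using R(4)[OF that(1) i[OF that(2)]] by (simp add: divide_inverse)
  show n: "of_nat n \<in> S" for n by (induction n) (use R in auto)
  show "numeral n \<in> S" for n using n[of "numeral n"] by simp
qed

definition adjoin :: "'f::field set \<Rightarrow> 'f \<Rightarrow> 'f set" where
  "adjoin R u = {poly P u |P. poly_over R P}"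

lemma poly_over_pCons: "poly_over R (pCons a P) \<longleftrightarrow> a \<in> R \<and> poly_over R P"
  unfolding poly_over_def
proof safe
  fix i assume h: "\<forall>i. coeff (pCons a P) i \<in> R"
  show "a \<in> R" using h[rule_format, of 0] by simp
  show "coeff P i \<in> R" using h[rule_format, of "Suc i"] by simp
next
  fix i assume "a \<in> R" "\<forall>i. coeff P i \<in> R"
  then show "coeff (pCons a P) i \<in> R" by (cases i) auto
qed

lemma poly_over_ring:
  assumes "subring R"
  shows "poly_over R 0" "poly_over R 1" "\<And>P Q. poly_over R P \<Longrightarrow> poly_over R Q \<Longrightarrow> poly_over R (P + Q)"
    "\<And>P Q. poly_over R P \<Longrightarrow> poly_over R Q \<Longrightarrow> poly_over R (P - Q)"
    "\<And>P. poly_over R P \<Longrightarrow> poly_over R (- P)"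
    "\<And>P Q. poly_over R P \<Longrightarrow> poly_over R Q \<Longrightarrow> poly_over R (P * Q)"
    "\<And>a P. a \<in> R \<Longrightarrow> poly_over R P \<Longrightarrow> poly_over R (smult a P)"
    "\<And>a n. a \<in> R \<Longrightarrow> poly_over R (monom a n)"
    "\<And>P n. poly_over R P \<Longrightarrow> poly_over R (P ^ n)"
    "\<And>h I. (\<And>i. i \<in> I \<Longrightarrow> poly_over R (h i)) \<Longrightarrow> poly_over R (sum h I)"
proof -
  note R = subringD[OF assms]
  show a: "poly_over R 0" "poly_over R 1" 
    "\<And>P Q. poly_over R P \<Longrightarrow> poly_over R Q \<Longrightarrow> poly_over R (P + Q)"
    using R by (auto simp: poly_over_def coeff_1)
  show "\<And>P Q. poly_over R P \<Longrightarrow> poly_over R Q \<Longrightarrow> poly_over R (P - Q)"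
    "\<And>P. poly_over R P \<Longrightarrow> poly_over R (- P)"
    "\<And>a P. a \<in> R \<Longrightarrow> poly_over R P \<Longrightarrow> poly_over R (smult a P)"
    "\<And>a n. a \<in> R \<Longrightarrow> poly_over R (monom a n)"
    using R by (auto simp: poly_over_def)
  show m: "poly_over R (P * Q)" if "poly_over R P" "poly_over R Q" for P Q
    using that unfolding poly_over_def coeff_mult by (auto intro!: R)
  show "poly_over R (P ^ n)" if "poly_over R P" for P n
    by (induction n) (use a m that in auto)
  show "poly_over R (sum h I)" if "\<And>i. i \<in> I \<Longrightarrow> poly_over R (h i)" for h I
    using that by (induction I rule: infinite_finite_induct) (use a in auto)
qed

lemma poly_over_mono: "poly_over R P \<Longrightarrow> R \<subseteq> S \<Longrightarrow> poly_over S P"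
  by (auto simp: poly_over_def)

lemma poly_in_subring:
  assumes "subring R" "poly_over R P" "u \<in> R"
  shows "poly P u \<in> R"
  using assms(2) by (induction P) (use subringD[OF assms(1)] assms(3) in \<open>auto simp: poly_over_pCons\<close>)

lemma subring_adjoin:
  assumes "subring R"
  shows "subring (adjoin R u)" "R \<subseteq> adjoin R u" "u \<in> adjoin R u"
proof -
  note P = poly_over_ring[OF assms]
  show "R \<subseteq> adjoin R u"
  proof
    fix a assume "a \<in> R"
    then have "poly_over R [:a:]" "a = poly [:a:] u" by (auto simp: poly_over_pCons P)
    then show "a \<in> adjoin R u" unfolding adjoin_def by blast
  qed
  have "poly_over R [:0, 1:]" "u = poly [:0, 1:] u" using subringD[OF assms] by (auto simp: poly_over_pCons P)
  then show "u \<in> adjoin R u" unfolding adjoin_def by blast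
  show "subring (adjoin R u)"
    unfolding subring_def adjoin_def
  proof (safe, goal_cases)
    case 1 show ?case by (rule exI[of _ 1]) (simp add: P)
  next
    case (2 _ _ A B) then show ?case by (intro exI[of _ "A + B"]) (simp add: P)
  next
    case (3 _ _ A B) then show ?case by (intro exI[of _ "A * B"]) (simp add: P)
  next
    case (4 _ A) then show ?case by (intro exI[of _ "- A"]) (simp add: P)
  qed
qed

section \<open>Valuation rings and Chevalley's extension theorem\<close>

definition valring :: "'f::field set \<Rightarrow> bool" where
  "valring R \<longleftrightarrow> subring R \<and> (\<forall>u. u \<in> R \<or> inverse u \<in> R)"

text \<open>Since \<open>inverse 0 = 0\<close> lies in every ring, zero has to be added to the
  nonunits separately. The whole field counts as a valuation ring, with \<open>{0}\<close> as its
  \<open>maxid\<close>.\<close>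

definition maxid :: "'f::field set \<Rightarrow> 'f set" where
  "maxid R = {u. u = 0 \<or> inverse u \<notin> R}"

lemma pCons_split: "poly_over R P \<Longrightarrow> \<exists>a P'. P = pCons a P' \<and> a \<in> R \<and> poly_over R P' \<and> degree P' = degree P - 1"
  by (cases P) (auto simp: poly_over_pCons)

text \<open>Chevalley's argument: if neither $u$ nor $u^{-1}$ were in $R$, then $t^{-1}$ would be a polynomial in
  each of them, and two such expressions of minimal degrees can be combined to lower a degree.\<close>
lemma maximal_omitting_is_valring:
  fixes R :: "'f::field set"
  assumes R: "subring R" and t: "t \<in> R" and nt: "inverse t \<notin> R"
    and max: "\<And>S. subring S \<Longrightarrow> R \<subseteq> S \<Longrightarrow> inverse t \<notin> S \<Longrightarrow> S = R"
  shows "valring R"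
proof -
  note D = subringD[OF R]
  have t0: "t \<noteq> 0" using nt D(2) by auto
  \<comment> \<open>Elements congruent to 1 modulo \<open>t\<close> are units. If
    \<open>inverse t\<close> lay in R[1/w], clearing denominators would put
    \<open>inverse t * ?w ^ N\<close> in \<open>R\<close>; but \<open>?w ^ N\<close> is 1 modulo
    \<open>t\<close>, so \<open>inverse t\<close> itself would be in \<open>R\<close>. Maximality
    then gives R[1/w] = R.\<close>
  have unit: "inverse (1 - t * b) \<in> R" if b: "b \<in> R" for b
  proof -
    let ?w = "1 - t * b"
    have w0: "?w \<noteq> 0"
    proof
      assume "?w = 0"
      then have "inverse t = b" using t0 by (simp add: field_simps)
      with nt b show False by simp
    qed
    have "inverse t \<notin> adjoin R (inverse ?w)"
    proof
      assume "inverse t \<in> adjoin R (inverse ?w)"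
      then obtain P where P: "poly_over R P" "inverse t = poly P (inverse ?w)"
        by (auto simp: adjoin_def)
      have "\<exists>N. poly Q (inverse ?w) * ?w ^ N \<in> R" if "poly_over R Q" for Q
        using that
      proof (induction Q)
        case 0 then show ?case using D by auto
      next
        case (pCons a Q)
        then obtain N where N: "poly Q (inverse ?w) * ?w ^ N \<in> R" by (auto simp: poly_over_pCons)
        have "poly (pCons a Q) (inverse ?w) * ?w ^ Suc N
            = a * ?w ^ Suc N + poly Q (inverse ?w) * ?w ^ N"
          using w0 by (simp add: field_simps)
        also have "\<dots> \<in> R" using N pCons.prems D t b by (auto simp: poly_over_pCons)
        finally show ?case by blast
      qed
      from this[OF P(1)] obtain N where N: "inverse t * ?w ^ N \<in> R" unfolding P(2) by blast
      have "inverse t * (1 - ?w ^ k) \<in> R" for k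
      proof (induction k)
        case (Suc k)
        have "inverse t * (1 - ?w ^ Suc k) = inverse t * (1 - ?w ^ k) + b * ?w ^ k"
          using t0 by (simp add: field_simps)
        also have "\<dots> \<in> R" using Suc D t b by auto
        finally show ?case .
      qed (use D in auto)
      from D(3)[OF N this[of N]] have "inverse t \<in> R" by (simp add: algebra_simps)
      with nt show False ..
    qed
    then have "adjoin R (inverse ?w) = R" by (intro max subring_adjoin R)
    then show ?thesis using subring_adjoin(3)[OF R] by blast
  qed
  \<comment> \<open>Assuming \<open>degree B \<le> degree A\<close> costs nothing: exchanging
    \<open>u\<close> and \<open>inverse u\<close> exchanges \<open>A\<close> and
    \<open>B\<close>.\<close>
  have main: False
    if "u \<noteq> 0" "poly_over R A" "poly_over R B" "inverse t = poly A u" "inverse t = poly B (inverse u)"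
      "degree B \<le> degree A" for u A B
    using that
  proof (induction "degree A + degree B" arbitrary: A B u rule: less_induct)
    case less
    obtain b B' where B: "B = pCons b B'" "b \<in> R" "poly_over R B'" "degree B' = degree B - 1"
      using pCons_split[OF less.prems(3)] by blast
    define c where "c = inverse (1 - t * b)"
    have cR: "c \<in> R" unfolding c_def by (rule unit) (rule B)
    have cw: "c * (1 - t * b) = 1"
    proof -
      have "1 - t * b \<noteq> 0"
      proof
        assume "1 - t * b = 0"
        then have "inverse t = b" using t0 by (simp add: field_simps)
        with nt B(2) show False by simp
      qed
      then show ?thesis by (simp add: c_def)
    qed
    have dA: "degree A \<noteq> 0"
    proof
      assume "degree A = 0"
      then obtain a where "A = [:a:]" by (rule degree_eq_zeroE)
      with less.prems nt show False by (auto simp: poly_over_pCons)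
    qed
    define n where "n = degree A"
    define a where "a = lead_coeff A"
    have aR: "a \<in> R" using less.prems(2) by (auto simp: a_def poly_over_def)
    \<comment> \<open>The constant term \<open>b\<close> is moved to the left, where
      \<open>1 - t * b\<close> is a unit with inverse \<open>c\<close>. So 1 is a combination of
      negative powers of \<open>u\<close> alone, and multiplication by \<open>u ^ n\<close>
      expresses \<open>u ^ n\<close> by lower powers; this lowers the degree of
      \<open>A\<close>.\<close>
    have eq1: "1 = c * t * poly B' (inverse u) * inverse u"
    proof -
      have "1 = t * (b + inverse u * poly B' (inverse u))" using less.prems(5) t0 B(1) by (simp add: field_simps)
      then have w: "1 - t * b = t * poly B' (inverse u) * inverse u" by (simp add: algebra_simps)
      show ?thesis using cw unfolding w by (simp only: mult_ac)
    qed
    have rev: "\<exists>C. poly_over R C \<and> degree C \<le> k \<and> poly Q (inverse u) * u ^ k = poly C u"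
      if "poly_over R Q" "degree Q \<le> k" for Q k
      using that
    proof (induction Q arbitrary: k)
      case 0 then show ?case using poly_over_ring[OF R] by (intro exI[of _ 0]) auto
    next
      case (pCons d Q)
      have dR: "d \<in> R" "poly_over R Q" using pCons.prems by (auto simp: poly_over_pCons)
      show ?case
      proof (cases "Q = 0")
        case True
        then show ?thesis using dR
          by (intro exI[of _ "monom d k"]) (auto simp: poly_over_ring[OF R] poly_monom degree_monom_le)
      next
        case False
        then obtain j where j: "k = Suc j" using pCons.prems by (cases k) auto
        with False pCons.prems have "degree Q \<le> j" by auto
        from pCons.IH[OF dR(2) this] obtain C where
          C: "poly_over R C" "degree C \<le> j" "poly Q (inverse u) * u ^ j = poly C u" by blast
        have "poly (pCons d Q) (inverse u) * u ^ k = poly (monom d k + C) u"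
          using C(3) \<open>u \<noteq> 0\<close> by (simp add: j poly_monom field_simps)
        moreover have "degree (monom d k + C) \<le> k"
          using C(2) j by (intro degree_add_le) (auto simp: degree_monom_le)
        ultimately show ?thesis using C(1) dR(1)
          by (intro exI[of _ "monom d k + C"]) (auto simp: poly_over_ring[OF R])
      qed
    qed
    have nB: "degree B' \<le> n - 1" using B(4) less.prems(6) by (simp add: n_def)
    from rev[OF B(3) nB] obtain C where
      C: "poly_over R C" "degree C \<le> n - 1" "poly B' (inverse u) * u ^ (n - 1) = poly C u" by blast
    have un: "u ^ n = c * t * poly C u"
    proof -
      have "u ^ n = (c * t * poly B' (inverse u) * inverse u) * u ^ n" using eq1 by simp
      also have "\<dots> = c * t * (poly B' (inverse u) * u ^ (n - 1))"
        using dA \<open>u \<noteq> 0\<close> by (cases n) (auto simp: n_def field_simps)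
      finally show ?thesis using C(3) by simp
    qed
    define A' where "A' = A - monom a n + smult (a * c * t) C"
    have A'R: "poly_over R A'" unfolding A'_def using aR cR t less.prems(2) C(1) D
      by (intro poly_over_ring[OF R]) auto
    have A'v: "inverse t = poly A' u" using un less.prems(4) by (simp add: A'_def poly_monom)
    have "degree A' \<le> n - 1"
      unfolding A'_def
    proof (rule degree_add_le)
      show "degree (A - monom a n) \<le> n - 1"
      proof (rule degree_le, safe)
        fix i assume "n - 1 < i"
        then consider "i = n" | "i > n" by linarith
        then show "coeff (A - monom a n) i = 0"
          by cases (auto simp: a_def n_def coeff_eq_0)
      qed
      show "degree (smult (a * c * t) C) \<le> n - 1" using C(2) degree_smult_le order_trans by blast
    qed
    then have dA': "degree A' < degree A" using dA by (simp add: n_def)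
    show False
    proof (cases "degree B \<le> degree A'")
      case True
      then show False using less.hyps[of A' B u] dA' A'R A'v less.prems by auto
    next
      case False
      then show False using less.hyps[of B A' "inverse u"] dA' A'R A'v less.prems by auto
    qed
  qed
  have "u \<in> R \<or> inverse u \<in> R" for u
  proof (rule ccontr)
    assume *: "\<not> (u \<in> R \<or> inverse u \<in> R)"
    then have u0: "u \<noteq> 0" using D by auto
    have "inverse t \<in> adjoin R u" "inverse t \<in> adjoin R (inverse u)"
      using max[OF subring_adjoin(1,2)[OF R, of u]] max[OF subring_adjoin(1,2)[OF R, of "inverse u"]]
        subring_adjoin(3)[OF R, of u] subring_adjoin(3)[OF R, of "inverse u"] * by auto
    then obtain A B where AB: "poly_over R A" "poly_over R B" "inverse t = poly A u" "inverse t = poly B (inverse u)"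
      by (auto simp: adjoin_def)
    show False
    proof (cases "degree B \<le> degree A")
      case True
      then show False using main[OF u0 AB(1,2,3,4)] by simp
    next
      case False
      then show False using main[of "inverse u" B A] AB u0 by auto
    qed
  qed
  then show ?thesis using R by (simp add: valring_def)
qed

text \<open>Zorn's lemma yields a subring maximal among those that contain \<open>A\<close> and omit
  \<open>inverse t\<close>; by \<open>maximal_omitting_is_valring\<close> it is a valuation ring,
  and omitting \<open>inverse t\<close> means that \<open>t\<close> is a nonunit.\<close>

theorem valring_exists:
  fixes A :: "'f::field set"
  assumes A: "subring A" "t \<in> A" "inverse t \<notin> A"
  shows "\<exists>R. valring R \<and> A \<subseteq> R \<and> t \<in> maxid R"
proof -
  define \<A> where "\<A> = {S. subring S \<and> A \<subseteq> S \<and> inverse t \<notin> S}"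
  have "\<exists>M\<in>\<A>. \<forall>X\<in>\<A>. M \<subseteq> X \<longrightarrow> X = M"
  proof (rule subset_Zorn_nonempty)
    show "\<A> \<noteq> {}" using A by (auto simp: \<A>_def)
    fix \<C> assume ne: "\<C> \<noteq> {}" and ch: "subset.chain \<A> \<C>"
    have C: "\<C> \<subseteq> \<A>" using ch by (auto simp: subset.chain_def)
    have tot: "\<exists>S\<in>\<C>. a \<in> S \<and> b \<in> S" if ab: "a \<in> \<Union>\<C>" "b \<in> \<Union>\<C>" for a b
    proof -
      obtain S T where ST: "S \<in> \<C>" "a \<in> S" "T \<in> \<C>" "b \<in> T" using ab by blast
      then have "S \<subseteq> T \<or> T \<subseteq> S" using ch unfolding subset.chain_def by blast
      then show ?thesis using ST by blast
    qed
    show "\<Union>\<C> \<in> \<A>"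
      unfolding \<A>_def mem_Collect_eq subring_def
    proof (intro conjI ballI)
      obtain S where S: "S \<in> \<C>" using ne by blast
      then have S': "subring S" "A \<subseteq> S" using C by (auto simp: \<A>_def)
      show "1 \<in> \<Union>\<C>" using S subringD(1)[OF S'(1)] by blast
      show "A \<subseteq> \<Union>\<C>" using S S' by blast
      show "inverse t \<notin> \<Union>\<C>" using C by (auto simp: \<A>_def)
    next
      fix a b assume "a \<in> \<Union>\<C>" "b \<in> \<Union>\<C>"
      then obtain S where S: "S \<in> \<C>" "a \<in> S" "b \<in> S" using tot by blast
      then have "subring S" using C by (auto simp: \<A>_def)
      then show "a + b \<in> \<Union>\<C>" "a * b \<in> \<Union>\<C>" using S subringD(3,4) by blast+
    next
      fix a assume "a \<in> \<Union>\<C>"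
      then obtain S where S: "S \<in> \<C>" "a \<in> S" by blast
      then have "subring S" using C by (auto simp: \<A>_def)
      then show "- a \<in> \<Union>\<C>" using S subringD(5) by blast
    qed
  qed
  then obtain M where M: "M \<in> \<A>" "\<And>X. X \<in> \<A> \<Longrightarrow> M \<subseteq> X \<Longrightarrow> X = M" by blast
  then have M': "subring M" "A \<subseteq> M" "inverse t \<notin> M" by (auto simp: \<A>_def)
  have "valring M"
    by (rule maximal_omitting_is_valring[of M t]) (use M' A(2) M(2) in \<open>auto simp: \<A>_def\<close>)
  then show ?thesis using M' by (auto simp: maxid_def)
qed

lemma maxidD:
  assumes "valring R"
  shows "maxid R \<subseteq> R" "\<And>a b. a \<in> maxid R \<Longrightarrow> b \<in> maxid R \<Longrightarrow> a + b \<in> maxid R"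
    "\<And>a b. a \<in> R \<Longrightarrow> b \<in> maxid R \<Longrightarrow> a * b \<in> maxid R"
    "\<And>a. a \<in> maxid R \<Longrightarrow> - a \<in> maxid R"
    "\<And>a b. a \<in> maxid R \<Longrightarrow> b \<in> maxid R \<Longrightarrow> a - b \<in> maxid R"
    "0 \<in> maxid R" "1 \<notin> maxid R" "\<And>a. a \<notin> R \<Longrightarrow> inverse a \<in> maxid R"
    "\<And>a. a \<in> R \<Longrightarrow> a \<notin> maxid R \<Longrightarrow> inverse a \<in> R"
    "\<And>a b. a \<in> R \<Longrightarrow> b \<in> R \<Longrightarrow> a * b \<in> maxid R \<Longrightarrow> a \<in> maxid R \<or> b \<in> maxid R"
proof -
  have R: "subring R" and V: "\<And>u. u \<in> R \<or> inverse u \<in> R" using assms by (auto simp: valring_def)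
  note D = subringD[OF R]
  show sub: "maxid R \<subseteq> R" using V D(2) by (auto simp: maxid_def)
  show m: "a * b \<in> maxid R" if "a \<in> R" "b \<in> maxid R" for a b
  proof (rule ccontr)
    assume *: "a * b \<notin> maxid R"
    then have "a * b \<noteq> 0" "inverse (a * b) \<in> R" by (auto simp: maxid_def)
    moreover from this have "inverse b = a * inverse (a * b)" by (simp add: field_simps)
    ultimately have "inverse b \<in> R" using D(4)[OF that(1), of "inverse (a * b)"] by metis
    with that(2) \<open>a * b \<noteq> 0\<close> show False by (simp add: maxid_def)
  qed
  show mi: "- a \<in> maxid R" if "a \<in> maxid R" for a
    using that D(5)[of "- inverse a"] by (auto simp: maxid_def)
  show ad: "a + b \<in> maxid R" if "a \<in> maxid R" "b \<in> maxid R" for a b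
  proof -
    have *: "c + d \<in> maxid R" if "c \<in> maxid R" "d \<in> maxid R" "c / d \<in> R" "d \<noteq> 0" for c d
    proof -
      have "c + d = (c / d + 1) * d" using that by (simp add: field_simps)
      also have "\<dots> \<in> maxid R" using that by (intro m D(3) D(1))
      finally show ?thesis .
    qed
    show ?thesis
    proof (cases "a = 0 \<or> b = 0")
      case False
      then show ?thesis using *[of a b] *[of b a] that V[of "a / b"] by (auto simp: add.commute)
    qed (use that in auto)
  qed
  show "a - b \<in> maxid R" if "a \<in> maxid R" "b \<in> maxid R" for a b
    using ad[OF that(1) mi[OF that(2)]] by simp
  show "0 \<in> maxid R" "1 \<notin> maxid R" using D(1) by (auto simp: maxid_def)
  show "inverse a \<in> maxid R" if "a \<notin> R" for a using that by (auto simp: maxid_def)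
  show u: "inverse a \<in> R" if "a \<in> R" "a \<notin> maxid R" for a using that by (auto simp: maxid_def)
  show "a \<in> maxid R \<or> b \<in> maxid R" if "a \<in> R" "b \<in> R" "a * b \<in> maxid R" for a b
  proof (rule ccontr)
    assume *: "\<not> (a \<in> maxid R \<or> b \<in> maxid R)"
    then have "a \<noteq> 0" "b \<noteq> 0" by (auto simp: maxid_def)
    moreover have "inverse a * inverse b \<in> R" using * that by (intro D(4) u) auto
    ultimately show False using that(3) by (simp add: maxid_def)
  qed
qed

lemma valring_subringD:
  assumes "valring R"
  shows "subring R" using assms by (simp add: valring_def)

text \<open>Valuation rings are integrally closed: if \<open>v\<close> is missing then
  \<open>inverse v\<close> is present, and v is v^k times a power of \<open>inverse v\<close>. This
  carries information about \<open>x ^ m\<close>, \<open>z ^ m\<close> and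
  \<open>y ^ (3 * m)\<close> over to \<open>x\<close>, \<open>z\<close> and
  \<open>y\<close>.\<close>

lemma valring_power_iff:
  assumes "valring R" "k > 0"
  shows "u ^ k \<in> R \<longleftrightarrow> u \<in> R" "u ^ k \<in> maxid R \<longleftrightarrow> u \<in> maxid R"
proof -
  note D = subringD[OF valring_subringD[OF assms(1)]]
  show *: "v ^ k \<in> R \<longleftrightarrow> v \<in> R" for v
  proof
    assume h: "v ^ k \<in> R"
    show "v \<in> R"
    proof (rule ccontr)
      assume n: "v \<notin> R"
      then have i: "inverse v \<in> R" and v0: "v \<noteq> 0" using assms D by (auto simp: valring_def)
      have "v = v ^ k * inverse v ^ (k - 1)"
        using v0 assms(2) by (cases k) (auto simp: field_simps)
      also have "\<dots> \<in> R" using h i D by auto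
      finally show False using n by simp
    qed
  qed (use D in auto)
  show "u ^ k \<in> maxid R \<longleftrightarrow> u \<in> maxid R"
    using *[of "inverse u"] assms(2) by (auto simp: maxid_def power_inverse)
qed

text \<open>Residues are taken simultaneously at a family of valuation rings; this allows statements that
  hold uniformly at all valuation rings centred at a point before it is known that there is only one.\<close>
locale residues =
  fixes K :: "'f::field set" and \<R> :: "'f set set"
  assumes subfield: "subfield K" and valr: "R \<in> \<R> \<Longrightarrow> valring R" and sub: "R \<in> \<R> \<Longrightarrow> K \<subseteq> R"
begin

definition res :: "'f \<Rightarrow> 'f \<Rightarrow> bool" where
  "res u c \<longleftrightarrow> c \<in> K \<and> (\<forall>R\<in>\<R>. u - c \<in> maxid R)"

lemma resD: "res u c \<Longrightarrow> c \<in> K" "res u c \<Longrightarrow> R \<in> \<R> \<Longrightarrow> u - c \<in> maxid R" 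
  by (auto simp: res_def)

lemma res_const: "c \<in> K \<Longrightarrow> res c c"
  by (auto simp: res_def maxid_def)

lemma res_mem: assumes "res u c" "R \<in> \<R>" shows "u \<in> R"
proof -
  have "u = (u - c) + c" by simp
  also have "\<dots> \<in> R"
    using maxidD(1)[OF valr[OF assms(2)]] resD[OF assms(1)] sub[OF assms(2)] assms(2)
    by (intro subringD(3)[OF valring_subringD[OF valr[OF assms(2)]]]) blast+
  finally show ?thesis .
qed

lemma res_add: assumes "res u c" "res v d" shows "res (u + v) (c + d)"
  unfolding res_def
proof safe
  show "c + d \<in> K" using assms by (intro subfieldD[OF subfield]) (auto dest: resD)
  fix R assume R: "R \<in> \<R>"
  show "u + v - (c + d) \<in> maxid R"
    using maxidD(2)[OF valr[OF R] resD(2)[OF assms(1) R] resD(2)[OF assms(2) R]] by (simp add: algebra_simps)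
qed

lemma res_mult: assumes "res u c" "res v d" shows "res (u * v) (c * d)"
  unfolding res_def
proof safe
  show "c * d \<in> K" using assms by (intro subfieldD[OF subfield]) (auto dest: resD)
  fix R assume R: "R \<in> \<R>"
  note M = maxidD[OF valr[OF R]]
  have "u * v - c * d = u * (v - d) + d * (u - c)" by (simp add: algebra_simps)
  also have "\<dots> \<in> maxid R" using res_mem[OF assms(1) R] resD(2)[OF assms(1) R] resD(2)[OF assms(2) R]
      resD(1)[OF assms(2)] sub[OF R] by (intro M(2,3)) auto
  finally show "u * v - c * d \<in> maxid R" .
qed

lemma res_uminus: assumes "res u c" shows "res (- u) (- c)"
  using res_mult[OF res_const assms, of "-1"] subfieldD[OF subfield] by simp

lemma res_diff: assumes "res u c" "res v d" shows "res (u - v) (c - d)"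
  using res_add[OF assms(1) res_uminus[OF assms(2)]] by simp

lemma res_power: assumes "res u c" shows "res (u ^ n) (c ^ n)"
  by (induction n) (use res_mult[OF assms] res_const[OF subfieldD(1)[OF subfield]] in auto)

lemma res_sum: "(\<And>i. i \<in> I \<Longrightarrow> res (h i) (c i)) \<Longrightarrow> res (sum h I) (sum c I)"
  by (induction I rule: infinite_finite_induct) (use res_add res_const[OF subfieldD(2)[OF subfield]] in auto)

lemma res_poly: "poly_over K p \<Longrightarrow> res u c \<Longrightarrow> res (poly p u) (poly p c)"
  by (induction p) (use res_const[OF subfieldD(2)[OF subfield]] in \<open>auto simp: poly_over_pCons intro!: res_add res_mult res_const\<close>)

lemma res_nonzero:
  assumes "res u c" "c \<noteq> 0" "R \<in> \<R>"
  shows "u \<notin> maxid R" "inverse u \<in> R" "u \<noteq> 0"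
proof -
  note M = maxidD[OF valr[OF assms(3)]]
  show n: "u \<notin> maxid R"
  proof
    assume "u \<in> maxid R"
    then have "c \<in> maxid R" using M(5)[OF _ resD(2)[OF assms(1,3)]] by force
    moreover have "inverse c \<in> R" using resD(1)[OF assms(1)] subfieldD[OF subfield] sub[OF assms(3)] by auto
    ultimately show False using assms(2) by (auto simp: maxid_def)
  qed
  show "inverse u \<in> R" using M(9)[OF res_mem[OF assms(1,3)] n] .
  show "u \<noteq> 0" using n M by auto
qed

lemma res_inverse: assumes "res u c" "c \<noteq> 0" shows "res (inverse u) (inverse c)"
  unfolding res_def
proof safe
  show cK: "inverse c \<in> K" using assms by (intro subfieldD[OF subfield]) (auto dest: resD)
  fix R assume R: "R \<in> \<R>"
  note M = maxidD[OF valr[OF R]]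
  note N = res_nonzero[OF assms R]
  have "inverse u - inverse c = - (inverse u * (inverse c * (u - c)))"
    using N(3) assms(2) by (simp add: field_simps)
  also have "\<dots> \<in> maxid R" using N(2) cK sub[OF R] resD(2)[OF assms(1) R] by (intro M(3,4)) auto
  finally show "inverse u - inverse c \<in> maxid R" .
qed

lemma res_divide: "res u c \<Longrightarrow> res v d \<Longrightarrow> d \<noteq> 0 \<Longrightarrow> res (u / v) (c / d)"
  by (simp add: divide_inverse res_mult res_inverse)

lemma res_zero: "R \<in> \<R> \<Longrightarrow> res u 0 \<Longrightarrow> u \<in> maxid R"
  by (auto simp: res_def)

end

section \<open>Algebraically closed constants and places with a prescribed zero\<close>

lemma poly_root_factor:
  assumes "subring K" "poly_over K p" "c \<in> K" "poly p c = 0"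
  shows "\<exists>p'. poly_over K p' \<and> p = [:- c, 1:] * p'"
proof -
  have "poly_over K p \<Longrightarrow> poly_over K (synthetic_div p c)" for p
    by (induction p) (auto simp: poly_over_pCons poly_over_ring[OF assms(1)] intro: poly_in_subring assms)
  then have "poly_over K (synthetic_div p c)" using assms by blast
  moreover have "p = [:- c, 1:] * synthetic_div p c"
    using synthetic_div_correct'[of c p] assms(4) by simp
  ultimately show ?thesis by blast
qed

lemma algebraic_mem:
  assumes K: "alg_closed_subfield K" and p: "poly_over K p" "p \<noteq> 0" "poly p a = 0"
  shows "a \<in> K"
  using p
proof (induction "degree p" arbitrary: p)
  case 0
  then obtain b where "p = [:b:]" using degree_eq_zeroE by metis
  with 0 show ?case by auto
next
  case (Suc n)
  have sf: "subfield K" using K by (simp add: alg_closed_subfield_def)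
  obtain c where c: "c \<in> K" "poly p c = 0" using K Suc.prems(1) Suc.hyps(2) unfolding alg_closed_subfield_def
    by (auto dest!: spec[of _ p])
  obtain p' where p': "poly_over K p'" "p = [:- c, 1:] * p'"
    using poly_root_factor[OF subfield_subring[OF sf] Suc.prems(1) c] by blast
  have "p' \<noteq> 0" using p' Suc.prems by auto
  then have d: "degree p = Suc (degree p')" unfolding p'(2) by (subst degree_mult_eq) auto
  from Suc.prems(3) p' have "a = c \<or> poly p' a = 0" by (auto simp: algebra_simps)
  then show ?case using c(1) Suc.hyps(1)[OF _ p'(1) \<open>p' \<noteq> 0\<close>] Suc.hyps(2) d by auto
qed

text \<open>Every nonconstant function can therefore take over the role of \<open>x\<close>; in
  particular \<open>inverse x\<close> has a zero at some place, which is a place at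
  infinity.\<close>

lemma not_mem_transcendental:
  assumes K: "alg_closed_subfield K" and a: "a \<notin> K"
  shows "transcendental_over K a"
  using algebraic_mem[OF K] a unfolding transcendental_over_def by blast

text \<open>\<open>u - b\<close> is not invertible in K[u]: an inverse f would give (X - b) f = 1 as
  polynomials, which fails at b. Chevalley's theorem then supplies the place.\<close>

lemma place_exists:
  assumes K: "subfield K" and u: "transcendental_over K u" and b: "b \<in> K"
  shows "\<exists>R. valring R \<and> K \<subseteq> R \<and> u - b \<in> maxid R"
proof -
  note sr = subfield_subring[OF K]
  have *: "poly_over K [:- b, 1:]" using subfieldD[OF K] b by (auto simp: poly_over_pCons poly_over_ring[OF sr])
  have ub: "u - b \<noteq> 0"
  proof
    assume "u - b = 0"
    then have "poly [:- b, 1:] u = 0" by simp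
    with u * have "[:- b, 1:] = 0" unfolding transcendental_over_def by blast
    then show False by simp
  qed
  have "inverse (u - b) \<notin> adjoin K u"
  proof
    assume "inverse (u - b) \<in> adjoin K u"
    then obtain f where f: "poly_over K f" "inverse (u - b) = poly f u" by (auto simp: adjoin_def)
    have "poly ([:- b, 1:] * f - 1) u = 0" using ub f(2)[symmetric] by (simp add: field_simps)
    moreover have "poly_over K ([:- b, 1:] * f - 1)" using f * by (intro poly_over_ring[OF sr])
    ultimately have "[:- b, 1:] * f - 1 = 0" using u unfolding transcendental_over_def by blast
    then have "poly ([:- b, 1:] * f - 1) b = 0" by simp
    then show False by simp
  qed
  moreover have "subring (adjoin K u)" "K \<subseteq> adjoin K u" "u \<in> adjoin K u" using subring_adjoin[OF sr] by auto
  moreover from this have "u - b \<in> adjoin K u" using b by (auto intro: subringD(6))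
  ultimately show ?thesis using valring_exists[of "adjoin K u" "u - b"] by auto
qed

section \<open>Polynomials in two variables\<close>

definition poly2_over :: "'f::field set \<Rightarrow> 'f poly poly \<Rightarrow> bool" where
  "poly2_over K P \<longleftrightarrow> (\<forall>i. poly_over K (coeff P i))"

text \<open>The outer variable of a polynomial in two variables stands for $y$, the inner one for $x$.\<close>
definition ev :: "'f::field poly poly \<Rightarrow> 'f \<Rightarrow> 'f \<Rightarrow> 'f" where
  "ev P a b = poly (poly P [:b:]) a"

lemma ev_simps [simp]:
  "ev 0 a b = 0" "ev 1 a b = 1" "ev (P + Q) a b = ev P a b + ev Q a b" "ev (P - Q) a b = ev P a b - ev Q a b"
  "ev (- P) a b = - ev P a b" "ev (P * Q) a b = ev P a b * ev Q a b" "ev (smult c P) a b = poly c a * ev P a b"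
  "ev (pCons c P) a b = poly c a + b * ev P a b" "ev (monom c n) a b = poly c a * b ^ n" "ev (P ^ n) a b = ev P a b ^ n"
  by (simp_all add: ev_def poly_monom)

lemma ev_altdef:
  assumes "degree P \<le> N"
  shows "ev P a b = (\<Sum>i\<le>N. poly (coeff P i) a * b ^ i)"
proof -
  have "P = (\<Sum>i\<le>N. monom (coeff P i) i)" using assms by (intro poly_as_sum_of_monoms'[symmetric])
  then have "ev P a b = ev (\<Sum>i\<le>N. monom (coeff P i) i) a b" by simp
  also have "\<dots> = (\<Sum>i\<le>N. poly (coeff P i) a * b ^ i)" by (induction N) simp_all
  finally show ?thesis .
qed

lemma poly2_over_ring:
  assumes "subring K"
  shows "poly2_over K 0" "poly2_over K 1" "\<And>P Q. poly2_over K P \<Longrightarrow> poly2_over K Q \<Longrightarrow> poly2_over K (P + Q)"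
    "\<And>P Q. poly2_over K P \<Longrightarrow> poly2_over K Q \<Longrightarrow> poly2_over K (P - Q)"
    "\<And>P. poly2_over K P \<Longrightarrow> poly2_over K (- P)"
    "\<And>P Q. poly2_over K P \<Longrightarrow> poly2_over K Q \<Longrightarrow> poly2_over K (P * Q)"
    "\<And>c P. poly_over K c \<Longrightarrow> poly2_over K P \<Longrightarrow> poly2_over K (smult c P)"
    "\<And>c n. poly_over K c \<Longrightarrow> poly2_over K (monom c n)"
    "\<And>c P. poly2_over K (pCons c P) \<longleftrightarrow> poly_over K c \<and> poly2_over K P"
proof -
  note R = poly_over_ring[OF assms]
  show "poly2_over K 0" using R by (simp add: poly2_over_def)
  show "poly2_over K 1" using R by (auto simp: poly2_over_def coeff_1)
  show "\<And>P Q. poly2_over K P \<Longrightarrow> poly2_over K Q \<Longrightarrow> poly2_over K (P + Q)"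
    "\<And>P Q. poly2_over K P \<Longrightarrow> poly2_over K Q \<Longrightarrow> poly2_over K (P - Q)"
    "\<And>P. poly2_over K P \<Longrightarrow> poly2_over K (- P)"
    "\<And>c P. poly_over K c \<Longrightarrow> poly2_over K P \<Longrightarrow> poly2_over K (smult c P)"
    "\<And>c n. poly_over K c \<Longrightarrow> poly2_over K (monom c n)"
    using R by (auto simp: poly2_over_def)
  show "poly2_over K (P * Q)" if "poly2_over K P" "poly2_over K Q" for P Q
    unfolding poly2_over_def coeff_mult using that by (auto simp: poly2_over_def intro!: R(10,6))
  show "poly2_over K (pCons c P) \<longleftrightarrow> poly_over K c \<and> poly2_over K P" for c P
    unfolding poly2_over_def
  proof safe
    fix i assume h: "\<forall>i. poly_over K (coeff (pCons c P) i)"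
    show "poly_over K c" using h[rule_format, of 0] by simp
    show "poly_over K (coeff P i)" using h[rule_format, of "Suc i"] by simp
  next
    fix i assume "poly_over K c" "\<forall>i. poly_over K (coeff P i)"
    then show "poly_over K (coeff (pCons c P) i)" by (cases i) auto
  qed
qed

section \<open>The curve and its ramified points\<close>

text \<open>Through \<open>q + 1 = 3 * m\<close>, the bound \<open>m \<ge> 4\<close> is q >= 11 and
  \<open>even m\<close> is the oddness of \<open>q\<close>.\<close>

locale curve =
  fixes K :: "'f::field set" and p e q m :: nat and x y :: 'f
  assumes ac: "alg_closed_subfield K"
    and p: "prime p" "of_nat p = (0::'f)" and q: "q = p ^ e" "e > 0" and qm: "q + 1 = 3 * m"
    and m: "m \<ge> 4" "even m"
    and trans: "transcendental_over K x"
    and eq: "y ^ (3 * m) + x ^ (2 * m) + x ^ m = 0"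
begin

lemma sf: "subfield K" using ac by (simp add: alg_closed_subfield_def)

lemmas sr = subfield_subring[OF sf]
lemmas KD = subfieldD[OF sf]
lemmas poK = poly_over_ring[OF sr]

text \<open>In characteristic p, 3m = q + 1 equals 1. So 3, \<open>m\<close> and all divisors of
  \<open>3 * m\<close> are nonzero in the field, which makes the roots of X^m + 1 simple and
  provides enough roots of unity.\<close>

lemma of_nat_m: "of_nat (3 * m) = (1::'f)" "of_nat m \<noteq> (0::'f)"
proof -
  have "of_nat q = (0::'f)" using p q by (simp add: power_0_left)
  then show *: "of_nat (3 * m) = (1::'f)" unfolding qm[symmetric] by simp
  show "of_nat m \<noteq> (0::'f)" using * by auto
qed

lemma two: "(2::'f) \<noteq> 0"
proof
  assume "(2::'f) = 0"
  moreover obtain k where "m = 2 * k" using m by blast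
  ultimately have "of_nat m = (0::'f)" by simp
  then show False using of_nat_m by simp
qed

lemma frob: "(a + b :: 'f) ^ q = a ^ q + b ^ q" "(a - b :: 'f) ^ q = a ^ q - b ^ q"
proof -
  have C: "CHAR('f) = p"
  proof -
    have "CHAR('f) dvd p" using p(2) by (simp add: of_nat_eq_0_iff_char_dvd)
    moreover have "CHAR('f) \<noteq> 1" using CHAR_not_1' by simp
    ultimately show ?thesis using p(1) by (auto simp: prime_nat_iff)
  qed
  have pl: "(c + d :: 'f) ^ q = c ^ q + d ^ q" for c d
    using freshmans_dream'[of q e c d] p q C by simp
  show "(a + b) ^ q = a ^ q + b ^ q" by (rule pl)
  show "(a - b) ^ q = a ^ q - b ^ q" using pl[of "a - b" b] by (simp add: algebra_simps)
qed

lemma eq_factored: "y ^ (3 * m) = - (x ^ m * (x ^ m + 1))"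
proof -
  have "x ^ (2 * m) = x ^ m * x ^ m" by (simp add: mult_2 power_add)
  with eq show ?thesis by (simp add: algebra_simps eq_neg_iff_add_eq_0)
qed

lemma x_poly: "poly_over K f \<Longrightarrow> poly f x = 0 \<Longrightarrow> f = 0"
  using trans by (auto simp: transcendental_over_def)

lemma x_notin: "x \<notin> K"
proof
  assume h: "x \<in> K"
  then have "poly_over K [:- x, 1:]" using KD by (auto simp: poly_over_pCons poK)
  from x_poly[OF this] show False by auto
qed

lemma nz: "x \<noteq> 0" "x ^ m + 1 \<noteq> 0" "y \<noteq> 0"
proof -
  show x: "x \<noteq> 0" using x_notin KD by auto
  show xm: "x ^ m + 1 \<noteq> 0"
  proof
    assume "x ^ m + 1 = 0"
    then have "poly (monom 1 m + 1) x = 0" by (simp add: poly_monom)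
    moreover have "poly_over K (monom 1 m + 1)" using KD by (auto intro!: poK)
    ultimately have "monom 1 m + 1 = (0 :: 'f poly)" by (rule x_poly[rotated])
    then have "coeff (monom 1 m + 1 :: 'f poly) m = 0" by simp
    then show False using m by (auto simp: coeff_1 split: if_splits)
  qed
  show "y \<noteq> 0"
  proof
    assume "y = 0"
    then have "x ^ m * (x ^ m + 1) = 0" using eq_factored m by (simp add: power_0_left)
    then show False using x xm by simp
  qed
qed

definition z where "z = y ^ 3 / x"

lemma yz: "y ^ 3 = x * z" using nz by (simp add: z_def)

lemma z_nz: "z \<noteq> 0" using nz by (simp add: z_def)

lemma xz: "x ^ m + z ^ m + 1 = 0"
proof -
  have "y ^ (3 * m) = x ^ m * z ^ m" by (simp add: power_mult yz power_mult_distrib)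
  then have "x ^ m * (x ^ m + z ^ m + 1) = 0" using eq_factored by (simp add: algebra_simps eq_neg_iff_add_eq_0)
  then show ?thesis using nz by simp
qed

end

section \<open>Local structure at the points (epsilon, 0)\<close>

locale curve_place = curve +
  fixes \<epsilon> :: 'a
  assumes eps: "\<epsilon> \<in> K" "\<epsilon> ^ m = - 1"
begin

text \<open>The valuation rings centred at the point $(\varepsilon, 0)$.\<close>
definition VP :: "'a set set" where
  "VP = {R. valring R \<and> K \<subseteq> R \<and> x - \<epsilon> \<in> maxid R}"

lemma VP_nonempty: "\<exists>R. R \<in> VP"
  using place_exists[OF sf trans eps(1)] by (auto simp: VP_def)

sublocale residues K VP
  by unfold_locales (auto simp: VP_def sf)

lemma eps_nz: "\<epsilon> \<noteq> 0" using eps m by (auto simp: power_0_left)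

lemma res_x: "res x \<epsilon>"
  using eps unfolding res_def by (auto simp: VP_def)

lemma res_y: "res y 0"
  unfolding res_def
proof safe
  show "0 \<in> K" by (rule KD)
  fix R assume R: "R \<in> VP"
  have "res (- (x ^ m * (x ^ m + 1))) (- (\<epsilon> ^ m * (\<epsilon> ^ m + 1)))"
    by (intro res_mult res_uminus res_add res_power res_x res_const KD)
  then have "res (- (x ^ m * (x ^ m + 1))) 0" by (simp add: eps)
  moreover have "y ^ (3 * m) = - (x ^ m * (x ^ m + 1))"
    by (rule eq_factored)
  ultimately have "y ^ (3 * m) \<in> maxid R" using res_zero[OF R] by simp
  then show "y - 0 \<in> maxid R" using valring_power_iff[OF valr[OF R], of "3 * m" y] m by auto
qed

text \<open>\<open>\<epsilon>\<close> is a simple root of X^m + 1: the cofactor has residue m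
  \<epsilon>^(m-1), and m is nonzero in the field.\<close>

lemma res_xm: "\<exists>s c. x ^ m + 1 = (x - \<epsilon>) * s \<and> res s c \<and> c \<noteq> 0"
proof -
  define s where "s = (\<Sum>i<m. \<epsilon> ^ (m - Suc i) * x ^ i)"
  have "x ^ m - \<epsilon> ^ m = (x - \<epsilon>) * s" unfolding s_def by (rule power_diff_sumr2)
  moreover have "res s (\<Sum>i<m. \<epsilon> ^ (m - Suc i) * \<epsilon> ^ i)" unfolding s_def
    by (intro res_sum res_mult res_const res_power res_x KD eps)
  moreover have "(\<Sum>i<m. \<epsilon> ^ (m - Suc i) * \<epsilon> ^ i) = (\<Sum>i<m. \<epsilon> ^ (m - 1))"
    by (intro sum.cong refl) (simp flip: power_add)
  ultimately show ?thesis using of_nat_m(2) eps_nz by (intro exI[of _ s] exI[of _ "of_nat m * \<epsilon> ^ (m - 1)"]) (simp add: eps)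
qed

lemma x_eps: "\<exists>w c. x - \<epsilon> = y ^ (3 * m) * w \<and> res w c \<and> c \<noteq> 0"
proof -
  obtain s c where s: "x ^ m + 1 = (x - \<epsilon>) * s" "res s c" "c \<noteq> 0" using res_xm by blast
  have s0: "s \<noteq> 0" using s(1) nz by auto
  have "y ^ (3 * m) = - (x ^ m * (x ^ m + 1))"
    by (rule eq_factored)
  then have "x - \<epsilon> = y ^ (3 * m) * (- 1 / (x ^ m * s))" using s0 nz unfolding s(1) by simp
  moreover have "res (- 1 / (x ^ m * s)) (- 1 / (\<epsilon> ^ m * c))"
    using s eps_nz by (intro res_divide res_mult res_power res_x res_const KD) auto
  moreover have "- 1 / (\<epsilon> ^ m * c) \<noteq> 0" using s(3) eps_nz by simp
  ultimately show ?thesis by blast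
qed

text \<open>Each factor \<open>x - \<epsilon>\<close> of \<open>f\<close> contributes
  \<open>y ^ (3 * m)\<close>. The exponent of \<open>y\<close> in front of a function with nonzero
  residue stands in for a valuation, simultaneously at all rings of \<open>VP\<close>.\<close>

lemma poly_x_unit:
  assumes "poly_over K f" "f \<noteq> 0"
  shows "\<exists>k u c. poly f x = y ^ (3 * m * k) * u \<and> res u c \<and> c \<noteq> 0"
  using assms
proof (induction "degree f" arbitrary: f rule: less_induct)
  case less
  show ?case
  proof (cases "poly f \<epsilon> = 0")
    case False
    then show ?thesis using res_poly[OF less.prems(1) res_x] 
      by (intro exI[of _ 0] exI[of _ "poly f x"] exI[of _ "poly f \<epsilon>"]) auto
  next
    case True
    obtain g where g: "poly_over K g" "f = [:- \<epsilon>, 1:] * g"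
      using poly_root_factor[OF sr less.prems(1) eps(1) True] by blast
    have g0: "g \<noteq> 0" using g less.prems by auto
    have "degree f = Suc (degree g)" using g0 unfolding g(2) by (subst degree_mult_eq) auto
    then obtain k u c where k: "poly g x = y ^ (3 * m * k) * u" "res u c" "c \<noteq> 0"
      using less.hyps[of g] g g0 by auto
    obtain w d where w: "x - \<epsilon> = y ^ (3 * m) * w" "res w d" "d \<noteq> 0" using x_eps by blast
    have "poly f x = (x - \<epsilon>) * poly g x" by (simp add: g(2) algebra_simps)
    also have "\<dots> = y ^ (3 * m * Suc k) * (w * u)" unfolding w(1) k(1) by (simp add: power_add algebra_simps)
    finally have "poly f x = y ^ (3 * m * Suc k) * (w * u)" .
    moreover have "d * c \<noteq> 0" using k(3) w(3) by simp
    ultimately show ?thesis using res_mult[OF w(2) k(2)] by blast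
  qed
qed

text \<open>The ultrametric principle: the term with the least exponent dominates, because after
  dividing by its power of \<open>y\<close> the other terms carry positive powers of
  \<open>y\<close> and have residue 0.\<close>

lemma sum_distinct_orders:
  assumes "finite I" "I \<noteq> {}" "inj_on d I"
    "\<And>i. i \<in> I \<Longrightarrow> \<exists>u c. h i = y ^ d i * u \<and> res u c \<and> c \<noteq> 0"
  shows "\<exists>j\<in>I. \<exists>u c. sum h I = y ^ (d j :: nat) * u \<and> res u c \<and> c \<noteq> 0"
  using assms
proof (induction I rule: finite_ne_induct)
  case (singleton i)
  then show ?case by auto
next
  case (insert i I)
  have two_terms: "\<exists>w f. y ^ a * u + y ^ b * v = y ^ a * w \<and> res w f \<and> f \<noteq> 0"
    if "a < b" "res u c" "c \<noteq> 0" "res v d" for a b :: nat and u v c d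
  proof -
    have "y ^ b = y ^ a * y ^ (b - a)" using that(1) by (simp flip: power_add)
    then have "y ^ a * u + y ^ b * v = y ^ a * (u + y ^ (b - a) * v)" by (simp add: algebra_simps)
    moreover have "res (u + y ^ (b - a) * v) (c + 0 ^ (b - a) * d)"
      by (intro res_add res_mult res_power res_y that)
    moreover have "c + 0 ^ (b - a) * d \<noteq> 0" using that by (simp add: power_0_left)
    ultimately show ?thesis by blast
  qed
  obtain j u c where j: "j \<in> I" "sum h I = y ^ d j * u" "res u c" "c \<noteq> 0"
    using insert.IH insert.prems by (auto simp: inj_on_insert)
  obtain v b where v: "h i = y ^ d i * v" "res v b" "b \<noteq> 0" using insert.prems(2)[of i] by auto
  have "d i \<noteq> d j" using insert j by (auto simp: inj_on_def)
  then consider "d i < d j" | "d j < d i" by linarith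
  then show ?case
  proof cases
    case 1
    then show ?thesis using two_terms[OF 1 v(2,3) j(3)] insert.hyps v(1) j(2) by (intro bexI[of _ i]) auto
  next
    case 2
    then show ?thesis using two_terms[OF 2 j(3,4) v(2)] insert.hyps v(1) j(1,2)
      by (intro bexI[of _ j]) (auto simp: add.commute)
  qed
qed

text \<open>Total ramification over $x = \varepsilon$: the order of the $i$-th term at this point is congruent to
  $i$ modulo $q + 1$, so the terms have distinct orders.\<close>
lemma ev_unit:
  assumes P: "poly2_over K P" "P \<noteq> 0" "degree P \<le> q"
  shows "\<exists>k u c. ev P x y = y ^ k * u \<and> res u c \<and> c \<noteq> 0"
proof -
  define I where "I = {i. i \<le> q \<and> coeff P i \<noteq> 0}"
  have "\<forall>i. \<exists>k. i \<in> I \<longrightarrow> (\<exists>u c. poly (coeff P i) x = y ^ (3 * m * k) * u \<and> res u c \<and> c \<noteq> 0)"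
    using poly_x_unit P(1) unfolding I_def poly2_over_def by blast
  then obtain k where k: "\<And>i. i \<in> I \<Longrightarrow> \<exists>u c. poly (coeff P i) x = y ^ (3 * m * k i) * u \<and> res u c \<and> c \<noteq> 0"
    by metis
  have "\<exists>j\<in>I. \<exists>u c. (\<Sum>i\<in>I. poly (coeff P i) x * y ^ i) = y ^ (3 * m * k j + j) * u \<and> res u c \<and> c \<noteq> 0"
  proof (rule sum_distinct_orders)
    show "finite I" by (simp add: I_def)
    have "degree P \<in> I" using P by (simp add: I_def)
    then show "I \<noteq> {}" by blast
    show "inj_on (\<lambda>j. 3 * m * k j + j) I"
    proof (rule inj_onI)
      fix i j assume *: "i \<in> I" "j \<in> I" "3 * m * k i + i = 3 * m * k j + j"
      then have "i < 3 * m" "j < 3 * m" by (auto simp: I_def simp flip: qm)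
      then have "i = (3 * m * k i + i) mod (3 * m)" "j = (3 * m * k j + j) mod (3 * m)" by simp_all
      with *(3) show "i = j" by metis
    qed
    fix i assume "i \<in> I"
    from k[OF this] obtain u c where u: "poly (coeff P i) x = y ^ (3 * m * k i) * u" "res u c" "c \<noteq> 0" by blast
    show "\<exists>u c. poly (coeff P i) x * y ^ i = y ^ (3 * m * k i + i) * u \<and> res u c \<and> c \<noteq> 0"
      using u by (intro exI[of _ u] exI[of _ c]) (simp add: power_add mult_ac)
  qed
  moreover have "ev P x y = (\<Sum>i\<in>I. poly (coeff P i) x * y ^ i)"
    unfolding ev_altdef[OF P(3)] I_def by (rule sum.mono_neutral_right) auto
  ultimately show ?thesis by auto
qed

text \<open>A nonzero \<open>P\<close> of this degree has a finite order at the point, so its value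
  is not zero. In effect the curve equation is irreducible and \<open>y\<close> has degree exactly
  \<open>q + 1\<close> over K(x).\<close>

lemma indep_place:
  assumes P: "poly2_over K P" "degree P \<le> q" "ev P x y = 0"
  shows "P = 0"
proof (rule ccontr)
  assume "P \<noteq> 0"
  then obtain k u c where *: "ev P x y = y ^ k * u" "res u c" "c \<noteq> 0" using ev_unit P by blast
  obtain R where "R \<in> VP" using VP_nonempty by blast
  with * have "u \<noteq> 0" using res_nonzero by blast
  then show False using * P nz by simp
qed

end

section \<open>Normal forms modulo the curve equation\<close>

context curve
begin

lemma root_exists: "\<exists>\<epsilon>\<in>K. \<epsilon> ^ m = - 1"
proof -
  have "degree (monom 1 m + 1 :: 'f poly) = m"
    using m by (subst degree_add_eq_left) (auto simp: degree_monom_eq)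
  moreover have "poly_over K (monom 1 m + 1)" using KD by (auto intro!: poK)
  ultimately obtain a where "a \<in> K" "poly (monom 1 m + 1) a = 0"
    using ac m unfolding alg_closed_subfield_def by (metis not_numeral_le_zero not_gr_zero)
  then show ?thesis by (auto simp: poly_monom eq_neg_iff_add_eq_0)
qed

lemma indep:
  assumes "poly2_over K P" "degree P \<le> q" "ev P x y = 0"
  shows "P = 0"
proof -
  obtain \<epsilon> where "\<epsilon> \<in> K" "\<epsilon> ^ m = - 1" using root_exists by blast
  then interpret curve_place K p e q m x y \<epsilon> by unfold_locales
  show ?thesis using indep_place assms by blast
qed

definition curve_poly :: "'f poly poly" where
  "curve_poly = monom 1 (q + 1) + [:monom 1 (2 * m) + monom 1 m:]"

lemma curve_poly_over: "poly2_over K curve_poly"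
  unfolding curve_poly_def using KD by (intro poly2_over_ring[OF sr] poK) (auto simp: poly2_over_ring[OF sr] intro!: poK)

lemma ev_curve_poly: "ev curve_poly a b = b ^ (3 * m) + a ^ (2 * m) + a ^ m"
  unfolding curve_poly_def qm by (simp add: poly_monom)

text \<open>Division by the equation, which is monic in \<open>y\<close>. The remainder is asserted
  to work at all points \<open>(a, b)\<close> at once because \<open>kernel\<close> compares two
  pairs by means of the same remainder.\<close>

lemma reduce:
  assumes "poly2_over K P"
  shows "\<exists>R. poly2_over K R \<and> degree R \<le> q \<and>
           (\<forall>a b. b ^ (3 * m) + a ^ (2 * m) + a ^ m = 0 \<longrightarrow> ev P a b = ev R a b)"
  using assms
proof (induction P)
  case 0
  then show ?case by (intro exI[of _ 0]) auto
next
  case (pCons c P)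
  note P2 = poly2_over_ring[OF sr]
  have c: "poly_over K c" "poly2_over K P" using pCons.prems by (auto simp: P2)
  then obtain R where R: "poly2_over K R" "degree R \<le> q"
    "\<And>a b. b ^ (3 * m) + a ^ (2 * m) + a ^ m = 0 \<Longrightarrow> ev P a b = ev R a b" using pCons.IH by blast
  \<comment> \<open>Multiplying \<open>R\<close> by the outer variable can produce a term of degree
    \<open>q + 1\<close>, with coefficient \<open>coeff R q\<close>; a multiple of the equation
    removes it.\<close>
  define S where "S = pCons c R - smult (coeff R q) curve_poly"
  have "poly2_over K S" unfolding S_def using c R(1) curve_poly_over
    by (intro P2(4,7)) (auto simp: P2(9) poly2_over_def[of K R])
  moreover have "degree S \<le> q"
  proof (rule degree_le, safe)
    fix i assume "q < i"
    then obtain j where j: "i = Suc j" "j \<ge> q" by (cases i) auto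
    have "q > 0" using qm m by simp
    show "coeff S i = 0"
    proof (cases "j = q")
      case True
      then show ?thesis using \<open>q > 0\<close> by (simp add: S_def j curve_poly_def coeff_pCons)
    next
      case False
      then have "coeff R j = 0" using j R(2) by (intro coeff_eq_0) auto
      then show ?thesis using False j by (simp add: S_def curve_poly_def coeff_pCons)
    qed
  qed
  moreover have "ev (pCons c P) a b = ev S a b" if "b ^ (3 * m) + a ^ (2 * m) + a ^ m = 0" for a b
    using R(3)[OF that] that by (simp add: S_def ev_curve_poly)
  ultimately show ?case by blast
qed

end

section \<open>The function field\<close>

lemma rel_autsD:
  assumes "\<sigma> \<in> rel_auts K"
  shows "bij \<sigma>" "\<And>a b. \<sigma> (a + b) = \<sigma> a + \<sigma> b" "\<And>a b. \<sigma> (a * b) = \<sigma> a * \<sigma> b" "\<sigma> 1 = 1" "\<sigma> 0 = 0"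
    "\<And>a. a \<in> K \<Longrightarrow> \<sigma> a = a" "\<And>a. \<sigma> (- a) = - \<sigma> a" "\<And>a b. \<sigma> (a - b) = \<sigma> a - \<sigma> b"
    "\<And>a. \<sigma> (inverse a) = inverse (\<sigma> a)" "\<And>a b. \<sigma> (a / b) = \<sigma> a / \<sigma> b" "\<And>a n. \<sigma> (a ^ n) = \<sigma> a ^ n"
    "\<And>a. \<sigma> a = 0 \<longleftrightarrow> a = 0" "\<And>a b. \<sigma> a = \<sigma> b \<longleftrightarrow> a = b"
    "\<And>h I. \<sigma> (sum h I) = (\<Sum>i\<in>I. \<sigma> (h i))"
proof -
  show b: "bij \<sigma>" and add: "\<And>a b. \<sigma> (a + b) = \<sigma> a + \<sigma> b" and mult: "\<And>a b. \<sigma> (a * b) = \<sigma> a * \<sigma> b"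
    and one: "\<sigma> 1 = 1" and "\<And>a. a \<in> K \<Longrightarrow> \<sigma> a = a"
    using assms by (auto simp: rel_auts_def)
  show z: "\<sigma> 0 = 0" using add[of 0 0] by (metis add.right_neutral add_left_cancel)
  show mi: "\<sigma> (- a) = - \<sigma> a" for a using add[of a "- a"] z by (simp add: add_eq_0_iff)
  show "\<sigma> (a - b) = \<sigma> a - \<sigma> b" for a b using add[of a "- b"] mi by simp
  show inj: "\<sigma> a = \<sigma> b \<longleftrightarrow> a = b" for a b using bij_is_inj[OF b] by (auto simp: inj_eq)
  show z': "\<sigma> a = 0 \<longleftrightarrow> a = 0" for a using inj[of a 0] z by simp
  show inv: "\<sigma> (inverse a) = inverse (\<sigma> a)" for a
  proof (cases "a = 0")
    case False
    then have "\<sigma> a * \<sigma> (inverse a) = 1" by (simp flip: mult add: one)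
    then show ?thesis using inverse_unique by metis
  qed (simp add: z)
  show "\<sigma> (a / b) = \<sigma> a / \<sigma> b" for a b by (simp add: divide_inverse mult inv)
  show "\<sigma> (a ^ n) = \<sigma> a ^ n" for a n by (induction n) (simp_all add: one mult)
  show "\<sigma> (sum h I) = (\<Sum>i\<in>I. \<sigma> (h i))" for h I
    by (induction I rule: infinite_finite_induct) (simp_all add: z add)
qed

lemma rel_auts_poly:
  assumes "\<sigma> \<in> rel_auts K" "poly_over K f"
  shows "\<sigma> (poly f u) = poly f (\<sigma> u)"
  using assms(2) by (induction f) (use rel_autsD[OF assms(1)] in \<open>auto simp: poly_over_pCons\<close>)

lemma rel_auts_inv: assumes "\<sigma> \<in> rel_auts K" shows "inv \<sigma> \<in> rel_auts K"
proof -
  note D = rel_autsD[OF assms]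
  have s: "\<sigma> (inv \<sigma> a) = a" for a using bij_is_surj[OF D(1)] by (simp add: surj_f_inv_f)
  have i: "inv \<sigma> a = b" if "\<sigma> b = a" for a b using that D(13) s by metis
  show ?thesis unfolding rel_auts_def
    by (auto intro!: i bij_imp_bij_inv D(1,4,6) simp: D(2,3) s)
qed

lemma rel_auts_comp: assumes "\<sigma> \<in> rel_auts K" "\<tau> \<in> rel_auts K" shows "\<sigma> \<circ> \<tau> \<in> rel_auts K"
  using rel_autsD[OF assms(1)] rel_autsD[OF assms(2)] unfolding rel_auts_def
  by (auto intro: bij_comp)

lemma rel_auts_id: "id \<in> rel_auts K"
  by (auto simp: rel_auts_def)

lemma valring_vimage:
  assumes "\<sigma> \<in> rel_auts K" "valring R" "K \<subseteq> R"
  shows "valring (\<sigma> -` R)" "K \<subseteq> \<sigma> -` R" "maxid (\<sigma> -` R) = \<sigma> -` maxid R"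
  using rel_autsD[OF assms(1)] assms(2,3) unfolding valring_def subring_def maxid_def by auto

lemma poly_div_over:
  assumes S: "subfield S" and B: "poly_over S B" "B \<noteq> 0" and A: "poly_over S A"
  shows "\<exists>Q R. poly_over S Q \<and> poly_over S R \<and> A = Q * B + R \<and> (R = 0 \<or> degree R < degree B)"
  using A
proof (induction "degree A" arbitrary: A rule: less_induct)
  case less
  note P = poly_over_ring[OF subfield_subring[OF S]]
  show ?case
  proof (cases "A = 0 \<or> degree A < degree B")
    case True
    then show ?thesis using less.prems P by (intro exI[of _ 0] exI[of _ A]) auto
  next
    case False
    define c where "c = lead_coeff A / lead_coeff B"
    define T where "T = monom c (degree A - degree B)"
    define A' where "A' = A - T * B"
    have "c \<in> S" unfolding c_def using less.prems B by (intro subfieldD[OF S]) (auto simp: poly_over_def)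
    then have T: "poly_over S T" unfolding T_def by (rule P)
    have A': "poly_over S A'" unfolding A'_def using T B less.prems by (intro P)
    have c0: "c \<noteq> 0" using False B by (simp add: c_def)
    have dT: "degree (T * B) = degree A"
      using c0 B False by (auto simp: T_def degree_mult_eq degree_monom_eq monom_eq_0_iff)
    have "lead_coeff (T * B) = c * lead_coeff B"
      unfolding lead_coeff_mult by (simp add: T_def degree_monom_eq c0)
    also have "\<dots> = lead_coeff A" using B by (simp add: c_def)
    finally have lT: "lead_coeff (T * B) = lead_coeff A" .
    show ?thesis
    proof (cases "A' = 0")
      case True
      then show ?thesis using T P by (intro exI[of _ T] exI[of _ 0]) (auto simp: A'_def)
    next
      case A'0: False
      have "degree A' \<le> degree A" unfolding A'_def using dT by (intro degree_diff_le) auto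
      moreover have "coeff A' (degree A) = 0" unfolding A'_def using dT lT by simp
      ultimately have "degree A' < degree A"
        using A'0 by (metis leading_coeff_0_iff order_le_less)
      from less.hyps[OF this A'] obtain Q R where
        "poly_over S Q" "poly_over S R" "A' = Q * B + R" "R = 0 \<or> degree R < degree B" by blast
      moreover have "A = (T + Q) * B + R" using calculation(3) by (simp add: A'_def algebra_simps)
      ultimately show ?thesis using T P(3) by blast
    qed
  qed
qed

locale curve_field = curve +
  assumes gen: "generates_field (K \<union> {x, y})"
begin

lemma frac:
  "\<exists>P Q. poly2_over K P \<and> poly2_over K Q \<and> ev Q x y \<noteq> 0 \<and> f = ev P x y / ev Q x y"
proof -
  note P2 = poly2_over_ring[OF sr]
  define S where "S = {ev P x y / ev Q x y |P Q. poly2_over K P \<and> poly2_over K Q \<and> ev Q x y \<noteq> 0}"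
  have I: "ev P x y / ev Q x y \<in> S" if "poly2_over K P" "poly2_over K Q" "ev Q x y \<noteq> 0" for P Q
    using that unfolding S_def by blast
  have "subfield S"
    unfolding subfield_def
  proof (intro conjI ballI)
    show "0 \<in> S" "1 \<in> S" using I[OF P2(1,2)] I[OF P2(2,2)] by auto
  next
    fix a b assume "a \<in> S" "b \<in> S"
    then obtain A B C D where h: "poly2_over K A" "poly2_over K B" "poly2_over K C" "poly2_over K D"
      "ev B x y \<noteq> 0" "ev D x y \<noteq> 0" "a = ev A x y / ev B x y" "b = ev C x y / ev D x y"
      unfolding S_def by blast
    have "a + b = ev (A * D + C * B) x y / ev (B * D) x y" using h by (simp add: add_frac_eq)
    also have "\<dots> \<in> S" using h by (intro I P2(3,6)) auto
    finally show "a + b \<in> S" .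
    have "a * b = ev (A * C) x y / ev (B * D) x y" using h by simp
    also have "\<dots> \<in> S" using h by (intro I P2(3,6)) auto
    finally show "a * b \<in> S" .
  next
    fix a assume "a \<in> S"
    then obtain A B where h: "poly2_over K A" "poly2_over K B" "ev B x y \<noteq> 0" "a = ev A x y / ev B x y"
      unfolding S_def by blast
    have "- a = ev (- A) x y / ev B x y" using h by simp
    also have "\<dots> \<in> S" using h by (intro I P2(5)) auto
    finally show "- a \<in> S" .
    show "inverse a \<in> S"
    proof (cases "ev A x y = 0")
      case True
      then show ?thesis using h I[OF P2(1,2)] by simp
    next
      case False
      then show ?thesis using I[OF h(2,1)] h(4) by simp
    qed
  qed
  moreover have "K \<union> {x, y} \<subseteq> S"
  proof safe
    fix c assume "c \<in> K"
    then show "c \<in> S" using I[of "[:[:c:]:]" 1] by (simp add: P2 poly_over_pCons poK)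
  next
    show "x \<in> S" using I[of "[:[:0, 1:]:]" 1] KD by (simp add: P2 poly_over_pCons poK)
    show "y \<in> S" using I[of "[:0, 1:]" 1] KD by (simp add: P2 poly_over_pCons poK)
  qed
  ultimately have "S = UNIV" using gen unfolding generates_field_def by blast
  then have "f \<in> S" by simp
  then show ?thesis unfolding S_def by blast
qed

text \<open>Both pairs satisfy the same irreducible equation, so vanishing at either of them means
  that the common remainder is the zero polynomial.\<close>

lemma kernel:
  assumes "curve K p e q m a b" "poly2_over K P"
  shows "ev P x y = 0 \<longleftrightarrow> ev P a b = 0"
proof -
  interpret ab: curve K p e q m a b by fact
  obtain R where R: "poly2_over K R" "degree R \<le> q" "ev P x y = ev R x y" "ev P a b = ev R a b"
    using reduce[OF assms(2)] eq ab.eq by blast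
  then show ?thesis using indep ab.indep by (metis ev_simps(1))
qed

text \<open>Substituting \<open>(a, b)\<close> for \<open>(x, y)\<close> in fractions is well
  defined and injective by \<open>kernel\<close>, and surjective because \<open>a\<close> and
  \<open>b\<close> generate the field as well.\<close>

lemma aut_exists:
  assumes "curve_field K p e q m a b"
  shows "\<exists>\<sigma>\<in>rel_auts K. \<sigma> x = a \<and> \<sigma> y = b"
proof -
  interpret ab: curve_field K p e q m a b by fact
  note P2 = poly2_over_ring[OF sr]
  have ker: "ev P x y = 0 \<longleftrightarrow> ev P a b = 0" if "poly2_over K P" for P
    using kernel[OF ab.curve_axioms that] .
  have "\<exists>g. \<exists>P Q. poly2_over K P \<and> poly2_over K Q \<and> ev Q x y \<noteq> 0 \<and> f = ev P x y / ev Q x y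
      \<and> g = ev P a b / ev Q a b" for f
    using frac[of f] by blast
  then obtain \<sigma> where \<sigma>: "\<And>f. \<exists>P Q. poly2_over K P \<and> poly2_over K Q \<and> ev Q x y \<noteq> 0 \<and> f = ev P x y / ev Q x y
      \<and> \<sigma> f = ev P a b / ev Q a b" by metis
  \<comment> \<open>Choice has fixed one fraction for each function; the value does not depend on
    which one, since cross-multiplied differences vanish at both pairs.\<close>
  have val: "\<sigma> (ev P x y / ev Q x y) = ev P a b / ev Q a b"
    if h: "poly2_over K P" "poly2_over K Q" "ev Q x y \<noteq> 0" for P Q
  proof -
    obtain A B where AB: "poly2_over K A" "poly2_over K B" "ev B x y \<noteq> 0" "ev P x y / ev Q x y = ev A x y / ev B x y"
      "\<sigma> (ev P x y / ev Q x y) = ev A a b / ev B a b" using \<sigma> by blast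
    have "ev (P * B - A * Q) x y = 0" using AB h by (simp add: field_simps)
    moreover have "poly2_over K (P * B - A * Q)" using AB h by (intro P2(4,6))
    ultimately have "ev (P * B - A * Q) a b = 0" using ker by blast
    moreover have "ev Q a b \<noteq> 0" "ev B a b \<noteq> 0" using ker h AB by blast+
    ultimately show ?thesis using AB(5) by (simp add: frac_eq_eq)
  qed
  have val1: "\<sigma> (ev P x y) = ev P a b" if "poly2_over K P" for P
    using val[OF that P2(2)] by simp
  have hom: "\<sigma> (f + g) = \<sigma> f + \<sigma> g" "\<sigma> (f * g) = \<sigma> f * \<sigma> g" for f g
  proof -
    obtain A B where h: "poly2_over K A" "poly2_over K B" "ev B x y \<noteq> 0" "f = ev A x y / ev B x y" using frac by blast
    obtain C D where h': "poly2_over K C" "poly2_over K D" "ev D x y \<noteq> 0" "g = ev C x y / ev D x y" using frac by blast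
    have nz: "ev B a b \<noteq> 0" "ev D a b \<noteq> 0" using ker h h' by blast+
    have "f + g = ev (A * D + C * B) x y / ev (B * D) x y" using h h' by (simp add: add_frac_eq)
    then have "\<sigma> (f + g) = ev (A * D + C * B) a b / ev (B * D) a b"
      using val[of "A * D + C * B" "B * D"] h h' by (simp add: P2)
    also have "\<dots> = \<sigma> f + \<sigma> g" using val h h' nz by (simp add: add_frac_eq)
    finally show "\<sigma> (f + g) = \<sigma> f + \<sigma> g" .
    have "f * g = ev (A * C) x y / ev (B * D) x y" using h h' by simp
    then have "\<sigma> (f * g) = ev (A * C) a b / ev (B * D) a b"
      using val[of "A * C" "B * D"] h h' by (simp add: P2)
    also have "\<dots> = \<sigma> f * \<sigma> g" using val h h' nz by simp
    finally show "\<sigma> (f * g) = \<sigma> f * \<sigma> g" .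
  qed
  have K: "\<sigma> c = c" if "c \<in> K" for c
    using val1[of "[:[:c:]:]"] that by (simp add: P2 poly_over_pCons poK)
  have one: "\<sigma> 1 = 1" and zero: "\<sigma> 0 = 0" using K KD by auto
  have sx: "\<sigma> x = a" using val1[of "[:[:0, 1:]:]"] KD by (simp add: P2 poly_over_pCons poK)
  have sy: "\<sigma> y = b" using val1[of "[:0, 1:]"] KD by (simp add: P2 poly_over_pCons poK)
  have mi: "\<sigma> (- f) = - \<sigma> f" for f using hom(1)[of f "- f"] zero by (simp add: add_eq_0_iff)
  have inv: "\<sigma> (inverse f) = inverse (\<sigma> f)" for f
  proof (cases "f = 0")
    case False
    then have "\<sigma> f * \<sigma> (inverse f) = 1" by (simp flip: hom add: one)
    then show ?thesis using inverse_unique by metis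
  qed (simp add: zero)
  have z': "f = 0" if "\<sigma> f = 0" for f
  proof (rule ccontr)
    assume "f \<noteq> 0"
    then have "\<sigma> (f * inverse f) = 1" using one by simp
    then show False using hom(2)[of f "inverse f"] that by simp
  qed
  have "inj \<sigma>"
  proof (rule injI)
    fix f g assume "\<sigma> f = \<sigma> g"
    then have "\<sigma> (f - g) = 0" using hom(1)[of f "- g"] mi by simp
    then show "f = g" using z'[of "f - g"] by simp
  qed
  moreover have "range \<sigma> = UNIV"
  proof -
    have "subfield (range \<sigma>)" unfolding subfield_def
    proof (intro conjI ballI)
      show "0 \<in> range \<sigma>" "1 \<in> range \<sigma>" using rangeI[of \<sigma> 0] rangeI[of \<sigma> 1] zero one by simp_all
    next
      fix u v assume "u \<in> range \<sigma>" "v \<in> range \<sigma>"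
      then obtain f g where fg: "u = \<sigma> f" "v = \<sigma> g" by blast
      show "u + v \<in> range \<sigma>" "u * v \<in> range \<sigma>" unfolding fg hom[symmetric] by simp_all
    next
      fix u assume "u \<in> range \<sigma>"
      then obtain f where f: "u = \<sigma> f" by blast
      show "- u \<in> range \<sigma>" "inverse u \<in> range \<sigma>" unfolding f mi[symmetric] inv[symmetric] by simp_all
    qed
    moreover have "K \<union> {a, b} \<subseteq> range \<sigma>"
    proof safe
      fix c assume "c \<in> K"
      then show "c \<in> range \<sigma>" using rangeI[of \<sigma> c] K by simp
    qed (use sx sy in auto)
    ultimately show ?thesis using ab.gen by (simp add: generates_field_def)
  qed
  ultimately have "\<sigma> \<in> rel_auts K" using hom K one by (auto simp: rel_auts_def bij_def)
  with sx sy show ?thesis by blast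
qed

text \<open>The working form of \<open>aut_exists\<close>: transcendence of \<open>a\<close> reduces
  to \<open>a\<close> being nonconstant, and generation to recovering \<open>x\<close> and
  \<open>y\<close> from \<open>a\<close> and \<open>b\<close>.\<close>

lemma new_pair:
  assumes "a \<notin> K" "b ^ (3 * m) + a ^ (2 * m) + a ^ m = 0"
    and "\<And>S. subfield S \<Longrightarrow> K \<subseteq> S \<Longrightarrow> a \<in> S \<Longrightarrow> b \<in> S \<Longrightarrow> x \<in> S \<and> y \<in> S"
  shows "\<exists>\<sigma>\<in>rel_auts K. \<sigma> x = a \<and> \<sigma> y = b"
proof (rule aut_exists, unfold_locales)
  show "transcendental_over K a" using not_mem_transcendental[OF ac assms(1)] .
  show "generates_field (K \<union> {a, b})" using gen assms(3) unfolding generates_field_def by auto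
qed (use ac p q qm m assms in auto)

section \<open>The field as an extension of K(x) generated by y\<close>

definition Kx where "Kx = {poly A x / poly B x |A B. poly_over K A \<and> poly_over K B \<and> B \<noteq> 0}"

lemma KxI: "poly_over K A \<Longrightarrow> poly_over K B \<Longrightarrow> B \<noteq> 0 \<Longrightarrow> poly A x / poly B x \<in> Kx"
  unfolding Kx_def by blast

lemma Kx_subfield: "subfield Kx" and Kx_mem: "K \<subseteq> Kx" "x \<in> Kx"
proof -
  show "K \<subseteq> Kx"
  proof
    fix c assume "c \<in> K"
    then show "c \<in> Kx" using KxI[of "[:c:]" 1] by (simp add: poly_over_pCons poK)
  qed
  show "x \<in> Kx" using KxI[of "[:0, 1:]" 1] KD by (simp add: poly_over_pCons poK)
  show "subfield Kx"
    unfolding subfield_def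
  proof (intro conjI ballI)
    show "0 \<in> Kx" "1 \<in> Kx" using KxI[OF poK(1,2)] KxI[OF poK(2,2)] by auto
  next
    fix a b assume "a \<in> Kx" "b \<in> Kx"
    then obtain A B C D where h: "poly_over K A" "poly_over K B" "poly_over K C" "poly_over K D"
      "B \<noteq> 0" "D \<noteq> 0" "a = poly A x / poly B x" "b = poly C x / poly D x"
      unfolding Kx_def by blast
    then have nz: "poly B x \<noteq> 0" "poly D x \<noteq> 0" using x_poly by auto
    have "a + b = poly (A * D + C * B) x / poly (B * D) x" using h nz by (simp add: add_frac_eq)
    also have "\<dots> \<in> Kx" using h by (intro KxI poK(3,6)) auto
    finally show "a + b \<in> Kx" .
    have "a * b = poly (A * C) x / poly (B * D) x" using h by simp
    also have "\<dots> \<in> Kx" using h by (intro KxI poK(3,6)) auto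
    finally show "a * b \<in> Kx" .
  next
    fix a assume "a \<in> Kx"
    then obtain A B where h: "poly_over K A" "poly_over K B" "B \<noteq> 0" "a = poly A x / poly B x"
      unfolding Kx_def by blast
    have "- a = poly (- A) x / poly B x" using h by simp
    also have "\<dots> \<in> Kx" using h by (intro KxI poK(5)) auto
    finally show "- a \<in> Kx" .
    show "inverse a \<in> Kx"
    proof (cases "A = 0")
      case True
      then show ?thesis using h KxI[OF poK(1,2)] by simp
    next
      case False
      then show ?thesis using KxI[OF h(2,1)] h(4) by simp
    qed
  qed
qed

lemma common_denominator:
  assumes "poly_over Kx H"
  shows "\<exists>D P. poly_over K D \<and> D \<noteq> 0 \<and> poly2_over K P \<and> degree P \<le> degree H
    \<and> (\<forall>i. poly (coeff P i) x = poly D x * coeff H i)"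
  using assms
proof (induction H)
  case 0
  then show ?case by (intro exI[of _ 1] exI[of _ 0]) (auto simp: poK poly2_over_ring[OF sr])
next
  case (pCons c H)
  then have c: "c \<in> Kx" "poly_over Kx H" by (auto simp: poly_over_pCons)
  obtain D P where D: "poly_over K D" "D \<noteq> 0" "poly2_over K P" "degree P \<le> degree H"
    "\<And>i. poly (coeff P i) x = poly D x * coeff H i" using pCons.IH[OF c(2)] by blast
  obtain A B where A: "poly_over K A" "poly_over K B" "B \<noteq> 0" "c = poly A x / poly B x"
    using c(1) by (auto simp: Kx_def)
  have B: "poly B x \<noteq> 0" using A x_poly by auto
  show ?case
  proof (intro exI conjI allI)
    show "poly_over K (D * B)" "poly2_over K (pCons (A * D) (smult B P))"
      using D A by (auto simp: poK poly2_over_ring[OF sr])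
    show "D * B \<noteq> 0" using D A by simp
    show "degree (pCons (A * D) (smult B P)) \<le> degree (pCons c H)"
    proof (cases "H = 0")
      case True
      then have "coeff P i = 0" for i
      proof -
        have "poly (coeff P i) x = 0" using D(5) True by simp
        then show ?thesis using x_poly D(3) by (auto simp: poly2_over_def)
      qed
      then have "P = 0" by (intro poly_eqI) simp
      then show ?thesis by simp
    next
      case False
      then show ?thesis using D(4) by (auto simp: degree_pCons_eq_if)
    qed
    fix i show "poly (coeff (pCons (A * D) (smult B P)) i) x = poly (D * B) x * coeff (pCons c H) i"
      using B by (cases i) (simp_all add: A(4) D(5) field_simps)
  qed
qed

lemma indep_Kx:
  assumes "poly_over Kx H" "degree H \<le> q" "poly H y = 0"
  shows "H = 0"
proof -
  obtain D P where D: "poly_over K D" "D \<noteq> 0" "poly2_over K P" "degree P \<le> degree H"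
    "\<And>i. poly (coeff P i) x = poly D x * coeff H i" using common_denominator[OF assms(1)] by blast
  have "ev P x y = (\<Sum>i\<le>degree H. poly D x * coeff H i * y ^ i)" by (simp add: ev_altdef[OF D(4)] D(5))
  also have "\<dots> = poly D x * poly H y" by (simp add: poly_altdef sum_distrib_left mult.assoc)
  finally have "P = 0" using indep[OF D(3)] D(4) assms by simp
  then have "poly D x * coeff H i = 0" for i using D(5)[of i] by simp
  moreover have "poly D x \<noteq> 0" using D x_poly by auto
  ultimately show ?thesis by (intro poly_eqI) auto
qed

definition minpoly_y :: "'a poly" where "minpoly_y = monom 1 (3 * m) + [:x ^ (2 * m) + x ^ m:]"

lemma minpoly_y: "poly_over Kx minpoly_y" "degree minpoly_y = 3 * m" "poly minpoly_y y = 0"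
proof -
  note P = poly_over_ring[OF subfield_subring[OF Kx_subfield]] and D = subfieldD[OF Kx_subfield]
  show "poly_over Kx minpoly_y" unfolding minpoly_y_def using Kx_mem
    by (intro P) (auto simp: poly_over_pCons P intro!: P D)
  show "degree minpoly_y = 3 * m" unfolding minpoly_y_def using m
    by (subst degree_add_eq_left) (auto simp: degree_monom_eq)
  show "poly minpoly_y y = 0" using eq by (simp add: minpoly_y_def poly_monom add.assoc)
qed

text \<open>Inverses exist by Euclid's algorithm: a nonzero polynomial of least degree whose value at $y$ is a
  multiple of the given element divides the minimal polynomial of $y$, hence is constant.\<close>
lemma Kx_poly_repr: "\<exists>H. poly_over Kx H \<and> degree H \<le> q \<and> f = poly H y"
proof -
  note sK = Kx_subfield
  note P = poly_over_ring[OF subfield_subring[OF sK]] and D = subfieldD[OF sK]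
  define S where "S = adjoin Kx y"
  have S: "subring S" "Kx \<subseteq> S" "y \<in> S" using subring_adjoin[OF subfield_subring[OF sK]] by (auto simp: S_def)
  have red: "\<exists>H. poly_over Kx H \<and> degree H \<le> q \<and> g = poly H y" if "g \<in> S" for g
  proof -
    from that obtain A where A: "poly_over Kx A" "g = poly A y" by (auto simp: S_def adjoin_def)
    have "minpoly_y \<noteq> 0" using minpoly_y(2) m by auto
    then obtain Q R where QR: "poly_over Kx Q" "poly_over Kx R" "A = Q * minpoly_y + R" "R = 0 \<or> degree R < degree minpoly_y"
      using poly_div_over[OF sK minpoly_y(1) _ A(1)] by blast
    then have "degree R \<le> q" using minpoly_y(2) qm by auto
    moreover have "g = poly R y" using A(2) QR(3) minpoly_y(3) by simp
    ultimately show ?thesis using QR by blast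
  qed
  have inv: "inverse g \<in> S" if g: "g \<in> S" "g \<noteq> 0" for g
  proof -
    define J where "J R \<longleftrightarrow> poly_over Kx R \<and> degree R \<le> q \<and> R \<noteq> 0 \<and> (\<exists>h\<in>S. poly R y = g * h)" for R
    obtain H where H: "poly_over Kx H" "degree H \<le> q" "g = poly H y" using red[OF g(1)] by blast
    have "J H" unfolding J_def using H g subringD(1)[OF S(1)] by (auto intro!: bexI[of _ 1])
    then obtain R where R: "J R" "\<And>R'. J R' \<Longrightarrow> degree R \<le> degree R'"
      using ex_has_least_nat[of J H degree] by blast
    obtain h where h: "h \<in> S" "poly R y = g * h" using R(1) by (auto simp: J_def)
    have R': "poly_over Kx R" "R \<noteq> 0" "degree R \<le> q" using R(1) by (auto simp: J_def)
    obtain A B where AB: "poly_over Kx A" "poly_over Kx B" "minpoly_y = A * R + B" "B = 0 \<or> degree B < degree R"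
      using poly_div_over[OF sK R'(1,2) minpoly_y(1)] by blast
    have "B = 0"
    proof (rule ccontr)
      assume B: "B \<noteq> 0"
      have "poly A y * poly R y + poly B y = 0" using minpoly_y(3) AB(3) by (metis poly_add poly_mult)
      then have "poly B y = g * (- (poly A y * h))" using h(2) by (simp add: algebra_simps eq_neg_iff_add_eq_0)
      moreover have "- (poly A y * h) \<in> S" using h(1) poly_in_subring[OF S(1) poly_over_mono[OF AB(1) S(2)] S(3)]
        by (intro subringD(4,5)[OF S(1)])
      ultimately have "\<exists>h\<in>S. poly B y = g * h" by blast
      then have "J B" unfolding J_def using B AB R' by auto
      then show False using R(2) AB(4) B by fastforce
    qed
    then have EA: "minpoly_y = A * R" using AB by simp
    have "minpoly_y \<noteq> 0" using minpoly_y(2) m by auto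
    then have A0: "A \<noteq> 0" using EA by auto
    have "degree A + degree R = 3 * m" using minpoly_y(2) A0 R' by (simp add: EA degree_mult_eq)
    moreover have "poly R y \<noteq> 0" using indep_Kx R' by blast
    then have "poly A y = 0" using minpoly_y(3) by (simp add: EA)
    then have "degree A > q" using indep_Kx AB(1) A0 by (meson not_le)
    ultimately have "degree R = 0" using qm by simp
    then obtain c where c: "R = [:c:]" by (rule degree_eq_zeroE)
    then have "c \<in> Kx" "c \<noteq> 0" using R' by (auto simp: poly_over_pCons)
    moreover have "inverse g = h * inverse c" using h(2) c g \<open>c \<noteq> 0\<close> by (simp add: field_simps)
    ultimately show ?thesis using h S D by (auto intro!: subringD(4)[OF S(1)])
  qed
  have "subfield S" unfolding subfield_def
    using subringD[OF S(1)] inv by (metis inverse_zero)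
  moreover have "K \<union> {x, y} \<subseteq> S" using S Kx_mem by auto
  ultimately have "S = UNIV" using gen unfolding generates_field_def by blast
  then have "f \<in> S" by simp
  then show ?thesis using red by blast
qed

end

section \<open>The Riemann--Roch space of the pole divisor of \<open>x\<close>\<close>

lemma poly_only_zero_root:
  assumes K: "alg_closed_subfield K" and B: "poly_over K B" "B \<noteq> 0" "\<And>b. b \<in> K \<Longrightarrow> poly B b = 0 \<Longrightarrow> b = 0"
  shows "\<exists>c\<in>K. \<exists>k. c \<noteq> 0 \<and> B = monom c k"
  using B
proof (induction "degree B" arbitrary: B)
  case 0
  then obtain c where "B = [:c:]" using degree_eq_zeroE[of B] by metis
  with "0.prems" show ?case by (intro bexI[of _ c] exI[of _ 0]) (auto simp: monom_0 poly_over_pCons)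
next
  case (Suc n)
  have sf: "subfield K" using K by (simp add: alg_closed_subfield_def)
  obtain b where b: "b \<in> K" "poly B b = 0" using K Suc.prems(1) Suc.hyps(2) unfolding alg_closed_subfield_def
    by (auto dest!: spec[of _ B])
  then have b0: "b = 0" using Suc.prems by blast
  obtain B' where B': "poly_over K B'" "B = [:- b, 1:] * B'"
    using poly_root_factor[OF subfield_subring[OF sf] Suc.prems(1) b] by blast
  have BX: "B = pCons 0 B'" using B' b0 by simp
  have B'0: "B' \<noteq> 0" using BX Suc.prems by auto
  then have "n = degree B'" using BX Suc.hyps(2) by (simp add: degree_pCons_eq)
  moreover have "a = 0" if "a \<in> K" "poly B' a = 0" for a using Suc.prems(3)[of a] that BX by simp
  ultimately obtain c k where "c \<in> K" "c \<noteq> 0" "B' = monom c k" using Suc.hyps(1) B'(1) B'0 by blast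
  then show ?case using BX by (intro bexI[of _ c] exI[of _ "Suc k"]) (auto simp: monom_Suc)
qed

context curve_field
begin

text \<open>The space $L(D)$ for the pole divisor $D$ of $x$.\<close>
definition pole_space where
  "pole_space = {f. \<forall>R. valring R \<and> K \<subseteq> R \<longrightarrow> (x \<in> R \<longrightarrow> f \<in> R) \<and> (x \<notin> R \<longrightarrow> f / x \<in> R)}"

definition V where
  "V = {a + b * x + c * y + d * z |a b c d. a \<in> K \<and> b \<in> K \<and> c \<in> K \<and> d \<in> K}"

lemma VI: "a \<in> K \<Longrightarrow> b \<in> K \<Longrightarrow> c \<in> K \<Longrightarrow> d \<in> K \<Longrightarrow> a + b * x + c * y + d * z \<in> V"
  unfolding V_def by blast

lemma V_gens: "1 \<in> V" "x \<in> V" "y \<in> V" "z \<in> V" "0 \<in> V"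
  using VI[of 1 0 0 0] VI[of 0 1 0 0] VI[of 0 0 1 0] VI[of 0 0 0 1] VI[of 0 0 0 0] KD by auto

lemma V_add: "f \<in> V \<Longrightarrow> g \<in> V \<Longrightarrow> f + g \<in> V"
proof -
  assume "f \<in> V" "g \<in> V"
  then obtain a b c d a' b' c' d' where "a \<in> K" "b \<in> K" "c \<in> K" "d \<in> K" "f = a + b * x + c * y + d * z"
    "a' \<in> K" "b' \<in> K" "c' \<in> K" "d' \<in> K" "g = a' + b' * x + c' * y + d' * z" unfolding V_def by blast
  then show ?thesis using VI[of "a + a'" "b + b'" "c + c'" "d + d'"] KD by (simp add: algebra_simps)
qed

lemma V_scale: "k \<in> K \<Longrightarrow> f \<in> V \<Longrightarrow> k * f \<in> V"
proof -
  assume k: "k \<in> K" and "f \<in> V"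
  then obtain a b c d where "a \<in> K" "b \<in> K" "c \<in> K" "d \<in> K" "f = a + b * x + c * y + d * z" unfolding V_def by blast
  then show ?thesis using VI[of "k * a" "k * b" "k * c" "k * d"] k KD by (simp add: algebra_simps)
qed

lemma V_diff: "f \<in> V \<Longrightarrow> g \<in> V \<Longrightarrow> f - g \<in> V"
  using V_add[of f "(- 1) * g"] V_scale[of "- 1" g] KD by simp

lemma V_sum: "(\<And>i. i \<in> I \<Longrightarrow> h i \<in> V) \<Longrightarrow> sum h I \<in> V"
  by (induction I rule: infinite_finite_induct) (auto simp: V_gens V_add)

text \<open>\<open>y\<close> and \<open>z\<close> are integral over K[x], since
  \<open>y ^ (3 * m)\<close> and \<open>z ^ m\<close> are polynomials in \<open>x\<close>. The same
  argument in the chart 1/x, z/x, y/x gives \<open>infinite_place\<close>.\<close>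

lemma finite_place: assumes "valring R" "K \<subseteq> R" "x \<in> R" shows "y \<in> R" "z \<in> R"
proof -
  note D = subringD[OF valring_subringD[OF assms(1)]]
  have "y ^ (3 * m) \<in> R" unfolding eq_factored using assms D by auto
  then show "y \<in> R" using valring_power_iff[OF assms(1)] m by auto
  have "z ^ m = - (x ^ m) - 1" using xz by (simp add: eq_diff_eq eq_neg_iff_add_eq_0 algebra_simps)
  also have "\<dots> \<in> R" using assms D by auto
  finally show "z \<in> R" using valring_power_iff[OF assms(1)] m by auto
qed

lemma zx_power: "(z / x) ^ m = - 1 - inverse x ^ m"
proof -
  have "z ^ m = - (x ^ m) - 1" using xz by (simp add: eq_diff_eq eq_neg_iff_add_eq_0 algebra_simps)
  then show ?thesis using nz by (simp add: power_divide field_simps)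
qed

lemma yx_power: "(y / x) ^ 3 = z / x * inverse x"
  using nz by (simp add: power_divide yz) (simp add: field_simps eval_nat_numeral)

lemma infinite_place: assumes "valring R" "K \<subseteq> R" "x \<notin> R"
  shows "inverse x \<in> maxid R" "inverse x \<in> R" "z / x \<in> R" "y / x \<in> R"
proof -
  note D = subringD[OF valring_subringD[OF assms(1)]]
  show "inverse x \<in> maxid R" using maxidD[OF assms(1)] assms by auto
  then show ix: "inverse x \<in> R" using maxidD[OF assms(1)] by auto
  have "(z / x) ^ m \<in> R" unfolding zx_power using ix D by auto
  then show zx: "z / x \<in> R" using valring_power_iff[OF assms(1)] m by auto
  have "(y / x) ^ 3 \<in> R" unfolding yx_power by (rule D(4)[OF zx ix])
  then show "y / x \<in> R" using valring_power_iff[OF assms(1)] by auto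
qed

lemma LDI:
  assumes "\<And>R. valring R \<Longrightarrow> K \<subseteq> R \<Longrightarrow> x \<in> R \<Longrightarrow> f \<in> R"
    "\<And>R. valring R \<Longrightarrow> K \<subseteq> R \<Longrightarrow> x \<notin> R \<Longrightarrow> f / x \<in> R"
  shows "f \<in> pole_space"
  using assms unfolding pole_space_def by blast

lemma LDD: "f \<in> pole_space \<Longrightarrow> valring R \<Longrightarrow> K \<subseteq> R \<Longrightarrow> x \<in> R \<Longrightarrow> f \<in> R"
    "f \<in> pole_space \<Longrightarrow> valring R \<Longrightarrow> K \<subseteq> R \<Longrightarrow> x \<notin> R \<Longrightarrow> f / x \<in> R"
  unfolding pole_space_def by blast+

lemma LD_diff: assumes "f \<in> pole_space" "g \<in> pole_space" shows "f - g \<in> pole_space"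
proof (rule LDI)
  fix R assume R: "valring R" "K \<subseteq> R"
  note D = subringD[OF valring_subringD[OF R(1)]]
  show "f - g \<in> R" if "x \<in> R" using D(6)[OF LDD(1)[OF assms(1) R that] LDD(1)[OF assms(2) R that]] .
  show "(f - g) / x \<in> R" if "x \<notin> R"
    using D(6)[OF LDD(2)[OF assms(1) R that] LDD(2)[OF assms(2) R that]] by (simp add: diff_divide_distrib)
qed

lemma LD_scale: assumes "k \<in> K" "f \<in> pole_space" shows "k * f \<in> pole_space"
proof (rule LDI)
  fix R assume R: "valring R" "K \<subseteq> R"
  note D = subringD[OF valring_subringD[OF R(1)]]
  have k: "k \<in> R" using assms R by auto
  show "k * f \<in> R" if "x \<in> R" using D(4)[OF k LDD(1)[OF assms(2) R that]] .
  show "(k * f) / x \<in> R" if "x \<notin> R" using D(4)[OF k LDD(2)[OF assms(2) R that]] by simp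
qed

lemma LD_aut: assumes "\<tau> \<in> rel_auts K" "\<tau> x = x" "f \<in> pole_space" shows "\<tau> f \<in> pole_space"
proof (rule LDI)
  fix R assume R: "valring R" "K \<subseteq> R"
  note P = valring_vimage(1,2)[OF assms(1) R] and D = rel_autsD[OF assms(1)]
  show "\<tau> f \<in> R" if "x \<in> R" using LDD(1)[OF assms(3) P] that assms(2) by simp
  show "\<tau> f / x \<in> R" if "x \<notin> R" using LDD(2)[OF assms(3) P] that assms(2) D by simp
qed

text \<open>With d = gcd(k, 3m) and r = 3m/d > 1, take a root of the quotient (X^(3m) - 1)/(X^d -
  1). If \<delta>^d were 1, this quotient would have the value r, which is nonzero in the field; by
  Bezout \<delta>^k = 1 would force \<delta>^d = 1.\<close>

lemma root_of_unity: assumes "0 < k" "k < 3 * m" shows "\<exists>\<delta>\<in>K. \<delta> ^ (3 * m) = 1 \<and> \<delta> ^ k \<noteq> 1"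
proof -
  define d where "d = gcd k (3 * m)"
  have d: "d dvd k" "d dvd 3 * m" "d > 0" using assms by (auto simp: d_def)
  then obtain r where r: "3 * m = d * r" by auto
  have "d \<le> k" using d assms by (auto intro: dvd_imp_le)
  then have r1: "r > 1" 
  proof -
    have "r \<noteq> 0" using r m by (intro notI) simp
    moreover have "r \<noteq> 1" using r assms \<open>d \<le> k\<close> by (intro notI) simp
    ultimately show ?thesis by simp
  qed
  have rnz: "of_nat r \<noteq> (0::'a)"
  proof
    assume "of_nat r = (0::'a)"
    then have "of_nat (3 * m) = (0::'a)" unfolding r by simp
    then show False using of_nat_m by simp
  qed
  define T :: "'a poly" where "T = (\<Sum>j<r. monom 1 (d * j))"
  have T: "poly_over K T" unfolding T_def using KD by (intro poK) auto
  have "coeff T (d * (r - 1)) = (\<Sum>j<r. if j = r - 1 then 1 else 0)"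
    unfolding T_def coeff_sum using d(3) by (intro sum.cong refl) simp
  also have "\<dots> = 1" using r1 by simp
  finally have "degree T \<ge> d * (r - 1)" by (intro le_degree) simp
  then have "degree T > 0" using r1 d(3) by (metis less_le_trans nat_0_less_mult_iff zero_less_diff)
  then obtain \<delta> where \<delta>: "\<delta> \<in> K" "poly T \<delta> = 0" using ac T unfolding alg_closed_subfield_def by (auto dest!: spec[of _ T])
  have s: "(\<Sum>j<r. (\<delta> ^ d) ^ j) = 0" using \<delta>(2) by (simp add: T_def poly_sum poly_monom flip: power_mult)
  have "(\<delta> ^ d - 1) * (\<Sum>j<r. (\<delta> ^ d) ^ j) = (\<delta> ^ d) ^ r - 1" by (rule power_diff_1_eq[symmetric])
  then have one: "\<delta> ^ (3 * m) = 1" using s r by (simp add: power_mult)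
  have "\<delta> ^ d \<noteq> 1" using s rnz by auto
  have d0: "\<delta> \<noteq> 0" using one m by (auto simp: power_0_left)
  obtain a b where ab: "k * a = 3 * m * b + d" using bezout_nat[of k "3 * m"] assms by (auto simp: d_def)
  have "\<delta> ^ k \<noteq> 1"
  proof
    assume "\<delta> ^ k = 1"
    then have "\<delta> ^ (3 * m * b + d) = 1" by (simp flip: ab add: power_mult)
    moreover have "\<delta> ^ (3 * m * b + d) = (\<delta> ^ (3 * m)) ^ b * \<delta> ^ d" by (simp only: power_add power_mult)
    ultimately have "\<delta> ^ d = 1" unfolding one by simp
    with \<open>\<delta> ^ d \<noteq> 1\<close> show False ..
  qed
  then show ?thesis using \<delta> one by blast
qed

text \<open>These are the Galois automorphisms of the Kummer extension of K(x) generated by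
  \<open>y\<close>; they act on the powers of \<open>y\<close> by distinct characters.\<close>

lemma torus: assumes "\<delta> \<in> K" "\<delta> ^ (3 * m) = 1" shows "\<exists>\<tau>\<in>rel_auts K. \<tau> x = x \<and> \<tau> y = \<delta> * y"
proof (rule new_pair)
  show "x \<notin> K" by (rule x_notin)
  show "(\<delta> * y) ^ (3 * m) + x ^ (2 * m) + x ^ m = 0" using eq assms by (simp add: power_mult_distrib)
  fix S assume S: "subfield S" "K \<subseteq> S" "x \<in> S" "\<delta> * y \<in> S"
  have "\<delta> \<noteq> 0" using assms m by (auto simp: power_0_left)
  then have "y = (\<delta> * y) / \<delta>" by simp
  also have "\<dots> \<in> S" using S assms by (intro subfieldD(10)[OF S(1)]) auto
  finally show "x \<in> S \<and> y \<in> S" using S by blast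
qed

lemma aut_Kx: assumes "\<tau> \<in> rel_auts K" "\<tau> x = x" "a \<in> Kx" shows "\<tau> a = a"
  using assms(3) rel_autsD[OF assms(1)] rel_auts_poly[OF assms(1)] assms(2) by (auto simp: Kx_def)

text \<open>If $\tau$ multiplies $y$ by $\delta$ with $\delta^i \neq \delta^j$, then $\tau f - \delta^j f$ has
  lost the $j$-th component of $f$ but not the $i$-th one.\<close>
lemma components:
  assumes "finite I" "I \<subseteq> {..q}" "\<And>i. i \<in> I \<Longrightarrow> a i \<in> Kx" "(\<Sum>i\<in>I. a i * y ^ i) \<in> pole_space" "i \<in> I"
  shows "a i * y ^ i \<in> pole_space"
  using assms
proof (induction "card I" arbitrary: I a rule: less_induct)
  case less
  show ?case
  proof (cases "I = {i}")
    case True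
    then show ?thesis using less.prems by simp
  next
    case False
    then obtain j where j: "j \<in> I" "j \<noteq> i" using less.prems by blast
    have "\<exists>\<delta>\<in>K. \<delta> ^ (3 * m) = 1 \<and> \<delta> ^ i \<noteq> \<delta> ^ j"
    proof -
      define k where "k = (if i < j then j - i else i - j)"
      have "0 < k" "k < 3 * m" using j less.prems qm by (auto simp: k_def)
      from root_of_unity[OF this] obtain \<delta> where \<delta>: "\<delta> \<in> K" "\<delta> ^ (3 * m) = 1" "\<delta> ^ k \<noteq> 1" by blast
      have d0: "\<delta> \<noteq> 0" using \<delta> m by (auto simp: power_0_left)
      have "\<delta> ^ i \<noteq> \<delta> ^ j"
      proof (cases "i < j")
        case True
        then have "\<delta> ^ j = \<delta> ^ i * \<delta> ^ k" by (simp add: k_def flip: power_add)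
        then show ?thesis using \<delta> d0 by simp
      next
        case False
        then have "\<delta> ^ i = \<delta> ^ j * \<delta> ^ k" by (simp add: k_def flip: power_add)
        then show ?thesis using \<delta> d0 by simp
      qed
      then show ?thesis using \<delta> by blast
    qed
    then obtain \<delta> where \<delta>: "\<delta> \<in> K" "\<delta> ^ (3 * m) = 1" "\<delta> ^ i \<noteq> \<delta> ^ j" by blast
    obtain \<tau> where \<tau>: "\<tau> \<in> rel_auts K" "\<tau> x = x" "\<tau> y = \<delta> * y" using torus[OF \<delta>(1,2)] by blast
    note D = rel_autsD[OF \<tau>(1)]
    let ?f = "\<Sum>i\<in>I. a i * y ^ i"
    have "\<tau> ?f = (\<Sum>i\<in>I. \<delta> ^ i * (a i * y ^ i))"
    proof -
      have "\<tau> (a i * y ^ i) = \<delta> ^ i * (a i * y ^ i)" if "i \<in> I" for i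
        using less.prems(3)[OF that] by (simp add: D(3,11) \<tau>(3) aut_Kx[OF \<tau>(1,2)] power_mult_distrib)
      then show ?thesis by (simp add: D(14))
    qed
    then have "\<tau> ?f - \<delta> ^ j * ?f = (\<Sum>i\<in>I. (\<delta> ^ i - \<delta> ^ j) * a i * y ^ i)"
      by (simp only: sum_distrib_left flip: sum_subtractf) (simp add: left_diff_distrib mult.assoc)
    also have "\<dots> = (\<Sum>i\<in>I - {j}. (\<delta> ^ i - \<delta> ^ j) * a i * y ^ i)"
      using less.prems by (intro sum.mono_neutral_right) auto
    finally have eq': "(\<Sum>i\<in>I - {j}. (\<delta> ^ i - \<delta> ^ j) * a i * y ^ i) = \<tau> ?f - \<delta> ^ j * ?f" ..
    have "\<tau> ?f - \<delta> ^ j * ?f \<in> pole_space" 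
      by (rule LD_diff[OF LD_aut[OF \<tau>(1,2) less.prems(4)] LD_scale[OF KD(7)[OF \<delta>(1)] less.prems(4)]])
    moreover have "(\<delta> ^ i - \<delta> ^ j) * a i \<in> Kx" if "i \<in> I - {j}" for i
      using less.prems(3) that Kx_mem KD(6)[OF KD(7)[OF \<delta>(1)] KD(7)[OF \<delta>(1)]]
      by (intro subfieldD(4)[OF Kx_subfield]) auto
    moreover have "card (I - {j}) < card I" using less.prems(1) j by (intro card_Diff1_less)
    ultimately have "(\<delta> ^ i - \<delta> ^ j) * a i * y ^ i \<in> pole_space"
      using less.hyps[of "I - {j}" "\<lambda>i. (\<delta> ^ i - \<delta> ^ j) * a i"] less.prems j eq' by auto
    from LD_scale[OF KD(9)[OF KD(6)[OF KD(7)[OF \<delta>(1), of i] KD(7)[OF \<delta>(1), of j]]] this]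
    have "inverse (\<delta> ^ i - \<delta> ^ j) * ((\<delta> ^ i - \<delta> ^ j) * a i * y ^ i) \<in> pole_space" .
    then show ?thesis using \<delta>(3) by (simp add: mult.assoc[symmetric])
  qed
qed

lemma residues_single: "valring R \<Longrightarrow> K \<subseteq> R \<Longrightarrow> residues K {R}"
  by unfold_locales (auto simp: sf)

text \<open>The coefficient \<open>a\<close> can have a finite pole only over x = 0. Over b with b^m
  = -1 a pole of \<open>a\<close> has order at least q + 1 in \<open>y\<close>, more than
  \<open>y ^ i\<close> can cancel; over other nonzero b the function \<open>y\<close> is a unit and
  cancels nothing.\<close>

lemma monomial_numerator:
  assumes a: "a \<in> Kx" "a \<noteq> 0" and i: "i \<le> q" and pole_space: "a * y ^ i \<in> pole_space"
  shows "\<exists>A c k. poly_over K A \<and> A \<noteq> 0 \<and> c \<in> K \<and> c \<noteq> 0 \<and> a = poly A x / (c * x ^ k) \<and> (k = 0 \<or> poly A 0 \<noteq> 0)"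
proof -
  \<comment> \<open>A denominator of least degree is coprime to its numerator, so each of its roots
    is a genuine pole of \<open>a\<close>.\<close>
  define J where "J B \<longleftrightarrow> (\<exists>A. poly_over K A \<and> poly_over K B \<and> B \<noteq> 0 \<and> a = poly A x / poly B x)" for B
  have "\<exists>B. J B" using a(1) by (auto simp: Kx_def J_def)
  then obtain B where "J B" and min: "\<And>B'. J B' \<Longrightarrow> degree B \<le> degree B'"
    using ex_has_least_nat[of J _ degree] by blast
  then obtain A where AB: "poly_over K A" "poly_over K B" "B \<noteq> 0" "a = poly A x / poly B x" by (auto simp: J_def)
  have A0: "A \<noteq> 0" using AB a by auto
  have coprime: "poly A b \<noteq> 0" if b: "b \<in> K" "poly B b = 0" for b
  proof
    assume *: "poly A b = 0"
    obtain A' where A': "poly_over K A'" "A = [:- b, 1:] * A'" using poly_root_factor[OF sr AB(1) b(1) *] by blast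
    obtain B' where B': "poly_over K B'" "B = [:- b, 1:] * B'" using poly_root_factor[OF sr AB(2) b] by blast
    have B'0: "B' \<noteq> 0" using B' AB by auto
    have "x - b \<noteq> 0" using x_notin b by auto
    moreover have "poly A x = (x - b) * poly A' x" "poly B x = (x - b) * poly B' x"
      by (simp_all add: A'(2) B'(2) algebra_simps)
    ultimately have "a = poly A' x / poly B' x" using AB(4) by simp
    then have "J B'" using A' B' B'0 by (auto simp: J_def)
    moreover have "degree B = Suc (degree B')" using B'0 unfolding B'(2) by (subst degree_mult_eq) auto
    ultimately show False using min[of B'] by simp
  qed
  have Bx: "poly B x \<noteq> 0" using AB x_poly by auto
  have rel: "a * y ^ i * poly B x = poly A x * y ^ i" using Bx AB(4) by simp
  have zero: "b = 0" if b: "b \<in> K" "poly B b = 0" for b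
  proof (rule ccontr)
    assume b0: "b \<noteq> 0"
    obtain B' where B': "poly_over K B'" "B = [:- b, 1:] * B'" using poly_root_factor[OF sr AB(2) b] by blast
    show False
    proof (cases "b ^ m = - 1")
      case True
      then interpret P: curve_place K p e q m x y b using b by unfold_locales
      obtain R where R: "R \<in> P.VP" using P.VP_nonempty by blast
      have vR: "valring R" "K \<subseteq> R" using R by (auto simp: P.VP_def)
      note M = maxidD[OF vR(1)] and D = subringD[OF valring_subringD[OF vR(1)]]
      obtain w d where w: "x - b = y ^ (3 * m) * w" "P.res w d" using P.x_eps by blast
      have "y ^ (3 * m) = y ^ i * y ^ (3 * m - i)" using i qm by (simp flip: power_add)
      then have "poly B x = y ^ i * y ^ (3 * m - i) * w * poly B' x" using w by (simp add: B'(2) algebra_simps)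
      then have "y ^ i * (a * y ^ i * y ^ (3 * m - i) * w * poly B' x) = y ^ i * poly A x"
        using rel by (simp add: mult_ac)
      then have "a * y ^ i * y ^ (3 * m - i) * w * poly B' x = poly A x" using nz by simp
      moreover have "a * y ^ i * (y ^ (3 * m - i) * (w * poly B' x)) \<in> maxid R"
      proof -
        have "a * y ^ i \<in> R" using LDD(1)[OF pole_space vR P.res_mem[OF P.res_x R]] .
        moreover have "w * poly B' x \<in> R" using P.res_mem[OF P.res_mult[OF w(2) P.res_poly[OF B'(1) P.res_x]] R] .
        moreover have "y ^ (3 * m - i) \<in> maxid R"
          using P.res_zero[OF R P.res_y] valring_power_iff[OF vR(1), of "3 * m - i"] i qm by simp
        ultimately show ?thesis using M(3) by (metis mult.commute)
      qed
      moreover have "poly A x \<notin> maxid R"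
        using P.res_nonzero[OF P.res_poly[OF AB(1) P.res_x] coprime[OF b] R] by simp
      ultimately show False by (simp add: mult.assoc)
    next
      case False
      obtain R where R: "valring R" "K \<subseteq> R" "x - b \<in> maxid R" using place_exists[OF sf trans b(1)] by blast
      interpret P: residues K "{R}" by (rule residues_single) fact+
      note M = maxidD[OF R(1)] and D = subringD[OF valring_subringD[OF R(1)]]
      have rx: "P.res x b" using b R by (auto simp: P.res_def)
      then have xR: "x \<in> R" using P.res_mem by blast
      have "P.res (- (x ^ m * (x ^ m + 1))) (- (b ^ m * (b ^ m + 1)))"
        by (intro P.res_uminus P.res_mult P.res_add P.res_power P.res_const rx KD)
      moreover have "b ^ m + 1 \<noteq> 0" using False by (simp add: eq_neg_iff_add_eq_0)
      then have "- (b ^ m * (b ^ m + 1)) \<noteq> 0" using b0 by simp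
      ultimately have "y ^ (3 * m) \<notin> maxid R" unfolding eq_factored using P.res_nonzero by blast
      then have "y \<notin> maxid R" using valring_power_iff[OF R(1), of "3 * m" y] m by simp
      then have yi: "y ^ i \<notin> maxid R" using valring_power_iff[OF R(1), of i y] M(7) by (cases "i = 0") auto
      have "poly A x \<notin> maxid R" using P.res_nonzero(1)[OF P.res_poly[OF AB(1) rx] coprime[OF b]] by simp
      moreover have "poly A x \<in> R" using P.res_mem[OF P.res_poly[OF AB(1) rx]] by simp
      moreover have "y ^ i \<in> R" using finite_place(1)[OF R(1,2) xR] D by auto
      ultimately have "poly A x * y ^ i \<notin> maxid R" using M(10) yi by blast
      moreover have "poly B x \<in> maxid R" using P.res_poly[OF AB(2) rx] b P.res_zero by auto
      then have "a * y ^ i * poly B x \<in> maxid R" using LDD(1)[OF pole_space R(1,2) xR] M(3) by blast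
      ultimately show False using rel by simp
    qed
  qed
  obtain c k where ck: "c \<in> K" "c \<noteq> 0" "B = monom c k" using poly_only_zero_root[OF ac AB(2,3)] zero by blast
  moreover have "k = 0 \<or> poly A 0 \<noteq> 0"
    using coprime[of 0] KD ck by (cases "k = 0") (auto simp: poly_monom power_0_left)
  ultimately show ?thesis using AB A0 by (intro exI[of _ A] exI[of _ c] exI[of _ k]) (auto simp: poly_monom)
qed

text \<open>Only the places over 0 and infinity still constrain the monomial. They give two
  inequalities between \<open>i\<close>, the degree d of the numerator and the exponent k of the
  denominator, and the solutions are exactly the monomials occurring in 1, x, y and y^3/x.\<close>

lemma monomial_in_V:
  assumes a: "a \<in> Kx" and i: "i \<le> q" and pole_space: "a * y ^ i \<in> pole_space"
  shows "a * y ^ i \<in> V"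
proof (cases "a = 0")
  case True
  then show ?thesis using V_gens by simp
next
  case False
  obtain A c k where A: "poly_over K A" "A \<noteq> 0" "c \<in> K" "c \<noteq> 0" "a = poly A x / (c * x ^ k)" "k = 0 \<or> poly A 0 \<noteq> 0"
    using monomial_numerator[OF a False i pole_space] by blast
  define g where "g = a * y ^ i"
  define d where "d = degree A"
  have gLD: "g \<in> pole_space" using pole_space by (simp add: g_def)
  have g: "g * c * x ^ k = poly A x * y ^ i" using A nz by (simp add: g_def)
  \<comment> \<open>Cubing replaces \<open>y ^ 3\<close> by \<open>x * z\<close>; orders of
    \<open>y\<close> that are fractional in terms of \<open>x\<close> become integral.\<close>
  have "(g * c * x ^ k) ^ 3 = (poly A x) ^ 3 * (y ^ 3) ^ i" unfolding g by (simp add: power_mult_distrib power_mult[symmetric] mult.commute)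
  then have g3: "(g * c) ^ 3 * x ^ (3 * k) = (poly A x) ^ 3 * (x ^ i * z ^ i)"
    unfolding yz by (simp add: power_mult_distrib power_mult[symmetric] mult.commute)
  \<comment> \<open>Over x = 0 the function \<open>z\<close> is a unit, since its m-th power has
    residue -1. So the cube of \<open>y ^ i\<close> is worth \<open>x ^ i\<close>, which absorbs
    \<open>x ^ (3 * k)\<close> only if \<open>3 * k \<le> i\<close>.\<close>
  have k3: "3 * k \<le> i" if "k > 0"
  proof (rule ccontr)
    assume *: "\<not> 3 * k \<le> i"
    obtain R where R: "valring R" "K \<subseteq> R" "x - 0 \<in> maxid R" using place_exists[OF sf trans KD(2)] by blast
    interpret P: residues K "{R}" by (rule residues_single) fact+
    note M = maxidD[OF R(1)] and D = subringD[OF valring_subringD[OF R(1)]]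
    have rx: "P.res x 0" using KD R by (auto simp: P.res_def)
    then have xR: "x \<in> R" using P.res_mem by blast
    have zm: "z ^ m = - (x ^ m) - 1" using xz by (simp add: eq_diff_eq eq_neg_iff_add_eq_0 algebra_simps)
    have "P.res (- (x ^ m) - 1) (- (0 ^ m) - 1)"
      by (intro P.res_uminus P.res_diff P.res_power P.res_const rx KD)
    then have "z ^ m \<notin> maxid R" unfolding zm using P.res_nonzero m by (auto simp: power_0_left)
    then have "z \<notin> maxid R" using valring_power_iff[OF R(1), of m z] m by simp
    then have zi: "z ^ i \<notin> maxid R" using valring_power_iff[OF R(1), of i z] M(7) by (cases "i = 0") auto
    have A3: "poly A x ^ 3 \<notin> maxid R" using P.res_nonzero(1)[OF P.res_poly[OF A(1) rx]] A(6) that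
        valring_power_iff[OF R(1), of 3] by simp
    have "poly A x \<in> R" using P.res_mem[OF P.res_poly[OF A(1) rx]] by simp
    then have "poly A x ^ 3 \<in> R" by (rule D(7))
    moreover have "z ^ i \<in> R" using finite_place(2)[OF R(1,2) xR] by (rule D(7))
    ultimately have n: "poly A x ^ 3 * z ^ i \<notin> maxid R" using M(10) A3 zi by blast
    have "x ^ (3 * k) = x ^ i * x ^ (3 * k - i)" using * by (simp flip: power_add)
    then have "(g * c) ^ 3 * x ^ (3 * k - i) = poly A x ^ 3 * z ^ i" using g3 nz by simp
    moreover have "(g * c) ^ 3 \<in> R" using LDD(1)[OF gLD R(1,2) xR] A(3) R(2) by (intro D(4,7)) auto
    moreover have "x ^ (3 * k - i) \<in> maxid R" using R(3) * valring_power_iff[OF R(1), of "3 * k - i"] by simp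
    ultimately show False using n M(3) by metis
  qed
  \<comment> \<open>At infinity \<open>z / x\<close> is a unit, so y^3 grows like x^2 and g^3 like
    the power of x with exponent 3d + 2i - 3k. Membership in the pole space bounds this exponent by
    3.\<close>
  have d3: "3 * d + 2 * i \<le> 3 * k + 3"
  proof (rule ccontr)
    assume *: "\<not> 3 * d + 2 * i \<le> 3 * k + 3"
    define t where "t = inverse x"
    define v where "v = z / x"
    \<comment> \<open>This is the value of the reversed polynomial at \<open>t\<close>; its residue
      is the leading coefficient of \<open>A\<close>, so it is a unit.\<close>
    define u where "u = poly A x * t ^ d"
    define h where "h = g / x"
    have tx: "t * x = 1" using nz by (simp add: t_def)
    have tK: "t \<notin> K" using x_notin KD(9)[of t] by (auto simp: t_def)
    obtain R where R: "valring R" "K \<subseteq> R" "t - 0 \<in> maxid R"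
      using place_exists[OF sf not_mem_transcendental[OF ac tK] KD(2)] by blast
    interpret P: residues K "{R}" by (rule residues_single) fact+
    note M = maxidD[OF R(1)] and D = subringD[OF valring_subringD[OF R(1)]]
    have rt: "P.res t 0" using KD R by (auto simp: P.res_def)
    have xR: "x \<notin> R" using R(3) nz by (auto simp: maxid_def t_def)
    have "P.res (- 1 - t ^ m) (- 1 - 0 ^ m)" by (intro P.res_uminus P.res_diff P.res_power P.res_const rt KD)
    then have "v ^ m \<notin> maxid R" unfolding v_def zx_power t_def[symmetric] using P.res_nonzero m by (auto simp: power_0_left)
    then have "v \<notin> maxid R" using valring_power_iff[OF R(1), of m v] m by simp
    then have vi: "v ^ i \<notin> maxid R" using valring_power_iff[OF R(1), of i v] M(7) by (cases "i = 0") auto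
    have viR: "v ^ i \<in> R" using infinite_place(3)[OF R(1,2) xR] unfolding v_def by (rule D(7))
    have "poly (reflect_poly A) t = t ^ d * poly A (inverse t)"
      unfolding d_def by (rule poly_reflect_poly_nz) (use nz in \<open>simp add: t_def\<close>)
    then have u: "u = poly (reflect_poly A) t" by (simp add: u_def t_def)
    have "poly_over K (reflect_poly A)" using A(1) KD(2) by (auto simp: poly_over_def coeff_reflect_poly)
    then have ru: "P.res u (poly (reflect_poly A) 0)" unfolding u using rt by (rule P.res_poly)
    moreover have "poly (reflect_poly A) 0 \<noteq> 0" using A(2) by (simp add: poly_0_coeff_0)
    ultimately have "u \<notin> maxid R" using P.res_nonzero by blast
    then have u3: "u ^ 3 \<notin> maxid R" using valring_power_iff[OF R(1), of 3 u] by simp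
    have u3R: "u ^ 3 \<in> R" using P.res_mem[OF ru] by (intro D(7)) simp
    define l where "l = 3 * d + 2 * i - (3 * k + 3)"
    have l: "3 * d + 2 * i = 3 * k + 3 + l" "l > 0" using * by (auto simp: l_def)
    have Au: "poly A x = u * x ^ d" using tx by (simp add: u_def mult.assoc power_mult_distrib[symmetric])
    have zv: "z = v * x" and gh: "g = h * x" using nz by (auto simp: v_def h_def)
    have "(h * c) ^ 3 * x ^ (3 * k + 3) = (g * c) ^ 3 * x ^ (3 * k)"
      by (simp add: gh power_mult_distrib power_add)
    also have "\<dots> = u ^ 3 * v ^ i * x ^ (3 * d + 2 * i)"
    proof -
      have "x ^ (3 * d + 2 * i) = (x ^ d) ^ 3 * (x ^ i * x ^ i)"
        by (simp only: power_add mult_2 power_mult[symmetric] mult.commute[of d])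
      then show ?thesis unfolding g3 Au zv by (simp add: power_mult_distrib mult_ac)
    qed
    also have "\<dots> = u ^ 3 * v ^ i * x ^ l * x ^ (3 * k + 3)" unfolding l(1) by (simp add: power_add)
    finally have "(h * c) ^ 3 = u ^ 3 * v ^ i * x ^ l" using nz by simp
    then have "(h * c) ^ 3 * t ^ l = u ^ 3 * v ^ i * (t * x) ^ l" by (simp add: power_mult_distrib)
    then have "(h * c) ^ 3 * t ^ l = u ^ 3 * v ^ i" by (simp add: tx)
    moreover have "(h * c) ^ 3 \<in> R" using LDD(2)[OF gLD R(1,2) xR] A(3) R(2) by (intro D(4,7)) (auto simp: h_def)
    moreover have "t ^ l \<in> maxid R" using R(3) l valring_power_iff[OF R(1), of l] by simp
    ultimately have "u ^ 3 * v ^ i \<in> maxid R" using M(3) by metis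
    then show False using M(10)[OF u3R viR] u3 vi by blast
  qed
  have cK: "coeff A j / c \<in> K" for j using A KD by (auto simp: poly_over_def)
  consider "i = 0" "k = 0" "d \<le> 1" | "i = 1" "k = 0" "d = 0" | "i = 3" "k = 1" "d = 0"
    using k3 d3 by (cases "k = 0") (auto; linarith)+
  then show ?thesis
  proof cases
    case 1
    have "A = [:coeff A 0, coeff A 1:]"
      using 1(3) by (intro poly_eqI) (auto simp: coeff_pCons d_def coeff_eq_0 split: nat.split)
    then have "poly A x = coeff A 0 + coeff A 1 * x" by (metis poly_pCons poly_0 mult_zero_right add_0_right mult.commute)
    then have "a * y ^ i = coeff A 0 / c + coeff A 1 / c * x + 0 * y + 0 * z"
      using 1 by (simp add: A(5) add_divide_distrib)
    also have "\<dots> \<in> V" by (intro VI cK KD)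
    finally show ?thesis .
  next
    case 2
    then obtain b where b: "A = [:b:]" unfolding d_def by (metis degree_eq_zeroE)
    then have "a * y ^ i = 0 + 0 * x + b / c * y + 0 * z" using 2 by (simp add: A(5))
    also have "\<dots> \<in> V" using cK[of 0] b by (intro VI KD(2)) auto
    finally show ?thesis .
  next
    case 3
    then obtain b where b: "A = [:b:]" unfolding d_def by (metis degree_eq_zeroE)
    then have "a * y ^ i = 0 + 0 * x + 0 * y + b / c * z" using 3 by (simp add: A(5) z_def)
    also have "\<dots> \<in> V" using cK[of 0] b by (intro VI KD(2)) auto
    finally show ?thesis .
  qed
qed

lemma LD_subset_V: "f \<in> pole_space \<Longrightarrow> f \<in> V"
proof -
  assume f: "f \<in> pole_space"
  obtain H where H: "poly_over Kx H" "degree H \<le> q" "f = poly H y" using Kx_poly_repr by blast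
  have "poly H y = (\<Sum>i\<le>degree H. coeff H i * y ^ i)" by (rule poly_altdef)
  then have fs: "(\<Sum>i\<le>degree H. coeff H i * y ^ i) = f" using H by simp
  have "coeff H i * y ^ i \<in> V" if "i \<in> {..degree H}" for i
  proof (rule monomial_in_V)
    show "coeff H i \<in> Kx" using H by (auto simp: poly_over_def)
    show "i \<le> q" using that H by simp
    show "coeff H i * y ^ i \<in> pole_space"
      by (rule components[of "{..degree H}" "coeff H"]) (use H f fs that in \<open>auto simp: poly_over_def\<close>)
  qed
  then have "(\<Sum>i\<le>degree H. coeff H i * y ^ i) \<in> V" by (rule V_sum)
  then show "f \<in> V" using fs by simp
qed

lemma V_finite: assumes "f \<in> V" "valring R" "K \<subseteq> R" "x \<in> R" shows "f \<in> R"
proof -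
  note D = subringD[OF valring_subringD[OF assms(2)]]
  obtain a b c d where f: "a \<in> K" "b \<in> K" "c \<in> K" "d \<in> K" "f = a + b * x + c * y + d * z"
    using assms(1) unfolding V_def by blast
  show ?thesis unfolding f(5) using f assms(3,4) finite_place[OF assms(2-4)] by (intro D(3,4)) auto
qed

lemma V_infinite: assumes "f \<in> V" "valring R" "K \<subseteq> R" "x \<notin> R" shows "f / x \<in> R"
proof -
  note D = subringD[OF valring_subringD[OF assms(2)]]
  obtain a b c d where f: "a \<in> K" "b \<in> K" "c \<in> K" "d \<in> K" "f = a + b * x + c * y + d * z"
    using assms(1) unfolding V_def by blast
  have "f / x = a * inverse x + b + c * (y / x) + d * (z / x)" unfolding f(5) using nz by (simp add: field_simps)
  also have "\<dots> \<in> R" using f assms(3) infinite_place[OF assms(2-4)] by (intro D(3,4)) auto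
  finally show ?thesis .
qed

end

section \<open>Automorphisms act linearly\<close>

locale pointed_curve_field = curve_field K p e q m x y + curve_place K p e q m x y \<epsilon>
  for K :: "'f::field set" and p e q m x y \<epsilon>
begin

text \<open>The powers of \<open>y\<close> measure orders at the point. Exponents are natural
  numbers, so a pole is recorded by the alternative \<open>f * y ^ k = u\<close>.\<close>

lemma unit_repr:
  assumes "f \<noteq> 0"
  shows "\<exists>k u c. res u c \<and> c \<noteq> 0 \<and> (f = y ^ k * u \<or> k > 0 \<and> f * y ^ k = u)"
proof -
  obtain P Q where PQ: "poly2_over K P" "poly2_over K Q" "ev Q x y \<noteq> 0" "f = ev P x y / ev Q x y"
    using frac by blast
  have unit: "\<exists>k u c. ev A x y = y ^ k * u \<and> res u c \<and> c \<noteq> 0" if A: "poly2_over K A" "ev A x y \<noteq> 0" for A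
  proof -
    obtain B where "poly2_over K B" "degree B \<le> q" "ev A x y = ev B x y" using reduce[OF A(1)] eq by blast
    moreover have "B \<noteq> 0" using A(2) calculation(3) by auto
    ultimately show ?thesis using ev_unit[of B] by simp
  qed
  obtain a u c where u: "ev P x y = y ^ a * u" "res u c" "c \<noteq> 0" using unit[of P] PQ assms by auto
  obtain b v d where v: "ev Q x y = y ^ b * v" "res v d" "d \<noteq> 0" using unit[of Q] PQ by auto
  have f: "f = y ^ a * u / (y ^ b * v)" using PQ u v by simp
  have r: "res (u / v) (c / d)" "c / d \<noteq> 0" using res_divide u v by auto
  show ?thesis
  proof (cases "b \<le> a")
    case True
    then have "y ^ a = y ^ b * y ^ (a - b)" by (simp flip: power_add)
    then have "f = y ^ (a - b) * (u / v)" using f nz by simp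
    then show ?thesis using r by blast
  next
    case False
    then have "y ^ b = y ^ a * y ^ (b - a)" by (simp flip: power_add)
    then have "f * y ^ (b - a) = u / v" using f nz by simp
    then show ?thesis using r False by (intro exI[of _ "b - a"] exI[of _ "u / v"] exI[of _ "c / d"]) simp
  qed
qed

lemma VP_mem:
  assumes "R \<in> VP" "f \<in> R" "f \<noteq> 0"
  shows "\<exists>k u c. res u c \<and> c \<noteq> 0 \<and> f = y ^ k * u"
proof -
  note M = maxidD[OF valr[OF assms(1)]]
  obtain k u c where k: "res u c" "c \<noteq> 0" "f = y ^ k * u \<or> k > 0 \<and> f * y ^ k = u"
    using unit_repr[OF assms(3)] by blast
  have "\<not> (k > 0 \<and> f * y ^ k = u)"
  proof safe
    assume *: "k > 0" "u = f * y ^ k"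
    have "y ^ k \<in> maxid R" using res_zero[OF assms(1) res_y] valring_power_iff[OF valr[OF assms(1)] *(1)] by blast
    then have "u \<in> maxid R" using * M(3)[OF assms(2)] by simp
    then show False using res_nonzero[OF k(1,2) assms(1)] by simp
  qed
  then show ?thesis using k by blast
qed

lemma res_exists: assumes "R \<in> VP" "f \<in> R" shows "\<exists>c. res f c"
proof (cases "f = 0")
  case True
  then show ?thesis using res_const[OF KD(2)] by blast
next
  case False
  then obtain k u c where "res u c" "f = y ^ k * u" using VP_mem[OF assms] by blast
  then show ?thesis using res_mult[OF res_power[OF res_y]] by blast
qed

text \<open>A residue is by definition taken at all rings of \<open>VP\<close> together. Once every
  element of one of these rings has a residue, it belongs to all the others.\<close>

lemma VP_unique: assumes "R \<in> VP" "S \<in> VP" shows "R = S"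
  using res_exists[OF assms(1)] res_exists[OF assms(2)] res_mem assms by blast

lemma VP_maxid: assumes "R \<in> VP" "f \<in> maxid R" shows "\<exists>g\<in>R. f = y * g"
proof (cases "f = 0")
  case True
  then show ?thesis using subringD(2)[OF valring_subringD[OF valr[OF assms(1)]]] by (intro bexI[of _ 0]) auto
next
  case False
  note M = maxidD[OF valr[OF assms(1)]]
  have "f \<in> R" using M assms by auto
  then obtain k u c where k: "res u c" "c \<noteq> 0" "f = y ^ k * u" using VP_mem[OF assms(1)] False by blast
  have "k \<noteq> 0"
  proof
    assume "k = 0"
    then show False using k assms res_nonzero(1)[OF k(1,2) assms(1)] by simp
  qed
  then obtain j where j: "k = Suc j" by (cases k) auto
  have "f = y * (y ^ j * u)" using k j by simp
  moreover have "y ^ j * u \<in> R" using res_mem[OF res_mult[OF res_power[OF res_y] k(1)] assms(1)] .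
  ultimately show ?thesis by blast
qed

text \<open>\<^term>\<open>pole_bounded r\<close> says that \<^term>\<open>r\<close> lies in $L(qP)$ for the point $P = (\varepsilon, 0)$.
  The order condition at $P$ is phrased through $q$-th powers of elements of the maximal ideal, so that
  it is transported by automorphisms and matches the osculating function $h_Q$, a combination of $q$-th powers,
  without reference to valuations at other points.\<close>
definition pole_bounded :: "'f \<Rightarrow> bool" where
  "pole_bounded r \<longleftrightarrow> (\<forall>R. valring R \<and> K \<subseteq> R \<and> R \<notin> VP \<longrightarrow> r \<in> R) \<and>
     (\<forall>R\<in>VP. \<forall>w\<in>maxid R. w ^ q * r \<in> R)"

text \<open>At the point \<open>x - \<epsilon>\<close> is a unit times \<open>y ^ (q + 1)\<close>,
  so the quotient by it has order -q for \<open>y\<close> and 2 - q for \<open>z\<close>. The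
  constant 1 would give -q - 1, which is too much; this is why it is absent here.\<close>

lemma pole_bounded_quotient:
  assumes f: "f = y \<or> f = z"
  shows "pole_bounded (f / (x - \<epsilon>))"
  unfolding pole_bounded_def
proof (intro conjI allI impI ballI)
  fix R assume R: "valring R \<and> K \<subseteq> R \<and> R \<notin> VP"
  then have vR: "valring R" "K \<subseteq> R" "x - \<epsilon> \<notin> maxid R" by (auto simp: VP_def)
  note M = maxidD[OF vR(1)] and D = subringD[OF valring_subringD[OF vR(1)]]
  have e: "\<epsilon> \<in> R" using eps vR by auto
  show "f / (x - \<epsilon>) \<in> R"
  proof (cases "x \<in> R")
    case True
    have "x - \<epsilon> \<in> R" by (rule D(6)[OF True e])
    then have "inverse (x - \<epsilon>) \<in> R" using M(9) vR(3) by blast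
    moreover have "f \<in> R" using f finite_place[OF vR(1,2) True] by blast
    ultimately show ?thesis using D(4) by (simp add: divide_inverse)
  next
    case False
    have i: "inverse x \<in> maxid R" using infinite_place(1)[OF vR(1,2) False] .
    have em: "\<epsilon> * inverse x \<in> maxid R" using M(3)[OF e i] .
    have "1 - \<epsilon> * inverse x \<notin> maxid R"
    proof
      assume "1 - \<epsilon> * inverse x \<in> maxid R"
      from M(2)[OF this em] show False using M(7) by simp
    qed
    moreover have "1 - \<epsilon> * inverse x \<in> R" using D(6)[OF D(1)] em M(1) by blast
    ultimately have "inverse (1 - \<epsilon> * inverse x) \<in> R" using M(9) by blast
    moreover have "f / x \<in> R" using f infinite_place(3,4)[OF vR(1,2) False] by blast
    moreover have "f / (x - \<epsilon>) = f / x * inverse (1 - \<epsilon> * inverse x)" 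
    proof -
      have "x - \<epsilon> = x * (1 - \<epsilon> * inverse x)" using nz by (simp add: field_simps)
      then show ?thesis by (simp add: divide_inverse)
    qed
    ultimately show ?thesis using D(4) by metis
  qed
next
  fix R w assume R: "R \<in> VP" "w \<in> maxid R"
  note D = subringD[OF valring_subringD[OF valr[OF R(1)]]]
  obtain g where g: "g \<in> R" "w = y * g" using VP_maxid[OF R] by blast
  obtain v c where v: "x - \<epsilon> = y ^ (3 * m) * v" "res v c" "c \<noteq> 0" using x_eps by blast
  have v0: "v \<noteq> 0" using res_nonzero[OF v(2,3) R(1)] by simp
  have iv: "inverse v \<in> R" using res_nonzero[OF v(2,3) R(1)] by simp
  have ix: "inverse x \<in> R" using res_nonzero[OF res_x eps_nz R(1)] by simp
  have yR: "y \<in> R" using res_mem[OF res_y R(1)] .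
  have yq: "y ^ (3 * m) = y ^ q * y" unfolding qm[symmetric] by simp
  have "y ^ q * (f / (x - \<epsilon>)) \<in> R"
  proof (cases "f = y")
    case True
    then have "y ^ q * (f / (x - \<epsilon>)) = inverse v" unfolding v(1) yq using nz v0 by (simp add: field_simps)
    then show ?thesis using iv by simp
  next
    case False
    then have "f = z" using f by simp
    then have "y ^ q * (f / (x - \<epsilon>)) = y * y * inverse x * inverse v"
      unfolding v(1) yq z_def using nz v0 by (simp add: field_simps eval_nat_numeral)
    then show ?thesis using iv ix yR D(4) by simp
  qed
  then have "g ^ q * (y ^ q * (f / (x - \<epsilon>))) \<in> R" using D(4,7) g(1) by blast
  then show "w ^ q * (f / (x - \<epsilon>)) \<in> R" unfolding g(2) by (simp add: power_mult_distrib mult_ac)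
qed

end

context curve_field
begin

lemma V_indep:
  assumes "a \<in> K" "b \<in> K" "c \<in> K" "d \<in> K" "a + b * x + c * y + d * z = 0"
  shows "a = 0" "b = 0" "c = 0" "d = 0"
proof -
  define P where "P = [:[:0, a, b:], [:0, c:], 0, [:d:]:]"
  have "ev P x y = x * (a + b * x + c * y + d * z)"
    using nz by (simp add: P_def z_def algebra_simps eval_nat_numeral)
  then have "ev P x y = 0" using assms by simp
  moreover have "poly2_over K P" unfolding P_def using assms KD
    by (simp add: poly2_over_ring[OF sr] poly_over_pCons poK)
  moreover have "degree P \<le> q" using qm m by (simp add: P_def)
  ultimately have "P = 0" using indep by blast
  then show "a = 0" "b = 0" "c = 0" "d = 0" by (simp_all add: P_def)
qed

text \<open>With a = x^m and b = z^m the left side is a^3 + b^3 + 1 - 3ab, because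
  \<open>y ^ (3 * m)\<close> is ab and every (q+1)-th power is the cube of an m-th power. It has the
  factor a + b + 1 = 0.\<close>

lemma hermitian_identity: "x ^ q * x + z ^ q * z - 3 * (y ^ q * y) + 1 = 0"
proof -
  have e: "u ^ q * u = (u ^ m) ^ 3" for u :: 'a
    unfolding power_mult[symmetric] mult.commute[of m] qm[symmetric] by simp
  have y3: "(y ^ m) ^ 3 = x ^ m * z ^ m" by (metis power_mult mult.commute yz power_mult_distrib)
  have zm: "z ^ m = - 1 - x ^ m" using xz by (simp add: eq_diff_eq eq_neg_iff_add_eq_0 algebra_simps)
  show ?thesis unfolding e y3 zm by (simp add: algebra_simps eval_nat_numeral)
qed

lemma hermitian_identity_infinity:
  "inverse x ^ q * inverse x + (z / x) ^ q * (z / x) - 3 * ((y / x) ^ q * (y / x)) + 1 = 0"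
proof -
  have "(x ^ q * x + z ^ q * z - 3 * (y ^ q * y) + 1) * (inverse x ^ q * inverse x) = 0"
    by (simp add: hermitian_identity)
  moreover have "x ^ q * x * (inverse x ^ q * inverse x) = 1"
    using nz by (simp flip: power_mult_distrib add: field_simps)
  ultimately show ?thesis by (simp add: divide_inverse power_mult_distrib algebra_simps)
qed

end

context pointed_curve_field
begin

text \<open>The witness is the osculating function $h_Q$ at $Q = \sigma(P)$.\<close>
lemma osculating:
  assumes \<sigma>: "\<sigma> \<in> rel_auts K"
  shows "\<exists>h\<in>V. h \<noteq> 0 \<and> (\<forall>r. pole_bounded r \<longrightarrow> \<sigma> r * h \<in> V)"
proof -
  note S = rel_autsD[OF \<sigma>]
  have si: "\<sigma> (inv \<sigma> u) = u" for u using bij_is_surj[OF S(1)] by (simp add: surj_f_inv_f)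
  have left: "inv \<sigma> (\<sigma> u) = u" for u using bij_is_inj[OF S(1)] by simp
  note IA = rel_auts_inv[OF \<sigma>]
  note I = rel_autsD[OF IA]
  obtain R0 where R0: "R0 \<in> VP" using VP_nonempty by blast
  have K0: "K \<subseteq> R0" "valring R0" using R0 by (auto simp: VP_def)
  \<comment> \<open>A function behaves at \<open>Q\<close> as its image under
    \<open>inv \<sigma>\<close> does at the point P, so \<open>Q\<close> is where
    \<open>\<sigma> r\<close> may have its pole.\<close>
  define Q where "Q = inv \<sigma> -` R0"
  note Qv = valring_vimage[OF IA K0(2,1), folded Q_def]
  note D = subringD[OF valring_subringD[OF Qv(1)]]
  have Q_res: "\<exists>c\<in>K. f - c \<in> maxid Q" if "f \<in> Q" for f
  proof -
    from that obtain c where c: "res (inv \<sigma> f) c" using res_exists[OF R0, of "inv \<sigma> f"] by (auto simp: Q_def)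
    have cK: "c \<in> K" using resD(1)[OF c] .
    have "inv \<sigma> (f - c) \<in> maxid R0" using resD(2)[OF c R0] by (simp add: I(8) I(6)[OF cK])
    then show ?thesis using cK by (auto simp: Qv(3))
  qed
  have Q_pole: "w ^ q * \<sigma> r \<in> Q" if "w \<in> maxid Q" "pole_bounded r" for w r
  proof -
    have "inv \<sigma> w ^ q * r \<in> R0" using that R0 by (auto simp: Qv(3) pole_bounded_def)
    then show ?thesis by (simp add: Q_def I(3,11) left)
  qed
  have Q_only: "R = Q" if "\<sigma> -` R \<in> VP" for R
  proof -
    have "\<sigma> -` R = R0" using VP_unique[OF that R0] .
    then have "u \<in> R \<longleftrightarrow> inv \<sigma> u \<in> R0" for u using si[of u] by (metis vimage_eq)
    then show ?thesis by (auto simp: Q_def)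
  qed
  have local: "\<sigma> r * (c0 ^ q * f0 + c1 ^ q * f1 - 3 * (c2 ^ q * f2) + 1) \<in> Q"
    if "f0 ^ q * f0 + f1 ^ q * f1 - 3 * (f2 ^ q * f2) + 1 = 0" "f0 \<in> Q" "f1 \<in> Q" "f2 \<in> Q"
      "f0 - c0 \<in> maxid Q" "f1 - c1 \<in> maxid Q" "f2 - c2 \<in> maxid Q" "pole_bounded r" for f0 f1 f2 c0 c1 c2 r
  proof -
    \<comment> \<open>By additivity of q-th powers, each c^q is f^q - (f - c)^q. The f^q terms
      cancel by the identity, leaving only q-th powers of elements of the maximal ideal, the shape
      that \<open>pole_bounded\<close> controls.\<close>
    have expand: "c0 ^ q * f0 + c1 ^ q * f1 - 3 * (c2 ^ q * f2) + 1
      = (f0 ^ q * f0 + f1 ^ q * f1 - 3 * (f2 ^ q * f2) + 1)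
        - ((f0 - c0) ^ q * f0 + (f1 - c1) ^ q * f1 - 3 * ((f2 - c2) ^ q * f2))"
      unfolding frob by (simp add: algebra_simps)
    have "\<sigma> r * (c0 ^ q * f0 + c1 ^ q * f1 - 3 * (c2 ^ q * f2) + 1)
      = 3 * ((f2 - c2) ^ q * \<sigma> r * f2) - ((f0 - c0) ^ q * \<sigma> r * f0 + (f1 - c1) ^ q * \<sigma> r * f1)"
      unfolding expand that(1) by (simp add: algebra_simps)
    moreover have "3 \<in> Q" using KD(12)[of "Num.Bit1 Num.One"] Qv(2) by blast
    moreover note t = Q_pole[OF that(5,8)] Q_pole[OF that(6,8)] Q_pole[OF that(7,8)]
    ultimately show ?thesis
      using D(6)[OF D(4)[OF _ D(4)[OF t(3) that(4)]] D(3)[OF D(4)[OF t(1) that(2)] D(4)[OF t(2) that(3)]]] by metis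
  qed
  have finish: "\<exists>h\<in>V. h \<noteq> 0 \<and> (\<forall>r. pole_bounded r \<longrightarrow> \<sigma> r * h \<in> V)"
    if h: "h \<in> V" "h \<noteq> 0" and loc: "\<And>r. pole_bounded r \<Longrightarrow> (x \<in> Q \<longrightarrow> \<sigma> r * h \<in> Q) \<and> (x \<notin> Q \<longrightarrow> \<sigma> r * h / x \<in> Q)" for h
  proof (intro bexI[of _ h] conjI allI impI)
    fix r assume r: "pole_bounded r"
    \<comment> \<open>Away from \<open>Q\<close> the function \<open>\<sigma> r\<close> has no pole,
      so \<open>h \<in> V\<close> is enough; at \<open>Q\<close> the zeros of \<open>h\<close>
      cancel the pole.\<close>
    have *: "(x \<in> R \<longrightarrow> \<sigma> r * h \<in> R) \<and> (x \<notin> R \<longrightarrow> \<sigma> r * h / x \<in> R)" if R: "valring R" "K \<subseteq> R" for R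
    proof (cases "\<sigma> -` R \<in> VP")
      case True
      then show ?thesis using Q_only loc[OF r] by blast
    next
      case False
      have "r \<in> \<sigma> -` R" using r valring_vimage(1,2)[OF \<sigma> R] False by (auto simp: pole_bounded_def)
      then have "\<sigma> r \<in> R" by simp
      then show ?thesis using V_finite[OF h(1) R] V_infinite[OF h(1) R]
        subringD(4)[OF valring_subringD[OF R(1)]] by (metis times_divide_eq_right)
    qed
    show "\<sigma> r * h \<in> V" by (rule LD_subset_V, rule LDI) (use * in blast)+
  qed (use h in auto)
  show ?thesis
  proof (cases "x \<in> Q")
    case True
    note yz = finite_place[OF Qv(1,2) True]
    obtain c0 c1 c2 where c: "c0 \<in> K" "c1 \<in> K" "c2 \<in> K" "x - c0 \<in> maxid Q" "z - c1 \<in> maxid Q" "y - c2 \<in> maxid Q"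
      using Q_res[OF True] Q_res[OF yz(1)] Q_res[OF yz(2)] by blast
    define h where "h = c0 ^ q * x + c1 ^ q * z - 3 * (c2 ^ q * y) + 1"
    have heq: "h = 1 + c0 ^ q * x + (- 3 * c2 ^ q) * y + c1 ^ q * z" by (simp add: h_def algebra_simps)
    have hK: "1 \<in> K" "c0 ^ q \<in> K" "- 3 * c2 ^ q \<in> K" "c1 ^ q \<in> K" using c KD by auto
    show ?thesis
    proof (rule finish[of h])
      show "h \<in> V" unfolding heq by (rule VI[OF hK])
      show "h \<noteq> 0" using V_indep(1)[OF hK] unfolding heq by auto
      show "(x \<in> Q \<longrightarrow> \<sigma> r * h \<in> Q) \<and> (x \<notin> Q \<longrightarrow> \<sigma> r * h / x \<in> Q)" if "pole_bounded r" for r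
        using local[OF hermitian_identity True yz(2,1) c(4-6) that] True by (simp add: h_def)
    qed
  next
    case False
    note yz = infinite_place(2-4)[OF Qv(1,2) False]
    obtain c0 c1 c2 where c: "c0 \<in> K" "c1 \<in> K" "c2 \<in> K" "inverse x - c0 \<in> maxid Q" "z / x - c1 \<in> maxid Q" "y / x - c2 \<in> maxid Q"
      using Q_res[OF yz(1)] Q_res[OF yz(2)] Q_res[OF yz(3)] by blast
    \<comment> \<open>When \<open>x\<close> has a pole at \<open>Q\<close>, the identity is used in
      the chart 1/x, z/x, y/x and multiplied by \<open>x\<close> to return to V. Now the coefficient
      1 of \<open>x\<close>, instead of the constant term, shows that \<open>h\<close> is not
      zero.\<close>
    define h where "h = x * (c0 ^ q * inverse x + c1 ^ q * (z / x) - 3 * (c2 ^ q * (y / x)) + 1)"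
    have heq: "h = c0 ^ q + 1 * x + (- 3 * c2 ^ q) * y + c1 ^ q * z" using nz by (simp add: h_def field_simps)
    have hK: "c0 ^ q \<in> K" "1 \<in> K" "- 3 * c2 ^ q \<in> K" "c1 ^ q \<in> K" using c KD by auto
    show ?thesis
    proof (rule finish[of h])
      show "h \<in> V" unfolding heq by (rule VI[OF hK])
      show "h \<noteq> 0" using V_indep(2)[OF hK] unfolding heq by auto
      show "(x \<in> Q \<longrightarrow> \<sigma> r * h \<in> Q) \<and> (x \<notin> Q \<longrightarrow> \<sigma> r * h / x \<in> Q)" if "pole_bounded r" for r
        using local[OF hermitian_identity_infinity yz c(4-6) that] False nz by (simp add: h_def)
    qed
  qed
qed

text \<open>Take \<open>h / \<sigma> (x - \<epsilon>)\<close> as multiplier: it turns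
  \<open>\<sigma> (x - \<epsilon>)\<close> into \<open>h\<close> itself, and the other two images
  into products of \<open>h\<close> with functions of bounded pole.\<close>

lemma half_invariance:
  assumes \<sigma>: "\<sigma> \<in> rel_auts K"
  shows "\<exists>\<phi>. \<phi> \<noteq> 0 \<and> \<phi> * \<sigma> (x - \<epsilon>) \<in> V \<and> \<phi> * \<sigma> y \<in> V \<and> \<phi> * \<sigma> z \<in> V"
proof -
  note S = rel_autsD[OF \<sigma>]
  obtain h where h: "h \<in> V" "h \<noteq> 0" "\<And>r. pole_bounded r \<Longrightarrow> \<sigma> r * h \<in> V" using osculating[OF \<sigma>] by blast
  have xe: "x - \<epsilon> \<noteq> 0" using x_notin eps by auto
  have "\<sigma> y / \<sigma> (x - \<epsilon>) * h \<in> V" "\<sigma> z / \<sigma> (x - \<epsilon>) * h \<in> V"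
    using h(3)[OF pole_bounded_quotient[of y]] h(3)[OF pole_bounded_quotient[of z]] unfolding S(10) by blast+
  moreover have "\<sigma> (x - \<epsilon>) \<noteq> 0" using xe S(12) by blast
  ultimately show ?thesis using h by (intro exI[of _ "h / \<sigma> (x - \<epsilon>)"]) (simp add: mult.commute)
qed

end

section \<open>Linear forms in four variables\<close>

lemma lessThan_four: "{..<4::nat} = {0, 1, 2, 3}"
  by auto

definition lin :: "(nat \<Rightarrow> 'f::field) \<Rightarrow> (nat \<Rightarrow> 'f) \<Rightarrow> 'f" where
  "lin a T = (\<Sum>i<4. a i * T i)"

lemma lin4: "lin a T = a 0 * T 0 + a 1 * T 1 + a 2 * T 2 + a 3 * T 3"
  by (simp add: lin_def lessThan_four algebra_simps)

lemma lin_add: "lin a (\<lambda>i. T i + U i) = lin a T + lin a U"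
  by (simp add: lin4 algebra_simps)

text \<open>If some a_i is nonzero, the kernel vectors a_j e_i - a_i e_j force c_i a_j = c_j a_i. If
  all vanish, every vector is in the kernel and k = 0 works.\<close>

lemma lin_kernel:
  assumes S: "subfield S" and ac: "\<And>i. a i \<in> S" "\<And>i. c i \<in> S"
    and ker: "\<And>T. lin a T = 0 \<Longrightarrow> lin c T = 0"
  shows "\<exists>k\<in>S. \<forall>i<4. c i = k * a i"
proof (cases "\<exists>i<4. a i \<noteq> 0")
  case True
  then obtain i where i: "i < 4" "a i \<noteq> 0" by blast
  have "c j = c i / a i * a j" if j: "j < 4" for j
  proof (cases "j = i")
    case False
    let ?T = "\<lambda>n. if n = i then a j else if n = j then - a i else 0"
    have "(\<Sum>n<4. b n * ?T n) = (\<Sum>n\<in>{i, j}. b n * ?T n)" for b :: "nat \<Rightarrow> 'a"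
      using i j by (intro sum.mono_neutral_right) auto
    then have T: "lin b ?T = b i * a j - b j * a i" for b :: "nat \<Rightarrow> 'a"
      using False by (simp add: lin_def)
    have "lin a ?T = 0" unfolding T by simp
    then have "lin c ?T = 0" by (rule ker)
    then show ?thesis unfolding T using i by (simp add: field_simps)
  qed (use i in simp)
  moreover have "c i / a i \<in> S" using ac by (intro subfieldD[OF S])
  ultimately show ?thesis by blast
next
  case False
  have "c j = 0" if j: "j < 4" for j
  proof -
    have "lin c (\<lambda>n. if n = j then 1 else 0) = 0" using False by (intro ker) (simp add: lin_def)
    then show ?thesis using j by (simp add: lin_def if_distrib[of "\<lambda>u. _ * u"] cong: if_cong)
  qed
  then show ?thesis using subfieldD(2)[OF S] by (intro bexI[of _ 0]) auto
qed

text \<open>Where $a$ vanishes and $b$ does not, $c$ vanishes; such points span the kernel of $a$.\<close>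
lemma lin_product_cancel:
  assumes S: "subfield S" and mem: "\<And>i. a i \<in> S" "\<And>i. b i \<in> S" "\<And>i. c i \<in> S"
    and prod: "\<And>T. lin a T * lin d T = lin b T * lin c T"
    and indep: "\<not> (\<exists>k\<in>S. \<forall>i<4. b i = k * a i)"
  shows "\<exists>k\<in>S. \<forall>i<4. c i = k * a i"
proof (rule lin_kernel[of S a c, OF S mem(1,3)])
  fix T assume T: "lin a T = 0"
  obtain U where U: "lin a U = 0" "lin b U \<noteq> 0" using lin_kernel[of S a b, OF S mem(1,2)] indep by blast
  have c0: "lin c W = 0" if "lin a W = 0" "lin b W \<noteq> 0" for W using prod[of W] that by simp
  show "lin c T = 0"
  proof (cases "lin b T = 0")
    case True
    then have "lin c (\<lambda>i. T i + U i) = 0" using T U by (intro c0) (simp_all add: lin_add)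
    then show ?thesis using c0[OF U] by (simp add: lin_add)
  next
    case False
    then show ?thesis using c0 T by blast
  qed
qed

section \<open>Quadratic and cubic relations among 1, x, y, z\<close>

context curve_field
begin

text \<open>Index 2 is \<open>y\<close>, so the indices 0, 1, 3 belong to the three interchangeable
  coordinates. Indices above 3 repeat \<open>z\<close>, which keeps every value nonzero without a
  bound on the index.\<close>

definition coords :: "nat \<Rightarrow> 'a" where
  "coords i = (if i = 0 then 1 else if i = 1 then x else if i = 2 then y else z)"

lemma V_lin: "f \<in> V \<Longrightarrow> \<exists>a. (\<forall>i. a i \<in> K) \<and> f = lin a coords"
proof -
  assume "f \<in> V"
  then obtain a b c d where *: "a \<in> K" "b \<in> K" "c \<in> K" "d \<in> K" "f = a + b * x + c * y + d * z"
    unfolding V_def by blast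
  then show ?thesis
    by (intro exI[of _ "\<lambda>i. if i = 0 then a else if i = 1 then b else if i = 2 then c else d"])
       (auto simp: lin4 coords_def)
qed

text \<open>After multiplication by \<open>x ^ 2\<close> the ten products of two coordinates are
  distinct monomials in \<open>x\<close> and \<open>y\<close>, of degree at most 6 in
  \<open>y\<close>. Hence each symmetrised coefficient vanishes.\<close>

lemma no_quadric:
  assumes K: "\<And>i j. A i j \<in> K" and zero: "(\<Sum>i<4. \<Sum>j<4. A i j * coords i * coords j) = 0"
  shows "(\<Sum>i<4. \<Sum>j<4. A i j * T i * T j) = (0 :: 'a)"
proof -
  define B where "B i j = A i j + A j i" for i j
  define P where "P = [:[:0, 0, A 0 0, B 0 1, A 1 1:], [:0, 0, B 0 2, B 1 2:], [:0, 0, A 2 2:],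
    [:0, B 0 3, B 1 3:], [:0, B 2 3:], 0, [:A 3 3:]:]"
  have BK: "B i j \<in> K" for i j using K KD by (simp add: B_def)
  have "ev P x y = x ^ 2 * (\<Sum>i<4. \<Sum>j<4. A i j * coords i * coords j)"
    using nz by (simp add: P_def lessThan_four coords_def z_def B_def algebra_simps eval_nat_numeral)
  then have "ev P x y = 0" using zero by simp
  moreover have "poly2_over K P" unfolding P_def using K BK KD
    by (simp add: poly2_over_ring[OF sr] poly_over_pCons poK)
  moreover have "degree P \<le> q" using qm m by (simp add: P_def)
  ultimately have "P = 0" using indep by blast
  then have z: "A 0 0 = 0" "A 1 1 = 0" "A 2 2 = 0" "A 3 3 = 0"
    "B 0 1 = 0" "B 0 2 = 0" "B 0 3 = 0" "B 1 2 = 0" "B 1 3 = 0" "B 2 3 = 0"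
    by (simp_all add: P_def)
  have expand: "(\<Sum>i<4. \<Sum>j<4. A i j * T i * T j) = A 0 0 * T 0 * T 0 + A 1 1 * T 1 * T 1 + A 2 2 * T 2 * T 2 + A 3 3 * T 3 * T 3
    + B 0 1 * T 0 * T 1 + B 0 2 * T 0 * T 2 + B 0 3 * T 0 * T 3 + B 1 2 * T 1 * T 2 + B 1 3 * T 1 * T 3 + B 2 3 * T 2 * T 3"
    by (simp add: lessThan_four B_def algebra_simps)
  show ?thesis unfolding expand z by simp
qed

definition sym3 :: "(nat \<Rightarrow> nat \<Rightarrow> nat \<Rightarrow> 'a) \<Rightarrow> nat \<Rightarrow> nat \<Rightarrow> nat \<Rightarrow> 'a" where
  "sym3 A i j k = A i j k + A i k j + A j i k + A j k i + A k i j + A k j i"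

text \<open>For distinct indices this is the coefficient of T_i^2 T_j, just as \<open>sym3\<close>
  is that of T_i T_j T_k. For i = j it is three times the coefficient of T_i^3.\<close>

definition sym21 :: "(nat \<Rightarrow> nat \<Rightarrow> nat \<Rightarrow> 'a) \<Rightarrow> nat \<Rightarrow> nat \<Rightarrow> 'a" where
  "sym21 A i j = A i i j + A i j i + A j i i"

text \<open>The only cubic relation among $1, x, y, z$ is $1 \cdot x \cdot z = y^3$; this uses that cubic monomials
  in them have degree at most $9 \<le> q$ in $y$.\<close>
lemma cubic_coeffs:
  assumes K: "\<And>i j k. A i j k \<in> K" and zero: "(\<Sum>i<4. \<Sum>j<4. \<Sum>k<4. A i j k * coords i * coords j * coords k) = 0"
  shows "\<lbrakk>i \<in> {0, 1, 3}; j \<in> {0, 1, 2, 3}\<rbrakk> \<Longrightarrow> sym21 A i j = 0"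
    "\<lbrakk>i \<in> {0, 1, 3}; j \<in> {0, 1, 3}; i \<noteq> j\<rbrakk> \<Longrightarrow> sym3 A i j 2 = 0"
proof -
  let ?C = "sym21 A" and ?D = "sym3 A"
  \<comment> \<open>Multiplication by \<open>x ^ 3\<close> clears the denominators of
    \<open>z\<close>. Of the twenty cubic monomials only T_0 T_1 T_3 and T_2^3 then coincide, both
    being x^3 y^3; hence the one entry that is a sum of two coefficients.\<close>
  define P where "P = [:[:0, 0, 0, A 0 0 0, ?C 0 1, ?C 1 0, A 1 1 1:],
    [:0, 0, 0, ?C 0 2, ?D 0 1 2, ?C 1 2:],
    [:0, 0, 0, ?C 2 0, ?C 2 1:],
    [:0, 0, ?C 0 3, ?D 0 1 3 + A 2 2 2, ?C 1 3:],
    [:0, 0, ?D 0 2 3, ?D 1 2 3:],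
    [:0, 0, ?C 2 3:],
    [:0, ?C 3 0, ?C 3 1:],
    [:0, ?C 3 2:], 0, [:A 3 3 3:]:]"
  have "ev P x y = x ^ 3 * (\<Sum>i<4. \<Sum>j<4. \<Sum>k<4. A i j k * coords i * coords j * coords k)"
    using nz by (simp add: P_def lessThan_four coords_def z_def sym3_def sym21_def algebra_simps eval_nat_numeral)
  then have "ev P x y = 0" using zero by simp
  moreover have "poly2_over K P" unfolding P_def sym3_def sym21_def using K KD
    by (simp add: poly2_over_ring[OF sr] poly_over_pCons poK)
  moreover have "degree P \<le> q" using qm m by (simp add: P_def)
  ultimately have P0: "P = 0" using indep by blast
  then have "A 0 0 0 = 0" "A 1 1 1 = 0" "A 3 3 3 = 0" by (simp_all add: P_def)
  then have C: "?C 0 0 = 0" "?C 1 1 = 0" "?C 3 3 = 0" by (simp_all add: sym21_def)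
  show "\<lbrakk>i \<in> {0, 1, 3}; j \<in> {0, 1, 2, 3}\<rbrakk> \<Longrightarrow> ?C i j = 0"
    using P0 C by (auto simp: P_def)
  have D: "?D 0 1 2 = 0" "?D 0 2 3 = 0" "?D 1 2 3 = 0" using P0 by (simp_all add: P_def)
  have "?D 0 3 2 = ?D 0 2 3" "?D 1 3 2 = ?D 1 2 3" "?D 1 0 2 = ?D 0 1 2" "?D 3 0 2 = ?D 0 2 3" "?D 3 1 2 = ?D 1 2 3"
    by (simp_all add: sym3_def)
  with D show "\<lbrakk>i \<in> {0, 1, 3}; j \<in> {0, 1, 3}; i \<noteq> j\<rbrakk> \<Longrightarrow> ?D i j 2 = 0" by auto
qed

text \<open>Let \<phi> and \<psi> be the multipliers from the points with \<epsilon> and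
  -\<epsilon>. The images of \<open>y\<close> and \<open>z\<close> under both satisfy a quadratic
  relation, which is an identity of linear forms by \<open>no_quadric\<close>; cancelling
  independent forms makes \<psi> a constant multiple of \<phi>. Thus one multiplier serves both x +
  \<epsilon> and x - \<epsilon>, whose difference 2\<epsilon> gives the constant 1.\<close>

lemma V_invariant:
  assumes \<sigma>: "\<sigma> \<in> rel_auts K"
  shows "\<exists>\<phi>. \<phi> \<noteq> 0 \<and> \<phi> \<in> V \<and> \<phi> * \<sigma> x \<in> V \<and> \<phi> * \<sigma> y \<in> V \<and> \<phi> * \<sigma> z \<in> V"
proof -
  note S = rel_autsD[OF \<sigma>]
  obtain \<epsilon> where e: "\<epsilon> \<in> K" "\<epsilon> ^ m = - 1" using root_exists by blast
  interpret P1: pointed_curve_field K p e q m x y \<epsilon> using e by unfold_locales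
  have "(- \<epsilon>) ^ m = - 1" using e m by simp
  then interpret P2: pointed_curve_field K p e q m x y "- \<epsilon>" using e KD by unfold_locales auto
  obtain \<phi> where \<phi>: "\<phi> \<noteq> 0" "\<phi> * \<sigma> (x - \<epsilon>) \<in> V" "\<phi> * \<sigma> y \<in> V" "\<phi> * \<sigma> z \<in> V" using P1.half_invariance[OF \<sigma>] by blast
  obtain \<psi> where \<psi>: "\<psi> \<noteq> 0" "\<psi> * \<sigma> (x - - \<epsilon>) \<in> V" "\<psi> * \<sigma> y \<in> V" "\<psi> * \<sigma> z \<in> V" using P2.half_invariance[OF \<sigma>] by blast
  obtain a where a: "\<And>i. a i \<in> K" "\<phi> * \<sigma> y = lin a coords" using V_lin[OF \<phi>(3)] by blast
  obtain b where b: "\<And>i. b i \<in> K" "\<phi> * \<sigma> z = lin b coords" using V_lin[OF \<phi>(4)] by blast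
  obtain c where c: "\<And>i. c i \<in> K" "\<psi> * \<sigma> y = lin c coords" using V_lin[OF \<psi>(3)] by blast
  obtain d where d: "\<And>i. d i \<in> K" "\<psi> * \<sigma> z = lin d coords" using V_lin[OF \<psi>(4)] by blast
  have "\<exists>k\<in>K. \<forall>i<4. c i = k * a i"
  proof (rule lin_product_cancel[OF sf a(1) b(1) c(1)])
    have ex: "lin a T * lin d T - lin b T * lin c T = (\<Sum>i<4. \<Sum>j<4. (a i * d j - b i * c j) * T i * T j)" for T
      by (simp add: lin4 lessThan_four algebra_simps)
    have "lin a coords * lin d coords - lin b coords * lin c coords = 0"
      unfolding a(2)[symmetric] b(2)[symmetric] c(2)[symmetric] d(2)[symmetric] by simp
    then have z0: "(\<Sum>i<4. \<Sum>j<4. (a i * d j - b i * c j) * coords i * coords j) = 0"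
      unfolding ex .
    have AK: "a i * d j - b i * c j \<in> K" for i j
      by (rule KD(6)[OF KD(4)[OF a(1) d(1)] KD(4)[OF b(1) c(1)]])
    have "(\<Sum>i<4. \<Sum>j<4. (a i * d j - b i * c j) * T i * T j) = 0" for T
      by (rule no_quadric[OF AK z0])
    then show "lin a T * lin d T = lin b T * lin c T" for T using ex[of T] by simp
    show "\<not> (\<exists>k\<in>K. \<forall>i<4. b i = k * a i)"
    proof
      assume "\<exists>k\<in>K. \<forall>i<4. b i = k * a i"
      then obtain k where k: "k \<in> K" "\<And>i. i < 4 \<Longrightarrow> b i = k * a i" by blast
      have "lin b coords = k * lin a coords" by (simp add: lin4 k(2) algebra_simps)
      then have "\<phi> * \<sigma> z = \<phi> * \<sigma> (k * y)" by (simp add: a(2)[symmetric] b(2)[symmetric] S(3) S(6)[OF k(1)])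
      then have "z = k * y" using \<phi>(1) S(13) by simp
      then show False using V_indep(4)[of 0 0 "- k" 1] k KD by simp
    qed
  qed
  then obtain k where k: "k \<in> K" "\<And>i. i < 4 \<Longrightarrow> c i = k * a i" by blast
  have "lin c coords = k * lin a coords" by (simp add: lin4 k(2) algebra_simps)
  then have "\<psi> * \<sigma> y = k * \<phi> * \<sigma> y" by (simp add: a(2)[symmetric] c(2)[symmetric])
  then have \<psi>k: "\<psi> = k * \<phi>" using nz S(12)[of y] by simp
  then have k0: "k \<noteq> 0" using \<psi> by auto
  have "inverse k * (\<psi> * \<sigma> (x - - \<epsilon>)) \<in> V" by (rule V_scale[OF KD(9)[OF k(1)] \<psi>(2)])
  moreover have "inverse k * (\<psi> * \<sigma> (x - - \<epsilon>)) = \<phi> * \<sigma> (x + \<epsilon>)"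
    unfolding \<psi>k using k0 by (simp add: field_simps)
  ultimately have p: "\<phi> * \<sigma> (x + \<epsilon>) \<in> V" by metis
  have e0: "\<epsilon> \<noteq> 0" using P1.eps_nz .
  have "inverse (2 * \<epsilon>) * (\<phi> * \<sigma> (x + \<epsilon>) - \<phi> * \<sigma> (x - \<epsilon>)) \<in> V"
    by (rule V_scale[OF KD(9)[OF KD(4)[OF KD(12) e(1)]] V_diff[OF p \<phi>(2)]])
  moreover have "\<phi> * \<sigma> (x + \<epsilon>) - \<phi> * \<sigma> (x - \<epsilon>) = 2 * \<epsilon> * \<phi>"
    by (simp add: S(2,8) S(6)[OF e(1)] algebra_simps)
  moreover have "inverse (2 * \<epsilon>) * (2 * \<epsilon> * \<phi>) = \<phi>" using e0 two by (simp add: field_simps)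
  ultimately have 1: "\<phi> \<in> V" by metis
  have "\<phi> * \<sigma> (x - \<epsilon>) + \<epsilon> * \<phi> \<in> V" by (rule V_add[OF \<phi>(2) V_scale[OF e(1) 1]])
  then have "\<phi> * \<sigma> x \<in> V" by (simp add: S(8) S(6)[OF e(1)] algebra_simps)
  then show ?thesis using \<phi> 1 by blast
qed

section \<open>Automorphisms are monomial\<close>

lemma coords_mem: "coords 0 = 1" "coords 1 = x" "coords 2 = y" "coords 3 = z" "coords (Suc 0) = x" "coords i \<noteq> 0"
  using nz z_nz by (simp_all add: coords_def)

lemma three: "(3::'a) \<noteq> 0"
proof
  assume "(3::'a) = 0"
  then have "of_nat (3 * m) = (0::'a)" by simp
  then show False by (metis of_nat_m(1) zero_neq_one)
qed

lemma linear_matrix: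
  assumes \<sigma>: "\<sigma> \<in> rel_auts K"
  shows "\<exists>\<phi> M. \<phi> \<noteq> 0 \<and> (\<forall>j i. M j i \<in> K) \<and> (\<forall>j<4. \<phi> * \<sigma> (coords j) = lin (M j) coords)"
proof -
  obtain \<phi> where \<phi>: "\<phi> \<noteq> 0" "\<phi> \<in> V" "\<phi> * \<sigma> x \<in> V" "\<phi> * \<sigma> y \<in> V" "\<phi> * \<sigma> z \<in> V"
    using V_invariant[OF \<sigma>] by blast
  have "\<phi> * \<sigma> (coords j) \<in> V" for j using \<phi> rel_autsD(4)[OF \<sigma>] by (auto simp: coords_def)
  then have "\<forall>j. \<exists>a. (\<forall>i. a i \<in> K) \<and> \<phi> * \<sigma> (coords j) = lin a coords" using V_lin by blast
  then obtain M where "\<forall>j. (\<forall>i. M j i \<in> K) \<and> \<phi> * \<sigma> (coords j) = lin (M j) coords" by metis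
  then show ?thesis using \<phi>(1) by blast
qed

text \<open>The matrix of an automorphism preserves the cubic form $T_0 T_1 T_3 - T_2^3$ up to a factor, hence
  permutes the singular points of the cubic surface, which are three of the four coordinate points. In
  coordinates: for $i \<noteq> 2$ the coefficients of all $T_i^2 T_j$ vanish (fact \<open>col\<close>).\<close>
lemma monomial_form:
  assumes \<sigma>: "\<sigma> \<in> rel_auts K"
  shows "\<exists>c0\<in>{0, 1, 3}. \<exists>c1\<in>{0, 1, 3}. \<exists>\<gamma>\<in>K. \<exists>\<delta>\<in>K. c0 \<noteq> c1 \<and>
    \<sigma> x = \<gamma> * (coords c1 / coords c0) \<and> \<sigma> y = \<delta> * (y / coords c0)"
proof -
  note S = rel_autsD[OF \<sigma>]
  obtain \<phi> M where \<phi>: "\<phi> \<noteq> 0" and MK: "\<And>j i. M j i \<in> K"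
    and MV: "\<And>j. j < 4 \<Longrightarrow> \<phi> * \<sigma> (coords j) = lin (M j) coords" using linear_matrix[OF \<sigma>] by blast
  have L: "lin (M 0) coords = \<phi>" "lin (M 1) coords = \<phi> * \<sigma> x" "lin (M 2) coords = \<phi> * \<sigma> y" "lin (M 3) coords = \<phi> * \<sigma> z"
    using MV[of 0] MV[of 1] MV[of 2] MV[of 3] S(4) by (simp_all add: coords_mem)
  have indep: "a = 0 \<and> b = 0 \<and> c = 0 \<and> d = 0"
    if K: "a \<in> K" "b \<in> K" "c \<in> K" "d \<in> K"
      and "a * lin (M 0) coords + b * lin (M 1) coords + c * lin (M 2) coords + d * lin (M 3) coords = 0" for a b c d
  proof -
    have "\<phi> * \<sigma> (a + b * x + c * y + d * z) = 0"
      using that(5) unfolding L by (simp add: S(2,3) S(6)[OF K(1)] S(6)[OF K(2)] S(6)[OF K(3)] S(6)[OF K(4)] algebra_simps)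
    then have "a + b * x + c * y + d * z = 0" using \<phi> S(12) by simp
    then show ?thesis using V_indep[OF K] by simp
  qed
  define A where "A i j k = M 0 i * M 1 j * M 3 k - M 2 i * M 2 j * M 2 k" for i j k
  have AK: "A i j k \<in> K" for i j k unfolding A_def using MK by (intro KD(4,6))
  have "(\<Sum>i<4. \<Sum>j<4. \<Sum>k<4. A i j k * coords i * coords j * coords k)
    = lin (M 0) coords * lin (M 1) coords * lin (M 3) coords - lin (M 2) coords ^ 3"
  proof -
    have prod3: "lin a T * lin b T * lin c T = (\<Sum>i<4. \<Sum>j<4. \<Sum>k<4. a i * b j * c k * T i * T j * T k)" for a b c T :: "nat \<Rightarrow> 'a"
      by (simp add: lin4 lessThan_four algebra_simps)
    have "lin (M 2) coords ^ 3 = lin (M 2) coords * lin (M 2) coords * lin (M 2) coords" by (simp add: eval_nat_numeral mult_ac)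
    then show ?thesis by (simp only: prod3 A_def left_diff_distrib sum_subtractf)
  qed
  also have "\<dots> = \<phi> ^ 3 * \<sigma> (x * z - y ^ 3)" unfolding L S(3,8,11) by (simp add: power_mult_distrib algebra_simps eval_nat_numeral)
  also have "\<dots> = 0" by (simp add: yz S(5))
  finally have zero: "(\<Sum>i<4. \<Sum>j<4. \<Sum>k<4. A i j k * coords i * coords j * coords k) = 0" .
  note coeffs = cubic_coeffs[of A, OF AK zero]
  have col: "M 1 i * M 3 i = 0 \<and> M 0 i * M 3 i = 0 \<and> M 0 i * M 1 i = 0 \<and> M 2 i = 0" if i: "i \<in> {0, 1, 3}" for i
  proof -
    \<comment> \<open>These are the partial derivatives of the cubic form at the i-th column of
      \<open>M\<close>. The vanishing coefficients of T_i^2 T_j make them a linear relation between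
      the rows, which are independent, so the gradient vanishes there.\<close>
    let ?a = "M 1 i * M 3 i" and ?b = "M 0 i * M 3 i" and ?c = "- (3 * (M 2 i * M 2 i))" and ?d = "M 0 i * M 1 i"
    have w: "?a * M 0 j + ?b * M 1 j + ?c * M 2 j + ?d * M 3 j = 0" if "j \<in> {0, 1, 2, 3}" for j
      using coeffs(1)[OF i that] by (simp add: sym21_def A_def algebra_simps)
    have "?a * lin (M 0) coords + ?b * lin (M 1) coords + ?c * lin (M 2) coords + ?d * lin (M 3) coords
      = (?a * M 0 0 + ?b * M 1 0 + ?c * M 2 0 + ?d * M 3 0) * coords 0
      + (?a * M 0 1 + ?b * M 1 1 + ?c * M 2 1 + ?d * M 3 1) * coords 1
      + (?a * M 0 2 + ?b * M 1 2 + ?c * M 2 2 + ?d * M 3 2) * coords 2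
      + (?a * M 0 3 + ?b * M 1 3 + ?c * M 2 3 + ?d * M 3 3) * coords 3"
      unfolding lin4 by (simp only: distrib_left distrib_right mult.assoc add_ac)
    also have "\<dots> = 0" using w[of 0] w[of 1] w[of 2] w[of 3] by simp
    finally have "?a = 0 \<and> ?b = 0 \<and> ?c = 0 \<and> ?d = 0"
      by (intro indep) (intro KD(4,5,12) MK)+
    then show ?thesis using three by simp
  qed
  \<comment> \<open>Row 2 is supported on index 2 alone by \<open>col\<close>; a further row of this
    kind would be proportional to it.\<close>
  have row: "\<exists>c\<in>{0, 1, 3}. M j c \<noteq> 0" if j: "j \<in> {0, 1, 3}" for j
  proof (rule ccontr)
    assume "\<not> (\<exists>c\<in>{0, 1, 3}. M j c \<noteq> 0)"
    then have z: "M j 0 = 0" "M j 1 = 0" "M j 3 = 0" by auto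
    have z2: "M 2 0 = 0" "M 2 1 = 0" "M 2 3 = 0" using col by auto
    have Lj: "lin (M j) coords = M j 2 * y" unfolding lin4 z coords_mem by simp
    have L2: "lin (M 2) coords = M 2 2 * y" unfolding lin4 z2 coords_mem by simp
    have "M 2 2 * lin (M j) coords + (- M j 2) * lin (M 2) coords = 0" unfolding Lj L2 by simp
    then have "M 2 2 = 0"
      using j indep[of "M 2 2" 0 "- M j 2" 0] indep[of 0 "M 2 2" "- M j 2" 0] indep[of 0 0 "- M j 2" "M 2 2"]
        MK KD(2) KD(5)[OF MK] by auto
    then have "\<phi> * \<sigma> y = 0" using L(3) unfolding L2 by simp
    then show False using \<phi> S(12) nz by simp
  qed
  obtain c0 where c0: "c0 \<in> {0, 1, 3}" "M 0 c0 \<noteq> 0" using row[of 0] by blast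
  obtain c1 where c1: "c1 \<in> {0, 1, 3}" "M 1 c1 \<noteq> 0" using row[of 1] by blast
  obtain c3 where c3: "c3 \<in> {0, 1, 3}" "M 3 c3 \<noteq> 0" using row[of 3] by blast
  have ne: "c0 \<noteq> c1" "c0 \<noteq> c3" "c1 \<noteq> c3" using c0 c1 c3 col[OF c0(1)] col[OF c1(1)] by auto
  have z: "M 0 c1 = 0" "M 0 c3 = 0" "M 1 c0 = 0" "M 1 c3 = 0" "M 3 c0 = 0" "M 3 c1 = 0" "M 2 c0 = 0" "M 2 c1 = 0" "M 2 c3 = 0"
    using c0 c1 c3 col[OF c0(1)] col[OF c1(1)] col[OF c3(1)] by auto
  \<comment> \<open>With the zeros found so far, the coefficient of T_c1 T_c3 T_2 reduces to
    \<open>M 0 2 * M 1 c1 * M 3 c3\<close>, and that of T_c0 T_c3 T_2 to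
    \<open>M 1 2 * M 0 c0 * M 3 c3\<close>.\<close>
  have z2: "M 0 2 = 0" "M 1 2 = 0"
    using coeffs(2)[OF c1(1) c3(1) ne(3)] coeffs(2)[OF c0(1) c3(1) ne(2)] c0 c1 c3 z
    by (auto simp: sym3_def A_def)
  have full: "lin a coords = a c0 * coords c0 + a c1 * coords c1 + a c3 * coords c3 + a 2 * coords 2" for a
    using c0(1) c1(1) c3(1) ne by (auto simp: lin4)
  have f: "\<phi> = M 0 c0 * coords c0" "\<phi> * \<sigma> x = M 1 c1 * coords c1" "\<phi> * \<sigma> y = M 2 2 * y"
    using L(1-3) unfolding full z z2 coords_mem by simp_all
  have n: "M 0 c0 * coords c0 \<noteq> 0" using c0(2) coords_mem(6) by simp
  have g: "\<sigma> x * (M 0 c0 * coords c0) = M 1 c1 * coords c1" "\<sigma> y * (M 0 c0 * coords c0) = M 2 2 * y"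
    by (metis f mult.commute)+
  have "\<sigma> x = (M 1 c1 / M 0 c0) * (coords c1 / coords c0)" "\<sigma> y = (M 2 2 / M 0 c0) * (y / coords c0)"
    unfolding times_divide_times_eq nonzero_eq_divide_eq[OF n] by (fact g)+
  moreover have "M 1 c1 / M 0 c0 \<in> K" "M 2 2 / M 0 c0 \<in> K" using KD(10)[OF MK MK] by blast+
  ultimately show ?thesis using c0(1) c1(1) ne(1) by blast
qed

section \<open>The generators and the permutations of the coordinates\<close>

lemma x_pow_indep: assumes "a \<in> K" "b \<in> K" "a * x ^ m + b = 0" shows "a = 0" "b = 0"
proof -
  have "poly (monom a m + [:b:]) x = 0" using assms by (simp add: poly_monom)
  moreover have "poly_over K (monom a m + [:b:])" using assms by (intro poK) (auto simp: poly_over_pCons poK)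
  ultimately have z: "monom a m + [:b:] = 0" using x_poly by blast
  then have "coeff (monom a m + [:b:]) m = 0" "coeff (monom a m + [:b:]) 0 = 0" by simp_all
  then show "a = 0" "b = 0" using m by (auto simp: coeff_pCons split: nat.splits if_splits)
qed

text \<open>Applying \<open>\<tau>\<close> to x^m + z^m + 1 = 0 multiplies the first two terms by
  \<gamma>^m and \<mu>^m and fixes the third. Since x^m and 1 are independent over K, both factors
  are 1, and \<delta>^3 = \<gamma>\<mu>.\<close>

lemma diagonal_roots:
  assumes \<tau>: "\<tau> \<in> rel_auts K" and K: "\<gamma> \<in> K" "\<delta> \<in> K" and xy: "\<tau> x = \<gamma> * x" "\<tau> y = \<delta> * y"
  shows "\<gamma> ^ m = 1" "\<delta> ^ (3 * m) = 1"
proof -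
  note T = rel_autsD[OF \<tau>]
  have g0: "\<gamma> \<noteq> 0" using xy(1) T(12)[of x] nz by auto
  define \<mu> where "\<mu> = \<delta> ^ 3 / \<gamma>"
  have \<mu>K: "\<mu> \<in> K" using K KD by (simp add: \<mu>_def)
  have tz: "\<tau> z = \<mu> * z" unfolding z_def T(10,11) xy by (simp add: \<mu>_def power_mult_distrib)
  have zm: "z ^ m = - 1 - x ^ m" using xz by (simp add: eq_diff_eq eq_neg_iff_add_eq_0 algebra_simps)
  have "\<tau> (x ^ m + z ^ m + 1) = 0" by (simp add: xz T(5))
  then have "\<gamma> ^ m * x ^ m + \<mu> ^ m * z ^ m + 1 = 0" by (simp add: T(2,4,11) xy tz power_mult_distrib)
  then have e: "(\<gamma> ^ m - \<mu> ^ m) * x ^ m + (1 - \<mu> ^ m) = 0" unfolding zm by (simp add: algebra_simps)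
  have k: "\<gamma> ^ m - \<mu> ^ m \<in> K" "1 - \<mu> ^ m \<in> K" using K \<mu>K KD by auto
  have \<mu>1: "\<mu> ^ m = 1" using x_pow_indep(2)[OF k e] by simp
  then show g1: "\<gamma> ^ m = 1" using x_pow_indep(1)[OF k e] by simp
  have "\<delta> ^ 3 = \<gamma> * \<mu>" using g0 by (simp add: \<mu>_def)
  then show "\<delta> ^ (3 * m) = 1" by (simp add: power_mult power_mult_distrib \<mu>1 g1)
qed

lemma y_div_x_power: "(y / x) ^ (3 * m) = - (inverse x ^ m) - (inverse x ^ m) ^ 2"
proof -
  have "x ^ (3 * m) = (x ^ m) ^ 3" by (metis power_mult mult.commute)
  then show ?thesis unfolding power_divide eq_factored using nz
    by (simp add: power_inverse field_simps eval_nat_numeral)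
qed

lemma theta2_exists: "\<exists>\<sigma>\<in>rel_auts K. \<sigma> x = 1 / x \<and> \<sigma> y = y / x"
proof (rule new_pair)
  show "1 / x \<notin> K"
  proof
    assume "1 / x \<in> K"
    then have "inverse (1 / x) \<in> K" by (rule KD)
    then show False using x_notin by simp
  qed
  show "(y / x) ^ (3 * m) + (1 / x) ^ (2 * m) + (1 / x) ^ m = 0"
    unfolding y_div_x_power by (simp add: inverse_eq_divide power_mult[symmetric] mult.commute)
  fix S assume S: "subfield S" "1 / x \<in> S" "y / x \<in> S"
  have "1 / (1 / x) \<in> S" using subfieldD(10)[OF S(1) subfieldD(1)[OF S(1)] S(2)] .
  then have x: "x \<in> S" by simp
  have "y / x * x \<in> S" using subfieldD(4)[OF S(1) S(3) x] .
  then show "x \<in> S \<and> y \<in> S" using x nz by simp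
qed

text \<open>As y^3/x^2 = z/x, this map takes (1 : x : y : z) to (x : z : y : 1) up to a common
  factor: it cycles 1, x, z and fixes the coordinate y.\<close>

lemma theta3_exists: "\<exists>\<sigma>\<in>rel_auts K. \<sigma> x = y ^ 3 / x ^ 2 \<and> \<sigma> y = y / x"
proof (rule new_pair)
  have a: "y ^ 3 / x ^ 2 = z / x" using nz by (simp add: z_def power2_eq_square)
  show "y ^ 3 / x ^ 2 \<notin> K"
  proof
    assume h: "y ^ 3 / x ^ 2 \<in> K"
    have "0 + (- (y ^ 3 / x ^ 2)) * x + 0 * y + 1 * z = 0" unfolding a using nz by simp
    from V_indep(4)[OF KD(2) KD(5)[OF h] KD(2) KD(1) this] show False by simp
  qed
  show "(y / x) ^ (3 * m) + (y ^ 3 / x ^ 2) ^ (2 * m) + (y ^ 3 / x ^ 2) ^ m = 0"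
  proof -
    have "(y ^ 3 / x ^ 2) ^ (2 * m) = ((z / x) ^ m) ^ 2" unfolding a by (simp add: power_mult[symmetric] mult.commute)
    then show ?thesis unfolding a y_div_x_power zx_power by (simp add: power2_eq_square algebra_simps)
  qed
  fix S assume S: "subfield S" "y ^ 3 / x ^ 2 \<in> S" "y / x \<in> S"
  have "(y ^ 3 / x ^ 2) / (y / x) ^ 3 \<in> S" by (rule subfieldD(10)[OF S(1) S(2) subfieldD(7)[OF S(1) S(3)]])
  moreover have "(y ^ 3 / x ^ 2) / (y / x) ^ 3 = x" using nz by (simp add: field_simps eval_nat_numeral)
  ultimately have x: "x \<in> S" by simp
  have "y / x * x \<in> S" using subfieldD(4)[OF S(1) S(3) x] .
  then show "x \<in> S \<and> y \<in> S" using x nz by simp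
qed

definition generators :: "('a \<Rightarrow> 'a) set" where
  "generators = {\<sigma> \<in> rel_auts K.
     (\<exists>\<gamma>\<in>K. \<exists>\<delta>\<in>K. \<gamma> ^ m = 1 \<and> \<delta> ^ (q + 1) = 1 \<and> \<sigma> x = \<gamma> * x \<and> \<sigma> y = \<delta> * y)
     \<or> (\<sigma> x = 1 / x \<and> \<sigma> y = y / x) \<or> (\<sigma> x = y ^ 3 / x ^ 2 \<and> \<sigma> y = y / x)}"

lemma gen_perm_group_subset: "g \<in> gen_perm_group generators \<Longrightarrow> g \<in> rel_auts K"
proof (induction rule: gen_perm_group.induct)
  case gen_id
  show ?case by (rule rel_auts_id)
next
  case (gen_base s)
  then show ?case by (simp add: generators_def)
next
  case (gen_comp a b)
  then show ?case by (intro rel_auts_comp)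
next
  case (gen_inv a)
  then show ?case by (intro rel_auts_inv)
qed

text \<open>Up to a common factor, \<open>s\<close> exchanges 1 and x while \<open>t\<close> cycles
  1, x, z. They generate all six permutations of these coordinates, and each one is determined by
  the images of the first two, \<open>c0\<close> and \<open>c1\<close>.\<close>

lemma permutation_realised:
  assumes "c0 \<in> {0, 1, 3}" "c1 \<in> {0, 1, 3}" "c0 \<noteq> c1"
  shows "\<exists>g\<in>gen_perm_group generators. g x = coords c1 / coords c0 \<and> g y = y / coords c0"
proof -
  obtain s where s: "s \<in> rel_auts K" "s x = 1 / x" "s y = y / x" using theta2_exists by blast
  obtain t where t: "t \<in> rel_auts K" "t x = y ^ 3 / x ^ 2" "t y = y / x" using theta3_exists by blast
  have G: "s \<in> gen_perm_group generators" "t \<in> gen_perm_group generators"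
    using s t by (auto intro!: gen_base simp: generators_def)
  note C = gen_perm_group.gen_comp
  note S = rel_autsD(4,10,11)[OF s(1)] and T = rel_autsD(4,10,11)[OF t(1)]
  have tx: "t x = z / x" using t(2) nz by (simp add: z_def power2_eq_square)
  have sz: "s z = z / x" unfolding z_def S s using nz by (simp add: field_simps eval_nat_numeral)
  have tz: "t z = 1 / x" unfolding z_def T t using nz by (simp add: field_simps eval_nat_numeral)
  consider "c0 = 0" "c1 = 1" | "c0 = 1" "c1 = 0" | "c0 = 1" "c1 = 3" | "c0 = 3" "c1 = 0" | "c0 = 0" "c1 = 3" | "c0 = 3" "c1 = 1"
    using assms by auto
  then show ?thesis
  proof cases
    case 1 then show ?thesis by (intro bexI[OF _ gen_perm_group.gen_id]) (simp add: coords_mem)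
  next
    case 2 then show ?thesis by (intro bexI[OF _ G(1)]) (simp add: coords_mem s)
  next
    case 3 then show ?thesis by (intro bexI[OF _ G(2)]) (simp add: coords_mem tx t(3))
  next
    case 4 then show ?thesis using nz z_nz
      by (intro bexI[OF _ C[OF G(2) G(2)]]) (simp add: coords_mem tx tz T t(3))
  next
    case 5 then show ?thesis using nz z_nz
      by (intro bexI[OF _ C[OF G(1) G(2)]]) (simp add: coords_mem tx sz S s t(3))
  next
    case 6 then show ?thesis using nz z_nz
      by (intro bexI[OF _ C[OF G(2) G(1)]]) (simp add: coords_mem tx T s t(3))
  qed
qed

text \<open>A monomial automorphism is a permutation of the coordinates composed with a diagonal
  one. The former comes from \<open>permutation_realised\<close>; the latter is itself a generator
  by \<open>diagonal_roots\<close>.\<close>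

theorem rel_auts_generated: "rel_auts K = gen_perm_group generators"
proof (intro equalityI subsetI)
  fix \<sigma> assume \<sigma>: "\<sigma> \<in> rel_auts K"
  obtain c0 c1 \<gamma> \<delta> where c: "c0 \<in> {0, 1, 3}" "c1 \<in> {0, 1, 3}" "c0 \<noteq> c1" "\<gamma> \<in> K" "\<delta> \<in> K"
    "\<sigma> x = \<gamma> * (coords c1 / coords c0)" "\<sigma> y = \<delta> * (y / coords c0)"
    using monomial_form[OF \<sigma>] by blast
  obtain g where g: "g \<in> gen_perm_group generators" "g x = coords c1 / coords c0" "g y = y / coords c0"
    using permutation_realised[OF c(1-3)] by blast
  have gR: "g \<in> rel_auts K" using gen_perm_group_subset[OF g(1)] .
  note D = rel_autsD[OF gR] and I = rel_autsD[OF rel_auts_inv[OF gR]]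
  define \<tau> where "\<tau> = inv g \<circ> \<sigma>"
  have \<tau>: "\<tau> \<in> rel_auts K" unfolding \<tau>_def by (rule rel_auts_comp[OF rel_auts_inv[OF gR] \<sigma>])
  have left: "inv g (g u) = u" for u using bij_is_inj[OF D(1)] by simp
  have "\<tau> x = \<gamma> * x" "\<tau> y = \<delta> * y"
    unfolding \<tau>_def comp_def c(6,7) g(2,3)[symmetric] I(3) left I(6)[OF c(4)] I(6)[OF c(5)] by simp_all
  then have "\<tau> \<in> generators" using diagonal_roots[OF \<tau> c(4,5)] \<tau> c(4,5) qm by (auto simp: generators_def)
  then have "g \<circ> \<tau> \<in> gen_perm_group generators"
    by (rule gen_perm_group.gen_comp[OF g(1) gen_perm_group.gen_base])
  moreover have "g \<circ> \<tau> = \<sigma>" using bij_is_surj[OF D(1)] by (auto simp: \<tau>_def fun_eq_iff surj_f_inv_f)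
  ultimately show "\<sigma> \<in> gen_perm_group generators" by simp
qed (rule gen_perm_group_subset)

end

theorem theorem6p5:
  fixes q p e :: nat and K :: "('f::field) set" and x y :: 'f
  assumes "prime p" and "e > 0" and "q = p ^ e" and "odd q" and "q \<ge> 11" and "q mod 3 = 2"
    and "of_nat p = (0::'f)"
    and "alg_closed_subfield K"
    and "\<forall>a\<in>K. \<exists>n>0. a ^ (p ^ n) = a"
    and "transcendental_over K x"
    and "generates_field (K \<union> {x, y})"
    and "y ^ (q + 1) + x ^ (2 * ((q + 1) div 3)) + x ^ ((q + 1) div 3) = 0"
  shows "rel_auts K = gen_perm_group
           {\<sigma> \<in> rel_auts K.
              (\<exists>\<gamma>\<in>K. \<exists>\<delta>\<in>K. \<gamma> ^ ((q + 1) div 3) = 1 \<and> \<delta> ^ (q + 1) = 1 \<and>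
                  \<sigma> x = \<gamma> * x \<and> \<sigma> y = \<delta> * y)
            \<or> (\<sigma> x = 1 / x \<and> \<sigma> y = y / x)
            \<or> (\<sigma> x = y ^ 3 / x ^ 2 \<and> \<sigma> y = y / x)}"
proof -
  define m where "m = (q + 1) div 3"
  have qm: "q + 1 = 3 * m" using assms(6) unfolding m_def by presburger
  have "curve_field K p e q m x y"
  proof unfold_locales
    show "even m" using qm assms(4) by presburger
    show "m \<ge> 4" using qm assms(5) by simp
    show "y ^ (3 * m) + x ^ (2 * m) + x ^ m = 0" using assms(12) unfolding qm[symmetric] unfolding m_def .
  qed (use assms qm in auto)
  then interpret curve_field K p e q m x y .
  show ?thesis using rel_auts_generated unfolding generators_def unfolding m_def .
qed

end
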